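(* Let $M,N\ge 0$ be integers with $2M+N\ge 2$, let $L=\langle a_1,\dots,a_M,b_1,\dots,b_N\mid b_1^2,\dots,b_N^2\rangle$ with generating set $X=\{a_1^{\pm1},\dots,a_M^{\pm1},b_1,\dots,b_N\}$, and let $G$ be a group with finite symmetric generating set $Y$. Let $\tilde\sigma^A_{(G\wr L,\vec Y)}(z)$ be the contribution to the conjugacy growth series of $(G\wr L,\vec Y)$ of the conjugacy classes of elements whose cursor has infinite order. Then $$\tilde\sigma^A_{(G\wr L,\vec Y)}(z)=\sum_{r\ge 1}\frac{\phi(r)}{r}\sum_{s\ge 1}\frac{(2M+N-1)^s+(-1)^s(M+N-1)+M}{s}\,\bigl(F_E(z^r)\bigr)^s,$$ where $\phi$ is Euler's totient function and $$F_E(z):=z\,\sigma_{(G,Y)}(z)\,\Bigl(F_{\mathscr T}\bigl(z^2\sigma_{(G,Y)}(z),\,z^2(\sigma_{(G,Y)}(z)-1)\bigr)\Bigr)^{2M+N-2}.$$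
   Context: Wreath product. $e,e'$ are the neutral elements of $G,L$. $G\wr L=\bigl(\bigoplus_{i\in L}G\bigr)\rtimes L$ with product $(\eta,m)(\theta,n)=(\eta\theta^m,mn)$, where $\theta^m(i)=\theta(m^{-1}i)$. For $(\eta,b)\in G\wr L$, the element $b\in L$ is called the cursor. For $g\in G$, $\vec g\in\bigoplus_{i\in L}G$ has value $g$ at $e'$ and $e$ elsewhere. The generating set is $\vec Y=\{(\vec e,x):x\in X\}\cup\{(\vec y,e'):y\in Y\}$. Growth series. For a group $H$ with finite symmetric generating set $Z$, $|h|_Z$ is the word length. The standard growth series is $\sigma_{(H,Z)}(z)=\sum_{n\ge0}\#\{h\in H:|h|_Z=n\}z^n$. The length of a conjugacy class is the minimum of $|h|_Z$ over its elements $h$; the conjugacy growth series $\tilde\sigma_{(H,Z)}(z)$ has as coefficient of $z^n$ the number of conjugacy classes of length $n$. The contribution of a family of conjugacy classes is the power series whose coefficient of $z^n$ is the number of classes in the family of length $n$. The series $F_{\mathscr T}$. The Cayley graph $\mathrm{Cay}(L,X)$ is the $(2M+N)$-regular tree. Fix $v\in X$ and let $\mathscr T$ be the set of all finite subtrees of $\mathrm{Cay}(L,X)$ containing $e'$ and containing no vertex adjacent to $e'$ other than possibly $v$. A leaf of a finite tree is a vertex of valence $0$ or $1$ in it. Then $F_{\mathscr T}(x,y)=\sum_{i,j\ge0}a_{ij}x^iy^j$, where $a_{ij}$ is the number of $T\in\mathscr T$ with exactly $i$ non-leaves and exactly $j$ leaves other than $e'$. This does not depend on $v$, and it satisfies $F_{\mathscr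 T}(x,y)=1+y-x+xF_{\mathscr T}(x,y)^{2M+N-1}$. *)

theory Defs
  imports
    "HOL-Algebra.Generated_Groups"
    "HOL-Algebra.Multiplicative_Group"
    "HOL-Algebra.Product_Groups"
    "HOL-Computational_Algebra.Formal_Power_Series"
    "HOL-Number_Theory.Totient"
begin

section \<open>Groups given by generators and relators\<close>

text \<open>The letter \<open>(s, True)\<close> stands for the generator \<open>s\<close>, and \<open>(s, False)\<close> for its inverse.\<close>

type_synonym 'a gword = "('a \<times> bool) list"

definition gwords :: "'a set \<Rightarrow> 'a gword set" where
  "gwords S = lists (S \<times> UNIV)"

inductive_set pres_rel :: "'a set \<Rightarrow> 'a gword set \<Rightarrow> ('a gword \<times> 'a gword) set"
  for S :: "'a set" and R :: "'a gword set" where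
  refl: "w \<in> gwords S \<Longrightarrow> (w, w) \<in> pres_rel S R"
| sym: "(u, w) \<in> pres_rel S R \<Longrightarrow> (w, u) \<in> pres_rel S R"
| trans: "(u, w) \<in> pres_rel S R \<Longrightarrow> (w, t) \<in> pres_rel S R \<Longrightarrow> (u, t) \<in> pres_rel S R"
| cancel: "u \<in> gwords S \<Longrightarrow> w \<in> gwords S \<Longrightarrow> s \<in> S \<Longrightarrow>
    (u @ [(s, p), (s, \<not> p)] @ w, u @ w) \<in> pres_rel S R"
| relator: "u \<in> gwords S \<Longrightarrow> w \<in> gwords S \<Longrightarrow> r \<in> R \<Longrightarrow> r \<in> gwords S \<Longrightarrow>
    (u @ r @ w, u @ w) \<in> pres_rel S R"

definition presented_group :: "'a set \<Rightarrow> 'a gword set \<Rightarrow> 'a gword set monoid" where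
  "presented_group S R =
     \<lparr>carrier = gwords S // pres_rel S R,
      monoid.mult = (\<lambda>A B. \<Union>u\<in>A. \<Union>w\<in>B. pres_rel S R `` {u @ w}),
      one = pres_rel S R `` {[]}\<rparr>"

section \<open>The group \<open>L\<close>\<close>

datatype lgen = GenA nat | GenB nat

definition L_syms :: "nat \<Rightarrow> nat \<Rightarrow> lgen set" where
  "L_syms M N = GenA ` {..<M} \<union> GenB ` {..<N}"

definition L_rels :: "nat \<Rightarrow> lgen gword set" where
  "L_rels N = {[(GenB j, True), (GenB j, True)] | j. j < N}"

definition L_group :: "nat \<Rightarrow> nat \<Rightarrow> lgen gword set monoid" where
  "L_group M N = presented_group (L_syms M N) (L_rels N)"

definition L_gens :: "nat \<Rightarrow> nat \<Rightarrow> lgen gword set set" where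
  "L_gens M N =
     {pres_rel (L_syms M N) (L_rels N) `` {[(GenA i, p)]} | i p. i < M} \<union>
     {pres_rel (L_syms M N) (L_rels N) `` {[(GenB j, True)]} | j. j < N}"

section \<open>Wreath products\<close>

text \<open>The base group is the library's restricted direct sum \<^const>\<open>sum_group\<close>, whose elements
  are extensional functions on \<^term>\<open>carrier L\<close>.\<close>

abbreviation wreath_base ::
    "('g, 'c) monoid_scheme \<Rightarrow> ('l, 'd) monoid_scheme \<Rightarrow> ('l \<Rightarrow> 'g) monoid" where
  "wreath_base G L \<equiv> sum_group (carrier L) (\<lambda>_. G)"

definition wreath_shift :: "('l, 'd) monoid_scheme \<Rightarrow> 'l \<Rightarrow> ('l \<Rightarrow> 'g) \<Rightarrow> 'l \<Rightarrow> 'g" where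
  "wreath_shift L m \<theta> = (\<lambda>i\<in>carrier L. \<theta> (inv\<^bsub>L\<^esub> m \<otimes>\<^bsub>L\<^esub> i))"

definition wreath ::
    "('g, 'c) monoid_scheme \<Rightarrow> ('l, 'd) monoid_scheme \<Rightarrow> (('l \<Rightarrow> 'g) \<times> 'l) monoid" where
  "wreath G L =
     \<lparr>carrier = carrier (wreath_base G L) \<times> carrier L,
      monoid.mult = (\<lambda>(\<eta>, m) (\<theta>, n). (\<eta> \<otimes>\<^bsub>wreath_base G L\<^esub> wreath_shift L m \<theta>, m \<otimes>\<^bsub>L\<^esub> n)),
      one = (\<one>\<^bsub>wreath_base G L\<^esub>, \<one>\<^bsub>L\<^esub>)\<rparr>"

abbreviation cursor :: "('l \<Rightarrow> 'g) \<times> 'l \<Rightarrow> 'l" where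
  "cursor \<equiv> snd"

definition wreath_vec ::
    "('g, 'c) monoid_scheme \<Rightarrow> ('l, 'd) monoid_scheme \<Rightarrow> 'g \<Rightarrow> 'l \<Rightarrow> 'g" where
  "wreath_vec G L g = (\<lambda>i\<in>carrier L. if i = \<one>\<^bsub>L\<^esub> then g else \<one>\<^bsub>G\<^esub>)"

definition wreath_gens ::
    "('g, 'c) monoid_scheme \<Rightarrow> ('l, 'd) monoid_scheme \<Rightarrow> 'g set \<Rightarrow> 'l set \<Rightarrow> (('l \<Rightarrow> 'g) \<times> 'l) set" where
  "wreath_gens G L Y X =
     {(wreath_vec G L \<one>\<^bsub>G\<^esub>, x) | x. x \<in> X} \<union> {(wreath_vec G L y, \<one>\<^bsub>L\<^esub>) | y. y \<in> Y}"

section \<open>Growth series\<close>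

definition symmetric_generating_set :: "('h, 'c) monoid_scheme \<Rightarrow> 'h set \<Rightarrow> bool" where
  "symmetric_generating_set H Z \<longleftrightarrow>
     Z \<subseteq> carrier H \<and> (\<forall>z\<in>Z. inv\<^bsub>H\<^esub> z \<in> Z) \<and> generate H Z = carrier H"

text \<open>Only words in \<open>Z\<close> itself, not in \<open>Z \<union> Z\<^sup>-\<^sup>1\<close>, are considered, so these notions are only
  meaningful for symmetric generating sets \<open>Z\<close>.\<close>

definition word_length :: "('h, 'c) monoid_scheme \<Rightarrow> 'h set \<Rightarrow> 'h \<Rightarrow> nat" where
  "word_length H Z h =
     (LEAST n. \<exists>ws. set ws \<subseteq> Z \<and> length ws = n \<and> foldr (\<otimes>\<^bsub>H\<^esub>) ws \<one>\<^bsub>H\<^esub> = h)"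

definition growth_series :: "('h, 'c) monoid_scheme \<Rightarrow> 'h set \<Rightarrow> rat fps" where
  "growth_series H Z = Abs_fps (\<lambda>n. of_nat (card {h \<in> carrier H. word_length H Z h = n}))"

definition conj_class :: "('h, 'c) monoid_scheme \<Rightarrow> 'h \<Rightarrow> 'h set" where
  "conj_class H h = {k \<otimes>\<^bsub>H\<^esub> h \<otimes>\<^bsub>H\<^esub> inv\<^bsub>H\<^esub> k | k. k \<in> carrier H}"

definition class_length :: "('h, 'c) monoid_scheme \<Rightarrow> 'h set \<Rightarrow> 'h set \<Rightarrow> nat" where
  "class_length H Z C = (LEAST n. \<exists>h\<in>C. word_length H Z h = n)"

text \<open>The contribution of a family \<open>\<C>\<close> of conjugacy classes to the conjugacy growth series.\<close>

definition conj_contribution :: "('h, 'c) monoid_scheme \<Rightarrow> 'h set \<Rightarrow> 'h set set \<Rightarrow> rat fps" where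
  "conj_contribution H Z \<C> = Abs_fps (\<lambda>n. of_nat (card {C \<in> \<C>. class_length H Z C = n}))"

text \<open>Elements of infinite order are those with \<^const>\<open>group.ord\<close> equal to \<open>0\<close>.\<close>

definition infinite_cursor_classes ::
    "('g, 'c) monoid_scheme \<Rightarrow> ('l, 'd) monoid_scheme \<Rightarrow> (('l \<Rightarrow> 'g) \<times> 'l) set set" where
  "infinite_cursor_classes G L =
     {conj_class (wreath G L) w | w. w \<in> carrier (wreath G L) \<and> group.ord L (cursor w) = 0}"

section \<open>Subtrees of Cayley graphs\<close>

text \<open>Graphs are undirected: an edge is the set of its endpoints. The Cayley graph is the right one,
  on which \<open>H\<close> acts by left translations. This matches the wreath product: multiplying
  \<open>(\<eta>, m)\<close> on the right by a generator coming from \<open>x\<close> moves the cursor from \<open>m\<close> to \<open>m x\<close>.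
  Generators are assumed to be nontrivial, as they are for \<open>L\<close>, so there are no loops, and cycles
  have length at least \<open>3\<close>.\<close>

type_synonym 'v ugraph = "'v set \<times> 'v set set"

definition cayley_graph :: "('h, 'c) monoid_scheme \<Rightarrow> 'h set \<Rightarrow> 'h ugraph" where
  "cayley_graph H Z = (carrier H, {{g, g \<otimes>\<^bsub>H\<^esub> x} | g x. g \<in> carrier H \<and> x \<in> Z})"

definition is_subgraph :: "'v ugraph \<Rightarrow> 'v ugraph \<Rightarrow> bool" where
  "is_subgraph T \<Gamma> \<longleftrightarrow> fst T \<subseteq> fst \<Gamma> \<and> snd T \<subseteq> snd \<Gamma> \<and> (\<forall>e\<in>snd T. e \<subseteq> fst T)"

definition ug_connected :: "'v ugraph \<Rightarrow> bool" where
  "ug_connected T \<longleftrightarrow> fst T \<noteq> {} \<and>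
     (\<forall>u\<in>fst T. \<forall>w\<in>fst T. (u, w) \<in> {(p, q). {p, q} \<in> snd T}\<^sup>*)"

definition ug_cycle :: "'v ugraph \<Rightarrow> 'v list \<Rightarrow> bool" where
  "ug_cycle T vs \<longleftrightarrow> 3 \<le> length vs \<and> distinct vs \<and>
     (\<forall>i. Suc i < length vs \<longrightarrow> {vs ! i, vs ! Suc i} \<in> snd T) \<and> {last vs, hd vs} \<in> snd T"

definition is_tree :: "'v ugraph \<Rightarrow> bool" where
  "is_tree T \<longleftrightarrow> ug_connected T \<and> \<not> (\<exists>vs. ug_cycle T vs)"

definition valence :: "'v ugraph \<Rightarrow> 'v \<Rightarrow> nat" where
  "valence T u = card {e \<in> snd T. u \<in> e}"

definition leaves :: "'v ugraph \<Rightarrow> 'v set" where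
  "leaves T = {u \<in> fst T. valence T u \<le> 1}"

definition subtrees_at :: "('h, 'c) monoid_scheme \<Rightarrow> 'h set \<Rightarrow> 'h \<Rightarrow> 'h ugraph set" where
  "subtrees_at H Z v =
     {T. is_subgraph T (cayley_graph H Z) \<and> is_tree T \<and> finite (fst T) \<and> \<one>\<^bsub>H\<^esub> \<in> fst T \<and>
         (\<forall>u\<in>fst T. {\<one>\<^bsub>H\<^esub>, u} \<in> snd (cayley_graph H Z) \<longrightarrow> u = v)}"

definition subtree_count :: "('h, 'c) monoid_scheme \<Rightarrow> 'h set \<Rightarrow> 'h \<Rightarrow> nat \<Rightarrow> nat \<Rightarrow> nat" where
  "subtree_count H Z v i j =
     card {T \<in> subtrees_at H Z v. card (fst T - leaves T) = i \<and> card (leaves T - {\<one>\<^bsub>H\<^esub>}) = j}"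

text \<open>A bivariate power series is represented by its coefficients. The series
  \<open>\<Sum>i j. a i j * f ^ i * g ^ j\<close> is defined in the same way as \<^const>\<open>fps_compose\<close>: for \<open>f\<close> and
  \<open>g\<close> without constant term, terms with \<open>i > n\<close> or \<open>j > n\<close> do not contribute to the \<open>n\<close>-th
  coefficient.\<close>

definition fps_compose2 :: "(nat \<Rightarrow> nat \<Rightarrow> 'a) \<Rightarrow> 'a fps \<Rightarrow> 'a fps \<Rightarrow> 'a::comm_ring_1 fps" where
  "fps_compose2 a f g =
     Abs_fps (\<lambda>n. \<Sum>i=0..n. \<Sum>j=0..n. a i j * fps_nth (f ^ i * g ^ j) n)"

definition F_T :: "nat \<Rightarrow> nat \<Rightarrow> lgen gword set \<Rightarrow> rat fps \<Rightarrow> rat fps \<Rightarrow> rat fps" where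
  "F_T M N v f g =
     fps_compose2 (\<lambda>i j. of_nat (subtree_count (L_group M N) (L_gens M N) v i j)) f g"

definition F_E ::
    "nat \<Rightarrow> nat \<Rightarrow> lgen gword set \<Rightarrow> ('g, 'c) monoid_scheme \<Rightarrow> 'g set \<Rightarrow> rat fps" where
  "F_E M N v G Y =
     (let S = growth_series G Y
      in fps_X * S * F_T M N v (fps_X\<^sup>2 * S) (fps_X\<^sup>2 * (S - 1)) ^ (2 * M + N - 2))"

end

theory Submission
  imports Defs "HOL-Library.Sublist"
begin

text \<open>
  The Cayley graph of \<open>L\<close> is a tree, and an element \<open>(\<eta>, b)\<close> of the wreath product is a finitely
  supported labelling \<open>\<eta>\<close> of its vertices together with an end position \<open>b\<close> of the cursor. If \<open>b\<close> has
  infinite order, it translates the tree along an axis. Conjugating by a labelling moves the labels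
  along the orbits of \<open>b\<close>, so that only their ordered product along each orbit matters, and
  conjugating by an element of \<open>L\<close> moves the axis. A conjugacy class is therefore, up to rotation, a
  labelling of the quotient of the tree by \<open>b\<close>, which is a cycle with \<open>2M+N-2\<close> trees hanging from
  each of its vertices. Its length is that of a shortest closed walk that goes once
  around the cycle and does the labelling on the way: one step for each edge of the cycle, two for
  every edge of the hanging trees that has to be visited, and the word lengths of the labels.

  This picture is encoded by words whose letters are pairs \<open>(x, f)\<close> of a generator \<open>x\<close> of \<open>L\<close> and a
  labelling \<open>f\<close>; such a letter stands for the element \<open>(1, x) (f, 1)\<close>. A word is \<open>good\<close> if its
  generators form a cyclically reduced word and each \<open>f\<close> lives on the vertex of the cycle and the
  trees hanging there. Every class with infinite cursor contains a good word that is not heavier than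
  a shortest element of the class (\<open>good_representative\<close>): a word that is not good can be simplified
  without becoming heavier. Good words with conjugate values are rotations of each other
  (\<open>good_conj_rotation\<close>). Hence the classes are necklaces of decorated letters.

  One decorated letter has the series \<open>F_E\<close>. The factor for one hanging tree is obtained by
  sorting labellings of a branch by the subtree that they span (\<open>gf_branch_funs\<close>): values at
  leaves must be nontrivial, values elsewhere are arbitrary. The series is the same for all branches,
  although the branches at different generators are not translates of each other, because a recursion
  determines it (\<open>gf_branch_funs_eq\<close>). The number of cyclically reduced words of length \<open>s\<close> is the
  trace of \<open>(J - P)\<^sup>s\<close>, where \<open>J\<close> is the all-one matrix on the generators and \<open>P\<close> the permutation
  matrix of inversion (\<open>card_cyc_words\<close>); this is the numerator in the theorem. Finally, Burnside's
  lemma for rotations counts necklaces (\<open>card_necklaces\<close>): a word of length \<open>r s\<close> fixed by the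
  rotation by \<open>s\<close> is an \<open>r\<close>-th power, whence the substitution of \<open>z\<^sup>r\<close>, and
  there are \<open>\<phi>(r)\<close> rotations \<open>i\<close> with \<open>gcd i (r s) = s\<close>.
\<close>

unbundle fps_syntax

section \<open>Generating series of weighted sets\<close>

text \<open>An infinite level would be counted as \<open>0\<close>; \<open>fin_levels\<close> below excludes this.\<close>

definition gf :: "'a set \<Rightarrow> ('a \<Rightarrow> nat) \<Rightarrow> rat fps" where
  "gf A w = Abs_fps (\<lambda>n. of_nat (card {a \<in> A. w a = n}))"

definition fin_levels :: "'a set \<Rightarrow> ('a \<Rightarrow> nat) \<Rightarrow> bool" where
  "fin_levels A w \<longleftrightarrow> (\<forall>n. finite {a \<in> A. w a = n})"

lemma gf_nth: "gf A w $ n = of_nat (card {a \<in> A. w a = n})"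
  by (simp add: gf_def)

lemma fin_levels_le:
  assumes "fin_levels A w" shows "finite {a \<in> A. w a \<le> n}"
proof -
  have "{a \<in> A. w a \<le> n} = (\<Union>k\<le>n. {a \<in> A. w a = k})" by auto
  thus ?thesis using assms by (simp add: fin_levels_def)
qed

text \<open>Besides passing to subsets, this transfers finiteness to any larger weight; word lengths enter
  in this way.\<close>

lemma fin_levels_subset:
  assumes "fin_levels B w" "A \<subseteq> B" "\<And>a. a \<in> A \<Longrightarrow> w a \<le> w' a"
  shows "fin_levels A w'"
  unfolding fin_levels_def
proof
  fix n
  have "{a \<in> A. w' a = n} \<subseteq> {a \<in> B. w a \<le> n}" using assms by auto
  thus "finite {a \<in> A. w' a = n}" using fin_levels_le[OF assms(1)] finite_subset by blast
qed

lemma bij_betw_level: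
  assumes "bij_betw h A B" "\<And>a. a \<in> A \<Longrightarrow> w' (h a) = w a"
  shows "bij_betw h {a \<in> A. w a = n} {b \<in> B. w' b = n}"
proof -
  have "h ` {a \<in> A. w a = n} = {b \<in> B. w' b = n}"
    using assms by (auto simp: bij_betw_def)
  thus ?thesis using assms(1) by (auto simp: bij_betw_def inj_on_def)
qed

lemma gf_bij:
  assumes "bij_betw h A B" "\<And>a. a \<in> A \<Longrightarrow> w' (h a) = w a"
  shows "gf A w = gf B w'"
proof (rule fps_ext)
  fix n
  show "gf A w $ n = gf B w' $ n"
    using bij_betw_same_card[OF bij_betw_level[where w = w and w' = w' and n = n, OF assms]]
    by (simp add: gf_nth)
qed

lemma fin_levels_bij:
  assumes "bij_betw h A B" "\<And>a. a \<in> A \<Longrightarrow> w' (h a) = w a" "fin_levels A w"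
  shows "fin_levels B w'"
  unfolding fin_levels_def
proof
  fix n
  show "finite {b \<in> B. w' b = n}"
    using bij_betw_finite[OF bij_betw_level[where w = w and w' = w' and n = n, OF assms(1,2)]]
      assms(3) by (simp add: fin_levels_def)
qed

lemma gf_Un:
  assumes "fin_levels A w" "fin_levels B w" "A \<inter> B = {}"
  shows "gf (A \<union> B) w = gf A w + gf B w"
proof (rule fps_ext)
  fix n
  have "{a \<in> A \<union> B. w a = n} = {a \<in> A. w a = n} \<union> {a \<in> B. w a = n}" by auto
  moreover have "{a \<in> A. w a = n} \<inter> {a \<in> B. w a = n} = {}" using assms(3) by auto
  ultimately show "gf (A \<union> B) w $ n = (gf A w + gf B w) $ n"
    using assms(1,2) by (simp add: gf_nth fin_levels_def card_Un_disjoint)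
qed

lemma gf_UNION:
  assumes "finite I" "\<And>i. i \<in> I \<Longrightarrow> fin_levels (A i) w"
    "\<And>i j. i \<in> I \<Longrightarrow> j \<in> I \<Longrightarrow> i \<noteq> j \<Longrightarrow> A i \<inter> A j = {}"
  shows "gf (\<Union>i\<in>I. A i) w = (\<Sum>i\<in>I. gf (A i) w) \<and> fin_levels (\<Union>i\<in>I. A i) w"
  using assms
proof (induction I rule: finite_induct)
  case empty
  show ?case by (auto simp: gf_def fin_levels_def intro!: fps_ext)
next
  case (insert i I)
  have IH: "gf (\<Union>i\<in>I. A i) w = (\<Sum>i\<in>I. gf (A i) w)" "fin_levels (\<Union>i\<in>I. A i) w"
    using insert by auto
  have d: "A i \<inter> (\<Union>i\<in>I. A i) = {}"
  proof -
    have "A i \<inter> A j = {}" if "j \<in> I" for j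
      using insert.prems(2)[of i j] insert.hyps(2) that by blast
    thus ?thesis by blast
  qed
  have "fin_levels (\<Union>i\<in>insert i I. A i) w"
  proof -
    have "{a \<in> (\<Union>i\<in>insert i I. A i). w a = n} =
      {a \<in> A i. w a = n} \<union> {a \<in> (\<Union>i\<in>I. A i). w a = n}" for n by auto
    thus ?thesis using insert IH(2) by (simp add: fin_levels_def)
  qed
  thus ?case using gf_Un[OF _ IH(2) d] insert IH by simp
qed

lemma gf_singleton: "gf {a} w = fps_X ^ w a"
  by (rule fps_ext) (auto simp: gf_nth fps_X_power_nth conj_commute cong: conj_cong)

lemma fin_levels_finite: "finite A \<Longrightarrow> fin_levels A w"
  by (simp add: fin_levels_def)

lemma gf_shift: "gf A (\<lambda>a. k + w a) = fps_X ^ k * gf A w"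
proof (rule fps_ext)
  fix n
  have "{a \<in> A. k + w a = n} = (if n < k then {} else {a \<in> A. w a = n - k})" by auto
  thus "gf A (\<lambda>a. k + w a) $ n = (fps_X ^ k * gf A w) $ n"
    by (simp add: gf_nth fps_X_power_mult_nth)
qed

text \<open>Multiplying weights by \<open>r\<close> substitutes \<open>z\<^sup>r\<close>. This is how the \<open>r\<close>-th powers of words enter the count.\<close>

lemma gf_scale:
  assumes "r > 0"
  shows "gf A (\<lambda>a. r * w a) = fps_compose (gf A w) (fps_X ^ r)"
proof (rule fps_ext)
  fix n
  have "{a \<in> A. r * w a = n} = (if r dvd n then {a \<in> A. w a = n div r} else {})"
    using assms by auto
  moreover have "fps_compose (gf A w) (fps_X ^ r) $ n =
     (\<Sum>i=0..n. if n = r * i then gf A w $ i else 0)"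
    by (simp add: fps_compose_nth flip: power_mult) (auto simp: fps_X_power_nth intro!: sum.cong)
  moreover have "(\<Sum>i=0..n. if n = r * i then gf A w $ i else 0) =
     (if r dvd n then gf A w $ (n div r) else 0)"
  proof (cases "r dvd n")
    case True
    have "(\<Sum>i=0..n. if n = r * i then gf A w $ i else 0) =
          (\<Sum>i=0..n. if i = n div r then gf A w $ i else 0)"
      using assms True by (intro sum.cong) auto
    thus ?thesis using True by simp
  next
    case False
    thus ?thesis by (auto intro!: sum.neutral)
  qed
  ultimately show "gf A (\<lambda>a. r * w a) $ n = fps_compose (gf A w) (fps_X ^ r) $ n"
    by (simp add: gf_nth)
qed

lemma prod_levels:
  fixes w :: "'a \<Rightarrow> nat" and w' :: "'b \<Rightarrow> nat"
  shows
  "{p \<in> A \<times> B. w (fst p) + w' (snd p) = n} =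
   (\<Union>k\<in>{..n}. {a \<in> A. w a = k} \<times> {b \<in> B. w' b = n - k})"
  by auto

lemma fin_levels_Times:
  assumes "fin_levels A w" "fin_levels B w'"
  shows "fin_levels (A \<times> B) (\<lambda>p. w (fst p) + w' (snd p))"
  using assms unfolding fin_levels_def prod_levels by auto

lemma gf_Times:
  assumes "fin_levels A w" "fin_levels B w'"
  shows "gf (A \<times> B) (\<lambda>p. w (fst p) + w' (snd p)) = gf A w * gf B w'"
proof (rule fps_ext)
  fix n
  have "card {p \<in> A \<times> B. w (fst p) + w' (snd p) = n} =
     (\<Sum>k\<in>{..n}. card ({a \<in> A. w a = k} \<times> {b \<in> B. w' b = n - k}))"
    unfolding prod_levels using assms
    by (intro card_UN_disjoint) (auto simp: fin_levels_def)
  thus "gf (A \<times> B) (\<lambda>p. w (fst p) + w' (snd p)) $ n = (gf A w * gf B w') $ n"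
    by (simp add: gf_nth fps_mult_nth card_cartesian_product atLeast0AtMost)
qed

text \<open>Independent choices multiply. The index set will be the vertex set of a subtree.\<close>

lemma gf_PiE:
  assumes "finite I" "\<And>i. i \<in> I \<Longrightarrow> fin_levels (A i) (w i)"
  shows "gf (PiE I A) (\<lambda>f. \<Sum>i\<in>I. w i (f i)) = (\<Prod>i\<in>I. gf (A i) (w i)) \<and>
         fin_levels (PiE I A) (\<lambda>f. \<Sum>i\<in>I. w i (f i))"
  using assms
proof (induction I rule: finite_induct)
  case empty
  show ?case by (auto simp: gf_singleton[of "\<lambda>x. undefined"] fin_levels_def)
next
  case (insert i I)
  let ?h = "\<lambda>(y, g). g(i := y)"
  have IH: "gf (PiE I A) (\<lambda>f. \<Sum>i\<in>I. w i (f i)) = (\<Prod>i\<in>I. gf (A i) (w i))"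
    "fin_levels (PiE I A) (\<lambda>f. \<Sum>i\<in>I. w i (f i))"
    using insert by auto
  have bij: "bij_betw ?h (A i \<times> PiE I A) (PiE (insert i I) A)"
    unfolding bij_betw_def
    using inj_combinator[OF insert.hyps(2), of "A"] by (simp add: PiE_insert_eq)
  have weight: "(\<Sum>j\<in>insert i I. w j (?h p j)) = w i (fst p) + (\<Sum>j\<in>I. w j (snd p j))"
    if "p \<in> A i \<times> PiE I A" for p
    using insert(1,2) by (auto simp: case_prod_unfold intro!: sum.cong)
  note T = gf_Times[OF insert.prems[OF insertI1] IH(2)]
    fin_levels_Times[OF insert.prems[OF insertI1] IH(2)]
  show ?case
    using gf_bij[where w = "\<lambda>p. w i (fst p) + (\<Sum>j\<in>I. w j (snd p j))"
        and w' = "\<lambda>f. \<Sum>j\<in>insert i I. w j (f j)", OF bij weight]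
      fin_levels_bij[where w = "\<lambda>p. w i (fst p) + (\<Sum>j\<in>I. w j (snd p j))"
        and w' = "\<lambda>f. \<Sum>j\<in>insert i I. w j (f j)", OF bij weight T(2)]
      T(1) insert(1,2) IH by simp
qed

section \<open>Word length\<close>

context group begin

abbreviation ev :: "'a list \<Rightarrow> 'a" where "ev ws \<equiv> foldr (\<otimes>) ws \<one>"

lemma ev_closed [simp, intro]: "set ws \<subseteq> carrier G \<Longrightarrow> ev ws \<in> carrier G"
  by (induction ws) auto

lemma ev_append:
  "set us \<subseteq> carrier G \<Longrightarrow> set ws \<subseteq> carrier G \<Longrightarrow> ev (us @ ws) = ev us \<otimes> ev ws"
  by (induction us) (auto simp: m_assoc)

text \<open>Words of length at most \<open>n\<close>, because traversing a tree only yields upper bounds.\<close>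

definition has_word :: "'a set \<Rightarrow> nat \<Rightarrow> 'a \<Rightarrow> bool" where
  "has_word Z n h \<longleftrightarrow> (\<exists>ws. set ws \<subseteq> Z \<and> length ws \<le> n \<and> ev ws = h)"

lemma word_length_le: "has_word Z n h \<Longrightarrow> word_length G Z h \<le> n"
  unfolding has_word_def word_length_def by (auto intro: order.trans[OF Least_le])

lemma word_lengthE:
  assumes "has_word Z n h"
  obtains ws where "set ws \<subseteq> Z" "length ws = word_length G Z h" "ev ws = h"
proof -
  have "\<exists>m. \<exists>ws. set ws \<subseteq> Z \<and> length ws = m \<and> ev ws = h"
    using assms by (auto simp: has_word_def)
  from LeastI_ex[OF this] show thesis using that unfolding word_length_def by blast
qed

lemma has_word_length: "has_word Z n h \<Longrightarrow> has_word Z (word_length G Z h) h"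
  by (metis word_lengthE has_word_def order_refl)

lemma has_word_one: "has_word Z 0 \<one>"
  unfolding has_word_def by (rule exI[of _ "[]"]) auto

lemma word_length_one [simp]: "word_length G Z \<one> = 0"
  using word_length_le[OF has_word_one] by simp

lemma has_word_gen: "z \<in> Z \<Longrightarrow> Z \<subseteq> carrier G \<Longrightarrow> has_word Z 1 z"
  unfolding has_word_def by (rule exI[of _ "[z]"]) auto

lemma has_word_mult:
  assumes "Z \<subseteq> carrier G" "has_word Z m g" "has_word Z n h"
  shows "has_word Z (m + n) (g \<otimes> h)"
proof -
  obtain us ws where "set us \<subseteq> Z" "length us \<le> m" "ev us = g"
    "set ws \<subseteq> Z" "length ws \<le> n" "ev ws = h"
    using assms(2,3) by (auto simp: has_word_def)
  thus ?thesis unfolding has_word_def using assms(1)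
    by (intro exI[of _ "us @ ws"]) (auto simp del: foldr_append simp: ev_append)
qed

lemma word_length_mult:
  assumes "Z \<subseteq> carrier G" "has_word Z m g" "has_word Z n h"
  shows "word_length G Z (g \<otimes> h) \<le> word_length G Z g + word_length G Z h"
  by (intro word_length_le has_word_mult has_word_length assms has_word_length[OF assms(2)] has_word_length[OF assms(3)])

lemma fin_levels_word_length:
  assumes "finite Z" "\<And>h. h \<in> A \<Longrightarrow> \<exists>n. has_word Z n h"
  shows "fin_levels A (word_length G Z)"
  unfolding fin_levels_def
proof
  fix n
  have "{h \<in> A. word_length G Z h = n} \<subseteq> ev ` {ws. set ws \<subseteq> Z \<and> length ws = n}"
  proof
    fix h assume h: "h \<in> {h \<in> A. word_length G Z h = n}"
    then obtain m where hm: "has_word Z m h" using assms(2) by auto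
    obtain ws where "set ws \<subseteq> Z" "length ws = word_length G Z h" "ev ws = h"
      by (rule word_lengthE[OF hm])
    thus "h \<in> ev ` {ws. set ws \<subseteq> Z \<and> length ws = n}" using h by blast
  qed
  moreover have "finite {ws. set ws \<subseteq> Z \<and> length ws = n}"
    using assms(1) by (rule finite_lists_length_eq)
  ultimately show "finite {h \<in> A. word_length G Z h = n}"
    by (meson finite_imageI finite_subset)
qed

text \<open>Inverses in \<open>generate\<close> are letters because \<open>Z\<close> is symmetric.\<close>

lemma symmetric_has_word:
  assumes "symmetric_generating_set G Z" "h \<in> carrier G"
  shows "\<exists>n. has_word Z n h"
proof -
  have Z: "Z \<subseteq> carrier G" "\<And>z. z \<in> Z \<Longrightarrow> inv z \<in> Z"
    using assms(1) by (auto simp: symmetric_generating_set_def)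
  have "h \<in> generate G Z" using assms by (simp add: symmetric_generating_set_def)
  thus ?thesis
  proof (induction rule: generate.induct)
    case one show ?case using has_word_one by blast
  next
    case (incl h) thus ?case using has_word_gen Z by blast
  next
    case (inv h) thus ?case using has_word_gen[of "inv h" Z] Z by blast
  next
    case (eng h1 h2) thus ?case using has_word_mult Z by blast
  qed
qed

end

section \<open>Groups whose Cayley graph is a tree\<close>

text \<open>Uniqueness of reduced words says that the Cayley graph has no cycles. A generator may be its own
  inverse, so that free products of copies of \<open>\<int>\<close> and \<open>\<int>/2\<close> are covered.\<close>

locale tree_group = group L for L :: "'l monoid" (structure) +
  fixes X :: "'l set"
  assumes finite_X: "finite X"
    and X_sub: "X \<subseteq> carrier L"
    and X_inv: "x \<in> X \<Longrightarrow> inv x \<in> X"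
    and reduced_ex: "g \<in> carrier L \<Longrightarrow>
      \<exists>ws. set ws \<subseteq> X \<and> successively (\<lambda>x y. y \<noteq> inv x) ws \<and> foldr (\<otimes>) ws \<one> = g"
    and reduced_unique: "set us \<subseteq> X \<Longrightarrow> successively (\<lambda>x y. y \<noteq> inv x) us \<Longrightarrow>
      set ws \<subseteq> X \<Longrightarrow> successively (\<lambda>x y. y \<noteq> inv x) ws \<Longrightarrow>
      foldr (\<otimes>) us \<one> = foldr (\<otimes>) ws \<one> \<Longrightarrow> us = ws"
begin

definition reduced :: "'l list \<Rightarrow> bool" where
  "reduced ws \<longleftrightarrow> set ws \<subseteq> X \<and> successively (\<lambda>x y. y \<noteq> inv x) ws"

definition nf :: "'l \<Rightarrow> 'l list" where
  "nf g = (THE ws. reduced ws \<and> ev ws = g)"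

lemma X_carrier [simp]: "x \<in> X \<Longrightarrow> x \<in> carrier L" using X_sub by auto

lemma nf_props:
  assumes "g \<in> carrier L" shows "reduced (nf g)" "ev (nf g) = g"
proof -
  have "\<exists>!ws. reduced ws \<and> ev ws = g"
    using reduced_ex[OF assms] reduced_unique unfolding reduced_def by metis
  from theI'[OF this] show "reduced (nf g)" "ev (nf g) = g" by (auto simp: nf_def)
qed

lemma reduced_sub: "reduced ws \<Longrightarrow> set ws \<subseteq> carrier L"
  using X_sub by (auto simp: reduced_def)

lemma nf_ev: "reduced ws \<Longrightarrow> nf (ev ws) = ws"
  using nf_props[of "ev ws"] reduced_unique reduced_sub ev_closed
  unfolding reduced_def by metis

lemma nf_eqI: "reduced ws \<Longrightarrow> ev ws = g \<Longrightarrow> nf g = ws"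
  using nf_ev by auto

lemma nf_inj: "g \<in> carrier L \<Longrightarrow> h \<in> carrier L \<Longrightarrow> nf g = nf h \<Longrightarrow> g = h"
  using nf_props(2) by metis

lemma reduced_Nil [simp]: "reduced []" by (simp add: reduced_def)

lemma reduced_Cons:
  "reduced (x # ws) \<longleftrightarrow> x \<in> X \<and> reduced ws \<and> (ws \<noteq> [] \<longrightarrow> hd ws \<noteq> inv x)"
  by (auto simp: reduced_def successively_Cons)

lemma reduced_append:
  "reduced (us @ ws) \<longleftrightarrow> reduced us \<and> reduced ws \<and> (us \<noteq> [] \<longrightarrow> ws \<noteq> [] \<longrightarrow> hd ws \<noteq> inv (last us))"
  by (auto simp: reduced_def successively_append_iff)

lemma nf_one [simp]: "nf \<one> = []"
  by (rule nf_eqI) auto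

lemma nf_Nil_iff: "g \<in> carrier L \<Longrightarrow> nf g = [] \<longleftrightarrow> g = \<one>"
  using nf_inj[of g \<one>] by auto

lemma nf_gen: "x \<in> X \<Longrightarrow> nf x = [x]"
  by (rule nf_eqI) (auto simp: reduced_Cons)

lemma one_notin_X: "\<one> \<notin> X"
  using nf_gen by fastforce

text \<open>The part of the tree that lies beyond the edge from \<open>\<one>\<close> to \<open>x\<close>.\<close>

definition branch :: "'l \<Rightarrow> 'l set" where
  "branch x = {g \<in> carrier L. \<exists>ws. nf g = x # ws}"

lemma branch_carrier: "g \<in> branch x \<Longrightarrow> g \<in> carrier L"
  by (simp add: branch_def)

lemma branch_disjoint: "g \<in> branch x \<Longrightarrow> g \<in> branch y \<Longrightarrow> x = y"
  by (auto simp: branch_def)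

lemma one_notin_branch: "\<one> \<notin> branch x" by (auto simp: branch_def)

lemma gen_in_branch: "x \<in> X \<Longrightarrow> x \<in> branch x" by (simp add: branch_def nf_gen)

lemma branch_X: "g \<in> branch x \<Longrightarrow> x \<in> X"
  using nf_props(1)[of g] by (auto simp: branch_def reduced_Cons)

lemma branch_cases:
  assumes "g \<in> carrier L" obtains "g = \<one>" | x where "x \<in> X" "g \<in> branch x"
proof (cases "nf g")
  case Nil thus ?thesis using that(1) nf_Nil_iff assms by blast
next
  case (Cons x ws)
  hence "g \<in> branch x" using assms by (auto simp: branch_def)
  thus ?thesis using that(2) branch_X by blast
qed

lemma nf_mult_gen:
  assumes "x \<in> X" "g \<in> carrier L" "g \<notin> branch (inv x)"
  shows "nf (x \<otimes> g) = x # nf g"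
proof (rule nf_eqI)
  show "reduced (x # nf g)"
    using assms nf_props(1)[of g] by (cases "nf g") (auto simp: reduced_Cons branch_def)
  show "ev (x # nf g) = x \<otimes> g" using assms nf_props by simp
qed

lemma mult_gen_branch:
  assumes "x \<in> X" "g \<in> carrier L" "g \<notin> branch (inv x)"
  shows "x \<otimes> g \<in> branch x"
  using nf_mult_gen[OF assms] assms by (auto simp: branch_def)

text \<open>Left translation by \<open>inv x\<close> maps the branch at \<open>x\<close> onto the complement of the branch at \<open>inv x\<close>.
  All recursions on the tree rest on this self-similarity.\<close>

lemma branch_decomp:
  assumes "g \<in> branch x"
  shows "inv x \<otimes> g \<in> carrier L" "inv x \<otimes> g \<notin> branch (inv x)" "nf g = x # nf (inv x \<otimes> g)"
proof -
  obtain ws where ws: "nf g = x # ws" and g: "g \<in> carrier L" using assms by (auto simp: branch_def)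
  have x: "x \<in> X" using assms branch_X by blast
  have r: "reduced (x # ws)" "g = x \<otimes> ev ws" using nf_props[OF g] ws by auto
  hence rw: "reduced ws" "set ws \<subseteq> carrier L" using reduced_sub by (auto simp: reduced_Cons)
  have eq: "inv x \<otimes> g = ev ws" using r x rw by (simp flip: m_assoc)
  have n: "nf (inv x \<otimes> g) = ws" using eq nf_ev rw by simp
  show "inv x \<otimes> g \<in> carrier L" using x g by simp
  show "inv x \<otimes> g \<notin> branch (inv x)" using n r(1) by (cases ws) (auto simp: branch_def reduced_Cons)
  show "nf g = x # nf (inv x \<otimes> g)" using n ws by simp
qed

end

section \<open>The normal form theorem for \<open>L\<close>\<close>

lemma gwords_append [simp]: "u @ w \<in> gwords S \<longleftrightarrow> u \<in> gwords S \<and> w \<in> gwords S"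
  by (auto simp: gwords_def)

lemma gwords_Cons [simp]: "a # w \<in> gwords S \<longleftrightarrow> fst a \<in> S \<and> w \<in> gwords S"
  by (cases a) (auto simp: gwords_def)

lemma gwords_Nil [simp]: "[] \<in> gwords S" by (auto simp: gwords_def)

lemma pres_rel_gwords: "(u, w) \<in> pres_rel S R \<Longrightarrow> u \<in> gwords S \<and> w \<in> gwords S"
  by (induction rule: pres_rel.induct) auto

lemma equiv_pres_rel: "equiv (gwords S) (pres_rel S R)"
  by (auto simp: equiv_def refl_on_def sym_def trans_def pres_rel_gwords
      intro: pres_rel.intros dest: pres_rel.sym pres_rel.trans)

lemma pres_rel_context:
  assumes "(u, w) \<in> pres_rel S R" "a \<in> gwords S" "b \<in> gwords S"
  shows "(a @ u @ b, a @ w @ b) \<in> pres_rel S R"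
  using assms
proof (induction rule: pres_rel.induct)
  case (cancel u w s p)
  thus ?case using pres_rel.cancel[of "a @ u" S "w @ b" s p] by simp
next
  case (relator u w r)
  thus ?case using pres_rel.relator[of "a @ u" S "w @ b" r] by simp
qed (auto intro: pres_rel.refl pres_rel.sym pres_rel.trans)

lemma pres_rel_append:
  assumes "(u, u') \<in> pres_rel S R" "(w, w') \<in> pres_rel S R"
  shows "(u @ w, u' @ w') \<in> pres_rel S R"
  using pres_rel_context[OF assms(1), of "[]" w] pres_rel_context[OF assms(2), of u' "[]"]
    pres_rel_gwords[OF assms(1)] pres_rel_gwords[OF assms(2)]
  by (auto intro: pres_rel.trans)

lemma presented_mult:
  assumes "u \<in> gwords S" "w \<in> gwords S"
  shows "pres_rel S R `` {u} \<otimes>\<^bsub>presented_group S R\<^esub> pres_rel S R `` {w} = pres_rel S R `` {u @ w}"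
proof -
  have "congruent2 (pres_rel S R) (pres_rel S R) (\<lambda>u w. pres_rel S R `` {u @ w})"
  proof (rule congruent2I')
    fix y1 z1 y2 z2
    assume "(y1, z1) \<in> pres_rel S R" "(y2, z2) \<in> pres_rel S R"
    hence "(y1 @ y2, z1 @ z2) \<in> pres_rel S R" by (rule pres_rel_append)
    thus "pres_rel S R `` {y1 @ y2} = pres_rel S R `` {z1 @ z2}"
      using equiv_class_eq[OF equiv_pres_rel] by blast
  qed
  from UN_equiv_class2[OF equiv_pres_rel equiv_pres_rel this assms]
  show ?thesis by (simp add: presented_group_def)
qed

definition winv :: "'a gword \<Rightarrow> 'a gword" where
  "winv w = rev (map (\<lambda>(s, p). (s, \<not> p)) w)"

lemma winv_gwords: "w \<in> gwords S \<Longrightarrow> winv w \<in> gwords S"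
  by (auto simp: winv_def gwords_def)

lemma winv_cancel: "w \<in> gwords S \<Longrightarrow> (winv w @ w, []) \<in> pres_rel S R"
proof (induction w)
  case Nil show ?case by (auto simp: winv_def intro: pres_rel.refl)
next
  case (Cons a w)
  obtain s p where a: "a = (s, p)" by (cases a)
  have w: "w \<in> gwords S" "s \<in> S" using Cons.prems a by auto
  have "(winv w @ [(s, \<not> p), (s, \<not> \<not> p)] @ w, winv w @ w) \<in> pres_rel S R"
    by (rule pres_rel.cancel) (use w winv_gwords in auto)
  hence "(winv (a # w) @ a # w, winv w @ w) \<in> pres_rel S R" by (simp add: a winv_def)
  thus ?case using Cons.IH w by (auto intro: pres_rel.trans)
qed

lemma presented_carrierE:
  assumes "A \<in> carrier (presented_group S R)"
  obtains u where "u \<in> gwords S" "A = pres_rel S R `` {u}"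
  using assms by (auto simp: presented_group_def elim: quotientE)

lemma presented_class: "u \<in> gwords S \<Longrightarrow> pres_rel S R `` {u} \<in> carrier (presented_group S R)"
  by (auto simp: presented_group_def intro: quotientI)

lemma presented_one: "\<one>\<^bsub>presented_group S R\<^esub> = pres_rel S R `` {[]}"
  by (simp add: presented_group_def)

lemma presented_eq_iff:
  assumes "u \<in> gwords S" "w \<in> gwords S"
  shows "pres_rel S R `` {u} = pres_rel S R `` {w} \<longleftrightarrow> (u, w) \<in> pres_rel S R"
  using eq_equiv_class_iff[OF equiv_pres_rel assms] .

lemma group_presented: "group (presented_group S R)"
proof (rule groupI)
  let ?P = "presented_group S R"
  fix A assume A: "A \<in> carrier ?P"
  then obtain u where u: "u \<in> gwords S" "A = pres_rel S R `` {u}" by (rule presented_carrierE)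
  show "\<one>\<^bsub>?P\<^esub> \<otimes>\<^bsub>?P\<^esub> A = A" using u by (simp add: presented_one presented_mult)
  show "\<exists>B\<in>carrier ?P. B \<otimes>\<^bsub>?P\<^esub> A = \<one>\<^bsub>?P\<^esub>"
    using u winv_cancel[OF u(1)] winv_gwords[OF u(1)]
    by (intro bexI[of _ "pres_rel S R `` {winv u}"])
       (auto simp: presented_mult presented_one presented_eq_iff presented_class)
  fix B assume B: "B \<in> carrier ?P"
  then obtain w where w: "w \<in> gwords S" "B = pres_rel S R `` {w}" by (rule presented_carrierE)
  show "A \<otimes>\<^bsub>?P\<^esub> B \<in> carrier ?P" using u w by (simp add: presented_mult presented_class)
  fix C assume C: "C \<in> carrier ?P"
  then obtain t where t: "t \<in> gwords S" "C = pres_rel S R `` {t}" by (rule presented_carrierE)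
  show "A \<otimes>\<^bsub>?P\<^esub> B \<otimes>\<^bsub>?P\<^esub> C = A \<otimes>\<^bsub>?P\<^esub> (B \<otimes>\<^bsub>?P\<^esub> C)"
    using u w t by (simp add: presented_mult)
qed (simp add: presented_one presented_class)

lemma presented_ev:
  assumes "w \<in> gwords S"
  shows "foldr (\<otimes>\<^bsub>presented_group S R\<^esub>) (map (\<lambda>a. pres_rel S R `` {[a]}) w) \<one>\<^bsub>presented_group S R\<^esub>
         = pres_rel S R `` {w}"
  using assms by (induction w) (auto simp: presented_one presented_mult)

text \<open>In \<open>L\<close> the letters \<open>(GenB j, True)\<close> and \<open>(GenB j, False)\<close> denote the same element; the former
  is taken as its canonical name.\<close>

fun canon :: "lgen \<times> bool \<Rightarrow> lgen \<times> bool" where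
  "canon (GenA i, p) = (GenA i, p)"
| "canon (GenB j, p) = (GenB j, True)"

fun linv :: "lgen \<times> bool \<Rightarrow> lgen \<times> bool" where
  "linv (GenA i, p) = (GenA i, \<not> p)"
| "linv (GenB j, p) = (GenB j, True)"

definition letters :: "nat \<Rightarrow> nat \<Rightarrow> (lgen \<times> bool) set" where
  "letters M N = {(GenA i, p) | i p. i < M} \<union> {(GenB j, True) | j. j < N}"

lemma letters_props:
  assumes "a \<in> letters M N"
  shows "canon a = a" "fst a \<in> L_syms M N" "linv a \<in> letters M N" "linv (linv a) = a"
  using assms by (auto simp: letters_def L_syms_def)

lemma linv_canon: "linv (canon a) = linv a" "canon (linv a) = linv a" "linv (linv a) = canon a"
  by (cases a rule: canon.cases; simp)+

lemma canon_letters: "fst a \<in> L_syms M N \<Longrightarrow> canon a \<in> letters M N"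
  by (cases a rule: canon.cases) (auto simp: letters_def L_syms_def)

definition lred :: "nat \<Rightarrow> nat \<Rightarrow> lgen gword \<Rightarrow> bool" where
  "lred M N w \<longleftrightarrow> set w \<subseteq> letters M N \<and> successively (\<lambda>x y. y \<noteq> linv x) w"

text \<open>Left multiplication by a letter, as an operation on reduced words. That these operations
  respect the defining relations of \<open>L\<close> is what makes reduced words unique.\<close>

fun push :: "lgen \<times> bool \<Rightarrow> lgen gword \<Rightarrow> lgen gword" where
  "push a [] = [canon a]"
| "push a (y # ys) = (if y = linv a then ys else canon a # y # ys)"

lemma lred_Cons: "lred M N (x # w) \<longleftrightarrow> x \<in> letters M N \<and> lred M N w \<and> (w \<noteq> [] \<longrightarrow> hd w \<noteq> linv x)"
  by (auto simp: lred_def successively_Cons)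

lemma lred_push:
  assumes "lred M N w" "fst a \<in> L_syms M N" shows "lred M N (push a w)"
  using assms by (cases w) (auto simp: lred_Cons linv_canon canon_letters)

lemma push_push:
  assumes "lred M N w" "canon b = linv a"
  shows "push a (push b w) = w"
proof (cases w)
  case Nil thus ?thesis using assms by simp
next
  case (Cons y ys)
  have lb: "linv b = canon a" using assms(2) linv_canon by metis
  have y: "canon y = y" using assms(1) Cons by (auto simp: lred_Cons letters_props)
  show ?thesis
  proof (cases "y = linv b")
    case True
    hence "hd ys \<noteq> linv a" if "ys \<noteq> []"
      using assms(1) Cons that lb by (auto simp: lred_Cons linv_canon)
    hence "push a ys = canon a # ys" by (cases ys) auto
    thus ?thesis using Cons True lb by simp
  next
    case False thus ?thesis using Cons assms(2) by simp
  qed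
qed

lemma lred_pushes:
  assumes "lred M N w" "u \<in> gwords (L_syms M N)" shows "lred M N (foldr push u w)"
  using assms by (induction u) (auto intro: lred_push)

lemma pres_rel_pushes:
  assumes "(u, w) \<in> pres_rel (L_syms M N) (L_rels N)" "lred M N t"
  shows "foldr push u t = foldr push w t"
  using assms
proof (induction arbitrary: t rule: pres_rel.induct)
  case (cancel u w s p)
  have "canon (s, \<not> p) = linv (s, p)" by (cases s) auto
  thus ?case using push_push[OF lred_pushes] cancel by simp
next
  case (relator u w r)
  then obtain j where "r = [(GenB j, True), (GenB j, True)]" by (auto simp: L_rels_def)
  moreover have "canon (GenB j, True) = linv (GenB j, True)" by auto
  ultimately show ?case using push_push[OF lred_pushes] relator by simp
qed auto

text \<open>Applied to the empty word, a reduced word reproduces itself; so different reduced words act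
  differently and represent different elements.\<close>

lemma pushes_lred: "lred M N w \<Longrightarrow> foldr push w [] = w"
proof (induction w)
  case (Cons a w)
  hence "foldr push w [] = w" "canon a = a" by (auto simp: lred_Cons letters_props)
  thus ?case using Cons.prems by (cases w) (auto simp: lred_Cons)
qed simp

text \<open>For \<open>b = GenB j\<close>, inserting the relator gives \<open>b\<inverse> = b\<inverse> b b = b\<close>.\<close>

lemma pres_rel_canon:
  assumes "fst a \<in> L_syms M N" shows "([canon a], [a]) \<in> pres_rel (L_syms M N) (L_rels N)"
proof (cases "canon a = a")
  case True thus ?thesis using assms by (auto intro: pres_rel.refl)
next
  case False
  then obtain j where j: "a = (GenB j, False)" "j < N"
    using assms by (cases a rule: canon.cases) (auto simp: L_syms_def)
  let ?r = "[(GenB j, True), (GenB j, True)]"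
  have "(([(GenB j, False)] @ ?r @ []), [(GenB j, False)] @ []) \<in> pres_rel (L_syms M N) (L_rels N)"
    by (rule pres_rel.relator) (use j in \<open>auto simp: L_syms_def L_rels_def\<close>)
  moreover have "([] @ [(GenB j, False), (GenB j, \<not> False)] @ [(GenB j, True)],
      [] @ [(GenB j, True)]) \<in> pres_rel (L_syms M N) (L_rels N)"
    by (rule pres_rel.cancel) (use j in \<open>auto simp: L_syms_def\<close>)
  ultimately show ?thesis using j by (auto intro: pres_rel.sym pres_rel.trans)
qed

lemma pres_rel_push:
  assumes "fst a \<in> L_syms M N" "lred M N w"
  shows "(a # w, push a w) \<in> pres_rel (L_syms M N) (L_rels N)"
proof -
  let ?\<rho> = "pres_rel (L_syms M N) (L_rels N)"
  have gw: "v \<in> gwords (L_syms M N)" if "lred M N v" for v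
    using that letters_props(2) unfolding lred_def gwords_def by fastforce
  have c: "([a] @ w, [canon a] @ w) \<in> ?\<rho>"
    using pres_rel_canon[OF assms(1)] pres_rel.refl[OF gw[OF assms(2)]]
    by (intro pres_rel_append) (auto intro: pres_rel.sym)
  show ?thesis
  proof (cases "\<exists>ys. w = linv a # ys")
    case False
    hence "push a w = canon a # w" by (cases w) auto
    thus ?thesis using c by simp
  next
    case True
    then obtain ys where ys: "w = linv a # ys" by blast
    obtain s p where a: "a = (s, p)" by (cases a)
    have ys': "ys \<in> gwords (L_syms M N)" "s \<in> L_syms M N"
      using gw assms ys a by (auto simp: lred_Cons)
    have "([a] @ [linv a], [(s, p)] @ [(s, \<not> p)]) \<in> ?\<rho>"
    proof (rule pres_rel_append)
      show "([a], [(s, p)]) \<in> ?\<rho>" using a ys' by (auto intro: pres_rel.refl)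
      have "canon (s, \<not> p) = linv a" using a by (cases s) auto
      thus "([linv a], [(s, \<not> p)]) \<in> ?\<rho>"
        using pres_rel_canon[of "(s, \<not> p)" M N] ys' by simp
    qed
    hence "(([a] @ [linv a]) @ ys, ([(s, p)] @ [(s, \<not> p)]) @ ys) \<in> ?\<rho>"
      using ys'(1) by (rule pres_rel_append[OF _ pres_rel.refl])
    moreover have "([] @ [(s, p), (s, \<not> p)] @ ys, [] @ ys) \<in> ?\<rho>"
      using ys' by (intro pres_rel.cancel) auto
    ultimately show ?thesis using ys by (auto intro: pres_rel.trans)
  qed
qed

lemma pres_rel_pushes_self:
  assumes "w \<in> gwords (L_syms M N)"
  shows "(w, foldr push w []) \<in> pres_rel (L_syms M N) (L_rels N)"
  using assms
proof (induction w)
  case Nil show ?case by (auto intro: pres_rel.refl)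
next
  case (Cons a w)
  have r: "lred M N (foldr push w [])"
    using Cons.prems by (intro lred_pushes) (auto simp: lred_def)
  have "([a] @ w, [a] @ foldr push w []) \<in> pres_rel (L_syms M N) (L_rels N)"
    using Cons by (intro pres_rel_append pres_rel.refl) auto
  thus ?case using pres_rel_push[OF _ r, of a] Cons.prems by (auto intro: pres_rel.trans)
qed

definition lcls :: "nat \<Rightarrow> nat \<Rightarrow> lgen \<times> bool \<Rightarrow> lgen gword set" where
  "lcls M N a = pres_rel (L_syms M N) (L_rels N) `` {[a]}"

lemma L_gens_letters: "L_gens M N = lcls M N ` letters M N"
  by (auto simp: L_gens_def letters_def lcls_def)

lemma lred_gwords: "lred M N v \<Longrightarrow> v \<in> gwords (L_syms M N)"
  using letters_props(2) unfolding lred_def gwords_def by fastforce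

lemma lred_unique:
  assumes "lred M N u" "lred M N w"
    "pres_rel (L_syms M N) (L_rels N) `` {u} = pres_rel (L_syms M N) (L_rels N) `` {w}"
  shows "u = w"
proof -
  have "(u, w) \<in> pres_rel (L_syms M N) (L_rels N)"
    using assms presented_eq_iff lred_gwords by metis
  from pres_rel_pushes[OF this, of "[]"] have "foldr push u [] = foldr push w []"
    by (simp add: lred_def)
  thus ?thesis using pushes_lred assms by simp
qed

lemma inj_on_lcls: "inj_on (lcls M N) (letters M N)"
proof (rule inj_onI)
  fix a b assume ab: "a \<in> letters M N" "b \<in> letters M N" "lcls M N a = lcls M N b"
  hence "lred M N [a]" "lred M N [b]" by (auto simp: lred_def)
  from lred_unique[OF this] ab show "a = b" by (simp add: lcls_def)
qed

lemma inv_lcls: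
  assumes "a \<in> letters M N"
  shows "inv\<^bsub>L_group M N\<^esub> (lcls M N a) = lcls M N (linv a)"
proof -
  interpret group "L_group M N" unfolding L_group_def by (rule group_presented)
  have l: "linv a \<in> letters M N" using letters_props assms by blast
  have s: "fst a \<in> L_syms M N" "fst (linv a) \<in> L_syms M N"
    using assms l letters_props by blast+
  have "([linv a, a], push (linv a) [a]) \<in> pres_rel (L_syms M N) (L_rels N)"
    using pres_rel_push[of "linv a" M N "[a]"] s assms by (simp add: lred_def)
  moreover have "push (linv a) [a] = []" using letters_props[OF assms] by simp
  ultimately have "lcls M N (linv a) \<otimes>\<^bsub>L_group M N\<^esub> lcls M N a = \<one>\<^bsub>L_group M N\<^esub>"
    using s by (simp add: lcls_def L_group_def presented_mult presented_one presented_eq_iff)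
  thus ?thesis
    using s by (intro inv_equality) (auto simp: lcls_def L_group_def presented_class)
qed

text \<open>Reduced words in the elements of \<open>L_gens M N\<close> are the images of reduced words in canonical
  letters, to which the normal form theorem applies.\<close>

lemma L_tree_group: "tree_group (L_group M N) (L_gens M N)"
proof -
  let ?L = "L_group M N"
  interpret group ?L unfolding L_group_def by (rule group_presented)
  have succ: "successively (\<lambda>x y. y \<noteq> inv\<^bsub>?L\<^esub> x) (map (lcls M N) w) \<longleftrightarrow> successively (\<lambda>x y. y \<noteq> linv x) w"
    if "set w \<subseteq> letters M N" for w
    using that
  proof (induction w)
    case (Cons a w)
    thus ?case
      using inj_on_lcls[of M N] letters_props(3)[of a M N]
      by (cases w) (auto simp: inv_lcls inj_on_def)
  qed simp
  have words: "\<exists>w. set w \<subseteq> letters M N \<and> us = map (lcls M N) w"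
    if "set us \<subseteq> L_gens M N" for us
    using that
  proof (induction us)
    case (Cons x us)
    then obtain w a where "set w \<subseteq> letters M N" "us = map (lcls M N) w" "a \<in> letters M N" "x = lcls M N a"
      by (auto simp: L_gens_letters)
    thus ?case by (intro exI[of _ "a # w"]) auto
  qed simp
  have ev: "foldr (\<otimes>\<^bsub>?L\<^esub>) (map (lcls M N) w) \<one>\<^bsub>?L\<^esub> = pres_rel (L_syms M N) (L_rels N) `` {w}"
    if "set w \<subseteq> letters M N" for w
  proof -
    have "w \<in> gwords (L_syms M N)" using that letters_props(2) unfolding gwords_def by fastforce
    from presented_ev[OF this] show ?thesis unfolding L_group_def lcls_def[abs_def] by simp
  qed
  show ?thesis
  proof
    have "letters M N \<subseteq> (GenA ` {..<M} \<union> GenB ` {..<N}) \<times> UNIV" by (auto simp: letters_def)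
    thus "finite (L_gens M N)" unfolding L_gens_letters
      by (metis finite_SigmaI finite_UnI finite_UNIV finite_imageI finite_lessThan finite_subset)
    show "L_gens M N \<subseteq> carrier ?L"
      using letters_props(2) by (fastforce simp: L_gens_letters lcls_def L_group_def intro!: presented_class)
    show "inv\<^bsub>?L\<^esub> x \<in> L_gens M N" if "x \<in> L_gens M N" for x
      using that by (auto simp: L_gens_letters inv_lcls letters_props(3))
  next
    fix g assume "g \<in> carrier ?L"
    then obtain u where u: "u \<in> gwords (L_syms M N)" "g = pres_rel (L_syms M N) (L_rels N) `` {u}"
      unfolding L_group_def by (rule presented_carrierE)
    define w where "w = foldr push u []"
    have w: "lred M N w" unfolding w_def using u by (intro lred_pushes) (auto simp: lred_def)
    have "g = pres_rel (L_syms M N) (L_rels N) `` {w}"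
      using u pres_rel_pushes_self[OF u(1)] presented_eq_iff[OF u(1) lred_gwords[OF w]]
      by (simp add: w_def)
    moreover have "set w \<subseteq> letters M N" "successively (\<lambda>x y. y \<noteq> linv x) w"
      using w by (auto simp: lred_def)
    ultimately show "\<exists>ws. set ws \<subseteq> L_gens M N \<and> successively (\<lambda>x y. y \<noteq> inv\<^bsub>?L\<^esub> x) ws \<and>
        foldr (\<otimes>\<^bsub>?L\<^esub>) ws \<one>\<^bsub>?L\<^esub> = g"
      using ev[of w] succ[of w] by (intro exI[of _ "map (lcls M N) w"]) (auto simp: L_gens_letters)
  next
    fix us ws
    assume us: "set us \<subseteq> L_gens M N" "successively (\<lambda>x y. y \<noteq> inv\<^bsub>?L\<^esub> x) us"
      and ws: "set ws \<subseteq> L_gens M N" "successively (\<lambda>x y. y \<noteq> inv\<^bsub>?L\<^esub> x) ws"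
      and eq: "foldr (\<otimes>\<^bsub>?L\<^esub>) us \<one>\<^bsub>?L\<^esub> = foldr (\<otimes>\<^bsub>?L\<^esub>) ws \<one>\<^bsub>?L\<^esub>"
    obtain u where u: "set u \<subseteq> letters M N" "us = map (lcls M N) u" using words[OF us(1)] by blast
    obtain w where w: "set w \<subseteq> letters M N" "ws = map (lcls M N) w" using words[OF ws(1)] by blast
    have "lred M N u" "lred M N w" using u w us ws succ by (auto simp: lred_def)
    from lred_unique[OF this] eq ev u w show "us = ws" by simp
  qed
qed

lemma card_L_gens: "card (L_gens M N) = 2 * M + N"
proof -
  have "inj_on (\<lambda>(i, p). (GenA i, p)) ({..<M} \<times> (UNIV :: bool set))" "inj_on (\<lambda>j. (GenB j, True)) {..<N}"
    by (auto simp: inj_on_def)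
  hence "card ((\<lambda>(i, p). (GenA i, p)) ` ({..<M} \<times> (UNIV :: bool set)) \<union> (\<lambda>j. (GenB j, True)) ` {..<N})
      = card ({..<M} \<times> (UNIV :: bool set)) + card {..<N}"
    by (subst card_Un_disjoint) (auto simp: card_image)
  moreover have "letters M N = (\<lambda>(i, p). (GenA i, p)) ` ({..<M} \<times> (UNIV :: bool set)) \<union> (\<lambda>j. (GenB j, True)) ` {..<N}"
    by (force simp: letters_def)
  ultimately have "card (letters M N) = 2 * M + N" by (simp add: card_cartesian_product)
  thus ?thesis using card_image[OF inj_on_lcls, of M N] by (simp add: L_gens_letters)
qed

lemma card_L_involutions: "card {x \<in> L_gens M N. inv\<^bsub>L_group M N\<^esub> x = x} = N"
proof -
  have "{x \<in> L_gens M N. inv\<^bsub>L_group M N\<^esub> x = x} = lcls M N ` {a \<in> letters M N. linv a = a}"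
    using inj_on_lcls[of M N] letters_props(3) by (auto simp: L_gens_letters inv_lcls inj_on_def)
  moreover have "{a \<in> letters M N. linv a = a} = (\<lambda>j. (GenB j, True)) ` {..<N}"
    by (auto simp: letters_def)
  moreover have "inj_on (\<lambda>j. (GenB j, True)) {..<N}" by (auto simp: inj_on_def)
  moreover have "inj_on (lcls M N) {a \<in> letters M N. linv a = a}"
    by (rule inj_on_subset[OF inj_on_lcls]) auto
  ultimately show ?thesis by (simp add: card_image)
qed

section \<open>The wreath product and its finitely supported functions\<close>

locale wreath_tree = tree_group L X + G: group G
  for L :: "'l monoid" (structure) and X :: "'l set"
    and G :: "('g, 'c) monoid_scheme" and Y :: "'g set" +
  assumes finite_Y: "finite Y" and sym_Y: "symmetric_generating_set G Y"
begin

abbreviation W :: "(('l \<Rightarrow> 'g) \<times> 'l) monoid" where "W \<equiv> wreath G L"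
abbreviation Z :: "(('l \<Rightarrow> 'g) \<times> 'l) set" where "Z \<equiv> wreath_gens G L Y X"
abbreviation F :: "('l \<Rightarrow> 'g) set" where "F \<equiv> carrier (wreath_base G L)"
abbreviation glen :: "'g \<Rightarrow> nat" where "glen \<equiv> word_length G Y"
abbreviation shift :: "'l \<Rightarrow> ('l \<Rightarrow> 'g) \<Rightarrow> 'l \<Rightarrow> 'g" where "shift \<equiv> wreath_shift L"

definition supp :: "('l \<Rightarrow> 'g) \<Rightarrow> 'l set" where
  "supp f = {i \<in> carrier L. f i \<noteq> \<one>\<^bsub>G\<^esub>}"

definition fone :: "'l \<Rightarrow> 'g" where "fone = (\<lambda>i\<in>carrier L. \<one>\<^bsub>G\<^esub>)"

definition pmul :: "('l \<Rightarrow> 'g) \<Rightarrow> ('l \<Rightarrow> 'g) \<Rightarrow> 'l \<Rightarrow> 'g" where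
  "pmul f g = (\<lambda>i\<in>carrier L. f i \<otimes>\<^bsub>G\<^esub> g i)"

definition cut :: "'l set \<Rightarrow> ('l \<Rightarrow> 'g) \<Rightarrow> 'l \<Rightarrow> 'g" where
  "cut A f = (\<lambda>i\<in>carrier L. if i \<in> A then f i else \<one>\<^bsub>G\<^esub>)"

lemma F_iff: "f \<in> F \<longleftrightarrow> f \<in> carrier L \<rightarrow>\<^sub>E carrier G \<and> finite (supp f)"
  by (subst carrier_sum_group) (auto simp: supp_def)

lemma F_closed [simp]: "f \<in> F \<Longrightarrow> i \<in> carrier L \<Longrightarrow> f i \<in> carrier G"
  by (auto simp: F_iff)

lemma finite_supp [simp]: "f \<in> F \<Longrightarrow> finite (supp f)"
  by (simp add: F_iff)

lemma F_eqI: "f \<in> F \<Longrightarrow> g \<in> F \<Longrightarrow> (\<And>i. i \<in> carrier L \<Longrightarrow> f i = g i) \<Longrightarrow> f = g"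
  unfolding F_iff by (meson PiE_ext)

lemma supp_carrier: "i \<in> supp f \<Longrightarrow> i \<in> carrier L" by (simp add: supp_def)

lemma fone_apply [simp]: "i \<in> carrier L \<Longrightarrow> fone i = \<one>\<^bsub>G\<^esub>" by (simp add: fone_def)
lemma supp_fone [simp]: "supp fone = {}" by (auto simp: supp_def)
lemma fone_F [simp]: "fone \<in> F" by (auto simp: F_iff) (auto simp: fone_def)

lemma supp_empty_iff: "f \<in> F \<Longrightarrow> supp f = {} \<longleftrightarrow> f = fone"
  by (auto intro!: F_eqI simp: supp_def)

lemma pmul_apply [simp]: "i \<in> carrier L \<Longrightarrow> pmul f g i = f i \<otimes>\<^bsub>G\<^esub> g i" by (simp add: pmul_def)

lemma supp_pmul: "supp (pmul f g) \<subseteq> supp f \<union> supp g"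
  by (auto simp: supp_def)

lemma pmul_F [simp]: "f \<in> F \<Longrightarrow> g \<in> F \<Longrightarrow> pmul f g \<in> F"
  using finite_subset[OF supp_pmul[of f g]] by (subst F_iff) (auto simp: pmul_def)

lemma cut_apply [simp]: "i \<in> carrier L \<Longrightarrow> cut A f i = (if i \<in> A then f i else \<one>\<^bsub>G\<^esub>)"
  by (simp add: cut_def)

lemma supp_cut: "supp (cut A f) = supp f \<inter> A" by (auto simp: supp_def split: if_splits)

lemma cut_F [simp]: "f \<in> F \<Longrightarrow> cut A f \<in> F"
  by (subst F_iff) (auto simp: supp_cut, auto simp: cut_def)

lemma cut_pmul:
  assumes "f \<in> F"
  shows "pmul (cut (- A) f) (cut A f) = f" "pmul (cut A f) (cut (- A) f) = f"
  by (rule F_eqI; use assms in simp)+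

lemma shift_apply [simp]: "i \<in> carrier L \<Longrightarrow> shift m f i = f (inv m \<otimes> i)"
  by (simp add: wreath_shift_def)

lemma supp_shift:
  assumes "m \<in> carrier L" shows "supp (shift m f) = (\<otimes>) m ` supp f"
proof
  show "supp (shift m f) \<subseteq> (\<otimes>) m ` supp f"
  proof
    fix i assume i: "i \<in> supp (shift m f)"
    hence "inv m \<otimes> i \<in> supp f" "i \<in> carrier L" using assms by (auto simp: supp_def)
    moreover have "i = m \<otimes> (inv m \<otimes> i)" using assms calculation by (simp flip: m_assoc)
    ultimately show "i \<in> (\<otimes>) m ` supp f" by blast
  qed
  show "(\<otimes>) m ` supp f \<subseteq> supp (shift m f)"
  proof
    fix i assume "i \<in> (\<otimes>) m ` supp f"
    then obtain j where "j \<in> supp f" "i = m \<otimes> j" by blast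
    thus "i \<in> supp (shift m f)" using assms by (auto simp: supp_def simp flip: m_assoc)
  qed
qed

lemma shift_F [simp]: "m \<in> carrier L \<Longrightarrow> f \<in> F \<Longrightarrow> shift m f \<in> F"
  using supp_shift[of m f] by (subst F_iff) (auto simp: wreath_shift_def)

lemma shift_pmul: "m \<in> carrier L \<Longrightarrow> f \<in> F \<Longrightarrow> g \<in> F \<Longrightarrow> shift m (pmul f g) = pmul (shift m f) (shift m g)"
  by (rule F_eqI) auto

lemma shift_shift: "m \<in> carrier L \<Longrightarrow> n \<in> carrier L \<Longrightarrow> f \<in> F \<Longrightarrow> shift m (shift n f) = shift (m \<otimes> n) f"
  by (rule F_eqI) (auto simp: inv_mult_group m_assoc)

lemma shift_one [simp]: "f \<in> F \<Longrightarrow> shift \<one> f = f"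
  by (rule F_eqI) auto

lemma shift_fone [simp]: "m \<in> carrier L \<Longrightarrow> shift m fone = fone"
  by (rule F_eqI) auto

lemma pmul_assoc: "f \<in> F \<Longrightarrow> g \<in> F \<Longrightarrow> h \<in> F \<Longrightarrow> pmul (pmul f g) h = pmul f (pmul g h)"
  by (rule F_eqI) (auto simp: G.m_assoc)

lemma pmul_fone [simp]: "f \<in> F \<Longrightarrow> pmul f fone = f" "f \<in> F \<Longrightarrow> pmul fone f = f"
  by (rule F_eqI; auto)+

lemma W_carrier: "carrier W = F \<times> carrier L" by (simp add: wreath_def)

lemma W_mult [simp]: "(f, m) \<otimes>\<^bsub>W\<^esub> (g, n) = (pmul f (shift m g), m \<otimes> n)"
  by (simp add: wreath_def pmul_def)

lemma W_one: "\<one>\<^bsub>W\<^esub> = (fone, \<one>)" by (simp add: wreath_def fone_def)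

lemma wreath_group: "group W"
proof (rule groupI)
  show "\<one>\<^bsub>W\<^esub> \<in> carrier W" by (auto simp: W_one W_carrier)
  show "x \<otimes>\<^bsub>W\<^esub> y \<in> carrier W" if "x \<in> carrier W" "y \<in> carrier W" for x y
    using that by (cases x; cases y) (auto simp: W_carrier)
  show "x \<otimes>\<^bsub>W\<^esub> y \<otimes>\<^bsub>W\<^esub> z = x \<otimes>\<^bsub>W\<^esub> (y \<otimes>\<^bsub>W\<^esub> z)"
    if "x \<in> carrier W" "y \<in> carrier W" "z \<in> carrier W" for x y z
    using that by (cases x; cases y; cases z)
      (auto simp: W_carrier shift_pmul shift_shift pmul_assoc m_assoc)
  show "\<one>\<^bsub>W\<^esub> \<otimes>\<^bsub>W\<^esub> x = x" if "x \<in> carrier W" for x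
    using that by (cases x) (auto simp: W_carrier W_one)
  show "\<exists>y\<in>carrier W. y \<otimes>\<^bsub>W\<^esub> x = \<one>\<^bsub>W\<^esub>" if x: "x \<in> carrier W" for x
  proof -
    obtain f m where fm: "x = (f, m)" "f \<in> F" "m \<in> carrier L" using x by (auto simp: W_carrier)
    define g where "g = (\<lambda>i\<in>carrier L. inv\<^bsub>G\<^esub> (f (m \<otimes> i)))"
    have ginv: "g = (\<lambda>i\<in>carrier L. inv\<^bsub>G\<^esub> (shift (inv m) f i))"
      using fm by (auto simp: g_def intro!: restrict_ext)
    have "g \<in> F"
    proof -
      have "supp g = supp (shift (inv m) f)"
        using fm shift_F[of "inv m" f] by (auto simp: supp_def ginv)
      thus ?thesis using fm shift_F[of "inv m" f] by (subst F_iff) (auto simp: g_def)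
    qed
    moreover have "pmul g (shift (inv m) f) = fone"
      by (rule F_eqI) (use fm \<open>g \<in> F\<close> in \<open>auto simp: g_def\<close>)
    ultimately show ?thesis using fm
      by (intro bexI[of _ "(g, inv m)"]) (auto simp: W_carrier W_one)
  qed
qed

sublocale W: group W by (rule wreath_group)

subsection \<open>The weight of a function\<close>

text \<open>The vertices other than \<open>\<one>\<close> of the smallest subtree that contains \<open>\<one>\<close> and the support.\<close>

definition spanned :: "('l \<Rightarrow> 'g) \<Rightarrow> 'l set" where
  "spanned f = {p \<in> carrier L. p \<noteq> \<one> \<and> (\<exists>j\<in>supp f. prefix (nf p) (nf j))}"

text \<open>The cost of a closed walk from \<open>\<one>\<close> that visits the support and writes the values of \<open>f\<close> there:
  it runs through each edge of the spanned subtree twice.\<close>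

definition weight :: "('l \<Rightarrow> 'g) \<Rightarrow> nat" where
  "weight f = 2 * card (spanned f) + (\<Sum>i\<in>supp f. glen (f i))"

lemma finite_spanned [simp]: "f \<in> F \<Longrightarrow> finite (spanned f)"
proof -
  assume f: "f \<in> F"
  have "nf ` spanned f \<subseteq> (\<Union>j\<in>supp f. set (prefixes (nf j)))" by (auto simp: spanned_def)
  hence "finite (nf ` spanned f)" using finite_supp[OF f] by (meson finite_UN_I finite_set finite_subset)
  moreover have "inj_on nf (spanned f)" using nf_inj by (auto simp: inj_on_def spanned_def)
  ultimately show ?thesis using finite_imageD by blast
qed

lemma supp_spanned: "i \<in> supp f \<Longrightarrow> i \<noteq> \<one> \<Longrightarrow> i \<in> spanned f"
  by (auto simp: spanned_def supp_def)

lemma Y_word: "g \<in> carrier G \<Longrightarrow> \<exists>n. G.has_word Y n g"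
  using G.symmetric_has_word[OF sym_Y] by blast

lemma Y_sub: "Y \<subseteq> carrier G" using sym_Y by (simp add: symmetric_generating_set_def)

lemma glen_mult: "g \<in> carrier G \<Longrightarrow> h \<in> carrier G \<Longrightarrow> glen (g \<otimes>\<^bsub>G\<^esub> h) \<le> glen g + glen h"
  using G.word_length_mult[OF Y_sub] Y_word by blast

lemma weight_sum_superset:
  assumes "finite A" "supp f \<subseteq> A" "A \<subseteq> carrier L"
  shows "(\<Sum>i\<in>supp f. glen (f i)) = (\<Sum>i\<in>A. glen (f i))"
  using assms by (intro sum.mono_neutral_left) (auto simp: supp_def)

lemma spanned_mono: "supp f \<subseteq> supp g \<union> supp h \<Longrightarrow> spanned f \<subseteq> spanned g \<union> spanned h"
  by (auto simp: spanned_def)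

lemma weight_pmul:
  assumes "f \<in> F" "g \<in> F" shows "weight (pmul f g) \<le> weight f + weight g"
proof -
  let ?A = "supp f \<union> supp g"
  have A: "finite ?A" "?A \<subseteq> carrier L" using assms by (auto simp: supp_carrier)
  have "(\<Sum>i\<in>supp (pmul f g). glen (pmul f g i)) = (\<Sum>i\<in>?A. glen (pmul f g i))"
    by (rule weight_sum_superset) (use A supp_pmul in auto)
  also have "\<dots> \<le> (\<Sum>i\<in>?A. glen (f i) + glen (g i))"
  proof (rule sum_mono)
    fix i assume "i \<in> ?A"
    hence "i \<in> carrier L" using A(2) by blast
    thus "glen (pmul f g i) \<le> glen (f i) + glen (g i)" using assms by (simp add: glen_mult)
  qed
  also have "\<dots> = (\<Sum>i\<in>supp f. glen (f i)) + (\<Sum>i\<in>supp g. glen (g i))"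
    using weight_sum_superset[of ?A f] weight_sum_superset[of ?A g] A by (simp add: sum.distrib)
  finally have 1: "(\<Sum>i\<in>supp (pmul f g). glen (pmul f g i)) \<le> (\<Sum>i\<in>supp f. glen (f i)) + (\<Sum>i\<in>supp g. glen (g i))" .
  have "card (spanned (pmul f g)) \<le> card (spanned f \<union> spanned g)"
    using spanned_mono[OF supp_pmul] assms by (intro card_mono) auto
  also have "\<dots> \<le> card (spanned f) + card (spanned g)" by (rule card_Un_le)
  finally show ?thesis using 1 by (simp add: weight_def)
qed

text \<open>A vertex other than \<open>\<one>\<close> on the path to \<open>j\<close> has the same first letter as \<open>j\<close>.\<close>

lemma prefix_branch:
  assumes "p \<in> carrier L" "p \<noteq> \<one>" "prefix (nf p) (nf j)" "j \<in> carrier L"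
  shows "p \<in> branch x \<longleftrightarrow> j \<in> branch x"
proof -
  obtain y ws where "nf p = y # ws" using assms nf_Nil_iff by (cases "nf p") auto
  thus ?thesis using assms by (auto simp: branch_def prefix_Cons) (auto simp: prefix_def)
qed

lemma spanned_cut_branch: "spanned (cut (branch x) f) \<subseteq> branch x" "spanned (cut (- branch x) f) \<inter> branch x = {}"
  using prefix_branch supp_carrier unfolding spanned_def supp_cut by blast+

lemma weight_cut_branch:
  assumes "f \<in> F"
  shows "weight f = weight (cut (branch x) f) + weight (cut (- branch x) f)"
proof -
  let ?a = "cut (branch x) f" and ?b = "cut (- branch x) f"
  have h: "spanned f = spanned ?a \<union> spanned ?b" by (auto simp: spanned_def supp_cut)
  have "card (spanned f) = card (spanned ?a) + card (spanned ?b)"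
    unfolding h using spanned_cut_branch[of x f] assms by (intro card_Un_disjoint) auto
  moreover have "(\<Sum>i\<in>supp f. glen (f i)) = (\<Sum>i\<in>supp ?a. glen (f i)) + (\<Sum>i\<in>supp ?b. glen (f i))"
    using assms by (subst sum.union_disjoint[symmetric]) (auto simp: supp_cut intro!: sum.cong)
  moreover have "(\<Sum>i\<in>supp ?a. glen (f i)) = (\<Sum>i\<in>supp ?a. glen (?a i))"
    "(\<Sum>i\<in>supp ?b. glen (f i)) = (\<Sum>i\<in>supp ?b. glen (?b i))"
    by (auto intro!: sum.cong simp: supp_cut supp_carrier)
  ultimately show ?thesis by (simp add: weight_def)
qed

lemma inv_mult_cancel: "x \<in> carrier L \<Longrightarrow> j \<in> carrier L \<Longrightarrow> inv x \<otimes> (x \<otimes> j) = j"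
  "x \<in> carrier L \<Longrightarrow> j \<in> carrier L \<Longrightarrow> x \<otimes> (inv x \<otimes> j) = j"
  by (simp_all flip: m_assoc)

text \<open>Moving the base point along one edge adds at most that edge to the spanned subtree. If \<open>j\<close> lies
  in the branch at \<open>inv x\<close>, the path to \<open>x \<otimes> j\<close> is even shorter than the path to \<open>j\<close>.\<close>

lemma spanned_shift_sub:
  assumes "x \<in> X" "h \<in> F"
  shows "spanned (shift x h) \<subseteq> insert x ((\<otimes>) x ` spanned h)"
proof
  fix p assume p: "p \<in> spanned (shift x h)"
  have x: "x \<in> carrier L" "inv x \<in> X" using assms X_inv by auto
  from p obtain j where j: "j \<in> supp h" "prefix (nf p) (nf (x \<otimes> j))"
    and pc: "p \<in> carrier L" "p \<noteq> \<one>"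
    using x by (auto simp: spanned_def supp_shift)
  have jc: "j \<in> carrier L" using j supp_carrier by blast
  have "prefix (nf (inv x \<otimes> p)) (nf j)"
  proof (cases "j \<in> branch (inv x)")
    case False
    hence "x \<otimes> j \<in> branch x" using mult_gen_branch assms jc by auto
    hence "p \<in> branch x" using prefix_branch[OF pc j(2)] x jc by auto
    from branch_decomp(3)[OF this] show ?thesis
      using j(2) nf_mult_gen[OF assms(1) jc False] by auto
  next
    case True
    from branch_decomp(2,3)[OF this] x have d: "x \<otimes> j \<notin> branch x" "nf j = inv x # nf (x \<otimes> j)" by auto
    hence "p \<notin> branch x" using prefix_branch[OF pc j(2)] x jc by auto
    hence "nf (inv x \<otimes> p) = inv x # nf p" using nf_mult_gen[of "inv x" p] x pc by auto
    thus ?thesis using d j by simp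
  qed
  hence "inv x \<otimes> p = \<one> \<or> inv x \<otimes> p \<in> spanned h"
    using j x pc unfolding spanned_def by auto
  thus "p \<in> insert x ((\<otimes>) x ` spanned h)"
  proof
    assume "inv x \<otimes> p = \<one>"
    hence "x \<otimes> (inv x \<otimes> p) = x" using x by simp
    thus ?thesis using inv_mult_cancel x pc by simp
  next
    assume "inv x \<otimes> p \<in> spanned h"
    hence "x \<otimes> (inv x \<otimes> p) \<in> (\<otimes>) x ` spanned h" by blast
    thus ?thesis using inv_mult_cancel x pc by simp
  qed
qed

lemma sum_shift:
  assumes "x \<in> carrier L" "h \<in> F"
  shows "(\<Sum>i\<in>supp (shift x h). glen (shift x h i)) = (\<Sum>i\<in>supp h. glen (h i))"
proof -
  have "inj_on ((\<otimes>) x) (supp h)" using assms by (auto simp: inj_on_def supp_def)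
  thus ?thesis using assms
    by (auto simp: supp_shift sum.reindex supp_carrier inv_mult_cancel intro!: sum.cong)
qed

lemma weight_shift_le:
  assumes "x \<in> X" "h \<in> F" shows "weight (shift x h) \<le> 2 + weight h"
proof -
  have "card (spanned (shift x h)) \<le> card (insert x ((\<otimes>) x ` spanned h))"
    using spanned_shift_sub assms by (intro card_mono) auto
  also have "\<dots> \<le> Suc (card (spanned h))"
    using card_insert_le_m1 card_image_le[of "spanned h" "(\<otimes>) x"] assms
    by (metis (no_types, lifting) card_insert_if finite_spanned finite_imageI le_SucI not_less_eq_eq)
  finally show ?thesis using sum_shift[of x h] assms by (simp add: weight_def)
qed

text \<open>Off the branch at \<open>inv x\<close>, translation by \<open>x\<close> prepends \<open>x\<close> to all reduced words.\<close>

lemma weight_shift: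
  assumes "x \<in> X" "h \<in> F" "supp h \<inter> branch (inv x) = {}" "h \<noteq> fone"
  shows "weight (shift x h) = 2 + weight h"
proof -
  have x: "x \<in> carrier L" using assms by auto
  have nfs: "nf (x \<otimes> j) = x # nf j" if "j \<in> supp h" for j
    using that assms nf_mult_gen[OF assms(1), of j] supp_carrier by blast
  have "insert x ((\<otimes>) x ` spanned h) \<subseteq> spanned (shift x h)"
  proof -
    obtain j where "j \<in> supp h" using assms supp_empty_iff by blast
    hence "x \<in> spanned (shift x h)"
      using nfs[of j] x assms(1) one_notin_X nf_gen[OF assms(1)]
      by (auto simp: spanned_def supp_shift intro!: bexI[of _ j])
    moreover have "x \<otimes> p \<in> spanned (shift x h)" if p: "p \<in> spanned h" for p
    proof -
      obtain j where j: "j \<in> supp h" "prefix (nf p) (nf j)" and pc: "p \<in> carrier L" "p \<noteq> \<one>"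
        using p by (auto simp: spanned_def)
      have "p \<notin> branch (inv x)"
        using prefix_branch[OF pc j(2)] j assms(3) supp_carrier by blast
      hence "nf (x \<otimes> p) = x # nf p" using nf_mult_gen assms(1) pc by auto
      moreover from this have "x \<otimes> p \<noteq> \<one>" by (metis list.distinct(1) nf_one)
      ultimately show ?thesis using nfs j pc x by (auto simp: spanned_def supp_shift)
    qed
    ultimately show ?thesis by auto
  qed
  hence "spanned (shift x h) = insert x ((\<otimes>) x ` spanned h)" using spanned_shift_sub assms by blast
  moreover have "x \<notin> (\<otimes>) x ` spanned h" using x by (auto simp: spanned_def)
  moreover have "inj_on ((\<otimes>) x) (spanned h)" using x by (auto simp: inj_on_def spanned_def)
  ultimately have "card (spanned (shift x h)) = Suc (card (spanned h))"
    using assms by (simp add: card_image)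
  thus ?thesis using sum_shift[of x h] assms by (simp add: weight_def)
qed

text \<open>The part of \<open>f\<close> on a branch, seen from the first vertex of that branch.\<close>

definition pull :: "'l \<Rightarrow> ('l \<Rightarrow> 'g) \<Rightarrow> 'l \<Rightarrow> 'g" where
  "pull x f = shift (inv x) (cut (branch x) f)"

lemma pull_props:
  assumes "x \<in> X" "f \<in> F"
  shows "pull x f \<in> F" "supp (pull x f) \<inter> branch (inv x) = {}" "shift x (pull x f) = cut (branch x) f"
proof -
  have x: "x \<in> carrier L" "inv x \<in> carrier L" using assms by auto
  show "pull x f \<in> F" using x assms by (simp add: pull_def)
  show "shift x (pull x f) = cut (branch x) f" using x assms by (simp add: pull_def shift_shift)
  show "supp (pull x f) \<inter> branch (inv x) = {}"
    using x branch_decomp(2) unfolding pull_def by (auto simp: supp_shift supp_cut)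
qed

text \<open>Detaching a branch with nontrivial values saves the two passages of its first edge. Depth-first
  search and the simplification of decorated words both rely on this.\<close>

lemma weight_pull:
  assumes "x \<in> X" "f \<in> F" "supp f \<inter> branch x \<noteq> {}"
  shows "weight f = weight (cut (- branch x) f) + 2 + weight (pull x f)"
proof -
  have "pull x f \<noteq> fone"
  proof
    assume "pull x f = fone"
    hence "supp (cut (branch x) f) = {}" using pull_props(3)[OF assms(1,2)] assms(1) by (metis X_carrier shift_fone supp_fone)
    thus False using assms(3) by (simp add: supp_cut)
  qed
  thus ?thesis using weight_cut_branch[OF assms(2), of x] weight_shift[OF assms(1) pull_props(1,2)[OF assms(1,2)]]
    pull_props(3)[OF assms(1,2)] by simp
qed

subsection \<open>Words for functions\<close>

lemma wreath_vec_F: "g \<in> carrier G \<Longrightarrow> wreath_vec G L g \<in> F"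
  "g \<in> carrier G \<Longrightarrow> supp (wreath_vec G L g) \<subseteq> {\<one>}"
proof -
  assume g: "g \<in> carrier G"
  show s: "supp (wreath_vec G L g) \<subseteq> {\<one>}" by (auto simp: supp_def wreath_vec_def)
  show "wreath_vec G L g \<in> F" using g finite_subset[OF s] by (subst F_iff) (auto simp: wreath_vec_def)
qed

lemma wreath_vec_one: "wreath_vec G L \<one>\<^bsub>G\<^esub> = fone"
  by (auto simp: wreath_vec_def fone_def intro!: restrict_ext)

lemma Z_eq: "Z = {(fone, x) | x. x \<in> X} \<union> {(wreath_vec G L y, \<one>) | y. y \<in> Y}"
  by (simp add: wreath_gens_def wreath_vec_one)

lemma Z_sub: "Z \<subseteq> carrier W"
  using Y_sub wreath_vec_F by (auto simp: Z_eq W_carrier)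

lemma finite_Z: "finite Z"
  using finite_X finite_Y by (simp add: Z_eq Setcompr_eq_image)

lemma has_word_vec:
  assumes "G.has_word Y n g" shows "W.has_word Z n (wreath_vec G L g, \<one>)"
proof -
  have "\<exists>ws'. set ws' \<subseteq> Z \<and> length ws' = length ws \<and> W.ev ws' = (wreath_vec G L (G.ev ws), \<one>)"
    if "set ws \<subseteq> Y" for ws
    using that
  proof (induction ws)
    case Nil show ?case by (auto simp: W_one wreath_vec_one)
  next
    case (Cons y ws)
    then obtain ws' where ws': "set ws' \<subseteq> Z" "length ws' = length ws" "W.ev ws' = (wreath_vec G L (G.ev ws), \<one>)"
      by auto
    have y: "y \<in> carrier G" "G.ev ws \<in> carrier G" using Cons.prems Y_sub by auto
    have "pmul (wreath_vec G L y) (wreath_vec G L (G.ev ws)) = wreath_vec G L (y \<otimes>\<^bsub>G\<^esub> G.ev ws)"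
      by (rule F_eqI) (use y wreath_vec_F in \<open>auto simp: wreath_vec_def\<close>)
    thus ?case using ws' Cons.prems y wreath_vec_F
      by (intro exI[of _ "(wreath_vec G L y, \<one>) # ws'"]) (auto simp: Z_eq)
  qed
  thus ?thesis using assms unfolding G.has_word_def W.has_word_def by metis
qed

lemma has_word_gen: "x \<in> X \<Longrightarrow> W.has_word Z 1 (fone, x)"
  by (rule W.has_word_gen[OF _ Z_sub]) (auto simp: Z_eq)

lemma weight_no_branch:
  assumes "f \<in> F" "\<And>x. x \<in> X \<Longrightarrow> supp f \<inter> branch x = {}"
  shows "f = wreath_vec G L (f \<one>)" "weight f = glen (f \<one>)"
proof -
  have s: "supp f \<subseteq> {\<one>}"
    using assms(2) supp_carrier branch_cases by (metis IntI empty_iff insertI1 subsetI)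
  show "f = wreath_vec G L (f \<one>)"
    using assms(1) s wreath_vec_F(1)[of "f \<one>"] by (intro F_eqI) (auto simp: wreath_vec_def supp_def)
  have "spanned f = {}" using s nf_Nil_iff by (auto simp: spanned_def)
  moreover have "(\<Sum>i\<in>supp f. glen (f i)) = (\<Sum>i\<in>{\<one>}. glen (f i))"
    using s by (intro weight_sum_superset) auto
  ultimately show "weight f = glen (f \<one>)" by (simp add: weight_def)
qed

text \<open>Depth-first search: go to a branch with nontrivial values, treat it recursively, and return.\<close>

lemma has_word_fun: "f \<in> F \<Longrightarrow> W.has_word Z (weight f) (f, \<one>)"
proof (induction "weight f" arbitrary: f rule: less_induct)
  case less
  show ?case
  proof (cases "\<exists>x\<in>X. supp f \<inter> branch x \<noteq> {}")
    case False
    hence f: "f = wreath_vec G L (f \<one>)" "weight f = glen (f \<one>)" using weight_no_branch less.prems by blast+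
    obtain n where "G.has_word Y n (f \<one>)" using Y_word less.prems by force
    hence "G.has_word Y (glen (f \<one>)) (f \<one>)" by (rule G.has_word_length)
    thus ?thesis using has_word_vec f by metis
  next
    case True
    then obtain x where x: "x \<in> X" "supp f \<inter> branch x \<noteq> {}" by blast
    let ?f = "cut (- branch x) f" and ?h = "pull x f"
    note wf = weight_pull[OF x(1) less.prems x(2)]
    note h = pull_props[OF x(1) less.prems]
    have 1: "W.has_word Z (weight ?f) (?f, \<one>)" using less.hyps[of ?f] less.prems wf by simp
    have 2: "W.has_word Z (weight ?h) (?h, \<one>)" using less.hyps[of ?h] h(1) wf by simp
    have "W.has_word Z (1 + (weight ?h + 1)) ((fone, x) \<otimes>\<^bsub>W\<^esub> ((?h, \<one>) \<otimes>\<^bsub>W\<^esub> (fone, inv x)))"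
      by (intro W.has_word_mult Z_sub has_word_gen 2 X_inv x(1))
    from W.has_word_mult[OF Z_sub 1 this]
    have "W.has_word Z (weight f) ((?f, \<one>) \<otimes>\<^bsub>W\<^esub> ((fone, x) \<otimes>\<^bsub>W\<^esub> ((?h, \<one>) \<otimes>\<^bsub>W\<^esub> (fone, inv x))))"
      using wf by (simp add: add.commute add.left_commute)
    moreover have "(?f, \<one>) \<otimes>\<^bsub>W\<^esub> ((fone, x) \<otimes>\<^bsub>W\<^esub> ((?h, \<one>) \<otimes>\<^bsub>W\<^esub> (fone, inv x))) = (f, \<one>)"
      using h less.prems x(1) cut_pmul[OF less.prems] by simp
    ultimately show ?thesis by simp
  qed
qed

lemma has_word_W: "w \<in> carrier W \<Longrightarrow> \<exists>n. W.has_word Z n w"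
proof -
  assume "w \<in> carrier W"
  then obtain f m where w: "w = (f, m)" "f \<in> F" "m \<in> carrier L" by (auto simp: W_carrier)
  have "\<exists>n. W.has_word Z n (fone, ev ws)" if "set ws \<subseteq> X" for ws
    using that
  proof (induction ws)
    case Nil show ?case using W.has_word_one by (auto simp: W_one)
  next
    case (Cons x ws)
    then obtain n where "W.has_word Z n (fone, ev ws)" by auto
    from W.has_word_mult[OF Z_sub has_word_gen this, of x] show ?case using Cons.prems by auto
  qed
  moreover have "set (nf m) \<subseteq> X" "ev (nf m) = m" using nf_props[OF w(3)] by (auto simp: reduced_def)
  ultimately obtain n where "W.has_word Z n (fone, m)" by metis
  from W.has_word_mult[OF Z_sub has_word_fun[OF w(2)] this] show ?thesis using w by auto
qed

text \<open>The weight bounds the word length, and finitely many elements have a given word length.\<close>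

lemma fin_levels_F: "fin_levels F weight"
proof -
  have "fin_levels ((\<lambda>f. (f, \<one>)) ` F) (word_length W Z)"
    by (rule W.fin_levels_word_length[OF finite_Z]) (use has_word_fun in blast)
  moreover have "bij_betw fst ((\<lambda>f. (f, \<one>)) ` F) F" by (auto simp: bij_betw_def inj_on_def image_image)
  ultimately have "fin_levels F (\<lambda>f. word_length W Z (f, \<one>))"
    by (elim fin_levels_bij[rotated 2]) auto
  thus ?thesis
    by (rule fin_levels_subset) (use has_word_fun W.word_length_le in auto)
qed

end

section \<open>Generating series of finitely supported functions\<close>

lemma prod_nth_cong:
  fixes f :: "'i \<Rightarrow> rat fps"
  assumes "finite A" "\<And>i k. i \<in> A \<Longrightarrow> k \<le> n \<Longrightarrow> f i $ k = g $ k" "k \<le> n"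
  shows "(\<Prod>i\<in>A. f i) $ k = (g ^ card A) $ k"
  using assms
proof (induction A arbitrary: k rule: finite_induct)
  case (insert a A)
  have "(\<Prod>i\<in>insert a A. f i) $ k = (\<Sum>j=0..k. f a $ j * (\<Prod>i\<in>A. f i) $ (k - j))"
    using insert(1,2) by (simp add: fps_mult_nth)
  also have "\<dots> = (\<Sum>j=0..k. g $ j * (g ^ card A) $ (k - j))"
    using insert by (intro sum.cong) auto
  also have "\<dots> = (g ^ card (insert a A)) $ k"
    using insert(1,2) by (simp add: fps_mult_nth)
  finally show ?case .
qed simp

context wreath_tree
begin

definition branches :: "'l set \<Rightarrow> 'l set" where
  "branches I = insert \<one> (\<Union>y\<in>I. branch y)"

text \<open>The labellings of the vertex \<open>\<one>\<close> and of the trees that hang from it in the directions in \<open>I\<close>.\<close>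

definition funs_on :: "'l set \<Rightarrow> ('l \<Rightarrow> 'g) set" where
  "funs_on I = {f \<in> F. supp f \<subseteq> branches I}"

definition branch_funs :: "'l \<Rightarrow> ('l \<Rightarrow> 'g) set" where
  "branch_funs y = {f \<in> F. supp f \<subseteq> branch y}"

abbreviation \<sigma> :: "rat fps" where "\<sigma> \<equiv> growth_series G Y"

lemma sigma_gf: "\<sigma> = gf (carrier G) glen"
  by (simp add: growth_series_def gf_def)

lemma fin_levels_G: "fin_levels (carrier G) glen"
  by (rule G.fin_levels_word_length[OF finite_Y]) (use Y_word in auto)

lemma fin_levels_funs_on: "fin_levels (funs_on I) weight"
  by (rule fin_levels_subset[OF fin_levels_F]) (auto simp: funs_on_def)

lemma fin_levels_branch_funs: "fin_levels (branch_funs y) weight"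
  by (rule fin_levels_subset[OF fin_levels_F]) (auto simp: branch_funs_def)

lemma weight_fone [simp]: "weight fone = 0" by (simp add: weight_def spanned_def)

lemma branches_diff:
  assumes "y \<in> X" shows "branches (X - {y}) = carrier L - branch y"
proof
  show "branches (X - {y}) \<subseteq> carrier L - branch y"
    using branch_carrier branch_disjoint one_notin_branch by (auto simp: branches_def)
  show "carrier L - branch y \<subseteq> branches (X - {y})"
  proof
    fix g assume g: "g \<in> carrier L - branch y"
    hence "g \<in> carrier L" by simp
    thus "g \<in> branches (X - {y})" by (cases rule: branch_cases) (use g in \<open>auto simp: branches_def\<close>)
  qed
qed

lemma branches_diff2:
  assumes "x \<in> X" "y \<in> X" shows "branches (X - {x, y}) = carrier L - branch x - branch y"
  using branches_diff[OF assms(1)] branches_diff[OF assms(2)] branch_disjoint by (auto simp: branches_def)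

lemma gf_funs_on_empty: "gf (funs_on {}) weight = \<sigma>"
proof -
  have nb: "supp f \<inter> branch x = {}" if "f \<in> funs_on {}" for f x
    using that one_notin_branch by (auto simp: funs_on_def branches_def)
  have "bij_betw (\<lambda>f. f \<one>) (funs_on {}) (carrier G)"
  proof (rule bij_betw_byWitness[where f' = "wreath_vec G L"])
    show "\<forall>f\<in>funs_on {}. wreath_vec G L (f \<one>) = f"
      using weight_no_branch(1) nb by (auto simp: funs_on_def)
    show "\<forall>g\<in>carrier G. wreath_vec G L g \<one> = g" by (simp add: wreath_vec_def)
    show "(\<lambda>f. f \<one>) ` funs_on {} \<subseteq> carrier G" by (auto simp: funs_on_def)
    show "wreath_vec G L ` carrier G \<subseteq> funs_on {}" using wreath_vec_F by (auto simp: funs_on_def branches_def)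
  qed
  from gf_bij[OF this, where w = weight and w' = glen] show ?thesis
    using weight_no_branch(2) nb by (simp add: sigma_gf funs_on_def)
qed

text \<open>Different directions are independent, since weights add up over branches.\<close>

lemma gf_funs_on_insert:
  assumes "y \<in> X" "I \<subseteq> X" "y \<notin> I"
  shows "gf (funs_on (insert y I)) weight = gf (funs_on I) weight * gf (branch_funs y) weight"
proof -
  let ?h = "\<lambda>f. (cut (- branch y) f, cut (branch y) f)"
  have dI: "branches I \<inter> branch y = {}" using assms branch_disjoint one_notin_branch by (auto simp: branches_def)
  have "bij_betw ?h (funs_on (insert y I)) (funs_on I \<times> branch_funs y)"
  proof (rule bij_betw_byWitness[where f' = "\<lambda>(a, b). pmul a b"])
    show "\<forall>f\<in>funs_on (insert y I). (\<lambda>(a, b). pmul a b) (?h f) = f"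
      using cut_pmul by (auto simp: funs_on_def)
    have "cut (- branch y) (pmul a b) = a \<and> cut (branch y) (pmul a b) = b"
      if "a \<in> funs_on I" "b \<in> branch_funs y" for a b
    proof (intro conjI F_eqI)
      show F: "a \<in> F" "b \<in> F" "cut (- branch y) (pmul a b) \<in> F" "cut (branch y) (pmul a b) \<in> F"
        using that by (auto simp: funs_on_def branch_funs_def)
      fix i assume i: "i \<in> carrier L"
      have "i \<in> branch y \<Longrightarrow> a i = \<one>\<^bsub>G\<^esub>" "i \<notin> branch y \<Longrightarrow> b i = \<one>\<^bsub>G\<^esub>"
        using that i dI by (auto simp: funs_on_def branch_funs_def supp_def)
      thus "cut (- branch y) (pmul a b) i = a i" "cut (branch y) (pmul a b) i = b i"
        using i F by auto
    qed
    thus "\<forall>p\<in>funs_on I \<times> branch_funs y. ?h ((\<lambda>(a, b). pmul a b) p) = p" by auto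
    show "?h ` funs_on (insert y I) \<subseteq> funs_on I \<times> branch_funs y"
      by (auto simp: funs_on_def branch_funs_def supp_cut branches_def)
    show "(\<lambda>(a, b). pmul a b) ` (funs_on I \<times> branch_funs y) \<subseteq> funs_on (insert y I)"
      using supp_pmul by (fastforce simp: funs_on_def branch_funs_def branches_def)
  qed
  note gf = gf_bij[OF this, where w = weight and w' = "\<lambda>p. weight (fst p) + weight (snd p)"]
  have "gf (funs_on (insert y I)) weight = gf (funs_on I \<times> branch_funs y) (\<lambda>p. weight (fst p) + weight (snd p))"
  proof -
    have "weight (cut (- branch y) f) + weight (cut (branch y) f) = weight f" if "f \<in> funs_on (insert y I)" for f
      using that weight_cut_branch[of f y] by (simp add: funs_on_def)
    thus ?thesis using gf by (metis fst_conv snd_conv)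
  qed
  thus ?thesis by (simp add: gf_Times fin_levels_funs_on fin_levels_branch_funs)
qed

lemma gf_funs_on_prod:
  assumes "I \<subseteq> X" shows "gf (funs_on I) weight = \<sigma> * (\<Prod>y\<in>I. gf (branch_funs y) weight)"
proof -
  have "finite I" using assms finite_X finite_subset by blast
  thus ?thesis using assms
    by (induction I rule: finite_induct) (auto simp: gf_funs_on_empty gf_funs_on_insert)
qed

text \<open>A nontrivial function on the branch at \<open>y\<close> is one on the complement of the branch at \<open>inv y\<close>, carried
  across the edge \<open>y\<close> at cost \<open>2\<close>. With equal factors for all branches this becomes the functional
  equation of \<open>F_T\<close> at \<open>x = z\<^sup>2 \<sigma>\<close> and \<open>y = z\<^sup>2 (\<sigma> - 1)\<close>.\<close>

lemma gf_branch_funs_rec: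
  assumes "y \<in> X"
  shows "gf (branch_funs y) weight = 1 + fps_X ^ 2 * (gf (funs_on (X - {inv y})) weight - 1)"
proof -
  have y: "y \<in> carrier L" "inv y \<in> X" using assms X_inv by auto
  let ?A = "funs_on (X - {inv y})"
  have fl: "fin_levels (?A - {fone}) weight" "fin_levels (branch_funs y - {fone}) weight" "fin_levels {fone} weight"
    by (rule fin_levels_subset[OF fin_levels_funs_on], auto,
        rule fin_levels_subset[OF fin_levels_branch_funs], auto intro: fin_levels_finite)
  have A: "f \<in> ?A \<longleftrightarrow> f \<in> F \<and> supp f \<inter> branch (inv y) = {}" for f
    using supp_carrier by (auto simp: funs_on_def branches_diff[OF y(2)])
  have "bij_betw (shift y) (?A - {fone}) (branch_funs y - {fone})"
  proof (rule bij_betw_byWitness[where f' = "shift (inv y)"])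
    show "\<forall>f\<in>?A - {fone}. shift (inv y) (shift y f) = f"
      using y by (auto simp: funs_on_def shift_shift)
    show "\<forall>f\<in>branch_funs y - {fone}. shift y (shift (inv y) f) = f"
      using y by (auto simp: branch_funs_def shift_shift)
    show "shift y ` (?A - {fone}) \<subseteq> branch_funs y - {fone}"
    proof
      fix g assume "g \<in> shift y ` (?A - {fone})"
      then obtain f where f: "f \<in> F" "supp f \<inter> branch (inv y) = {}" "f \<noteq> fone" "g = shift y f"
        using A by auto
      have "supp g \<subseteq> branch y"
        using f y mult_gen_branch[OF assms] supp_carrier by (auto simp: supp_shift)
      moreover have "supp g \<noteq> {}" using f y supp_empty_iff by (simp add: supp_shift)
      ultimately show "g \<in> branch_funs y - {fone}" using f y by (auto simp: branch_funs_def)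
    qed
    show "shift (inv y) ` (branch_funs y - {fone}) \<subseteq> ?A - {fone}"
    proof
      fix g assume "g \<in> shift (inv y) ` (branch_funs y - {fone})"
      then obtain f where f: "f \<in> F" "supp f \<subseteq> branch y" "f \<noteq> fone" "g = shift (inv y) f"
        by (auto simp: branch_funs_def)
      have "supp g \<inter> branch (inv y) = {}"
        using f y branch_decomp(2) by (auto simp: supp_shift)
      moreover have "supp g \<noteq> {}" using f y supp_empty_iff by (simp add: supp_shift)
      ultimately show "g \<in> ?A - {fone}" using A f y by auto
    qed
  qed
  from gf_bij[OF this, where w = "\<lambda>f. 2 + weight f" and w' = weight]
  have "gf (branch_funs y - {fone}) weight = gf (?A - {fone}) (\<lambda>f. 2 + weight f)"
    using weight_shift[OF assms] A by simp
  hence 1: "gf (branch_funs y - {fone}) weight = fps_X ^ 2 * gf (?A - {fone}) weight" by (simp only: gf_shift)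
  have "?A = {fone} \<union> (?A - {fone})" "branch_funs y = {fone} \<union> (branch_funs y - {fone})"
    by (auto simp: funs_on_def branch_funs_def)
  hence "gf ?A weight = 1 + gf (?A - {fone}) weight" "gf (branch_funs y) weight = 1 + gf (branch_funs y - {fone}) weight"
    using gf_Un[OF fl(3,1)] gf_Un[OF fl(3,2)] by (metis Diff_disjoint gf_singleton power_0 weight_fone)+
  thus ?thesis using 1 by simp
qed

text \<open>In the recursion, the coefficient at \<open>n\<close> depends only on coefficients at indices up to \<open>n - 2\<close>,
  and in the same way for all generators.\<close>

lemma gf_branch_funs_eq:
  assumes "v \<in> X" "y \<in> X" shows "gf (branch_funs y) weight = gf (branch_funs v) weight"
proof -
  have "\<forall>y\<in>X. gf (branch_funs y) weight $ n = gf (branch_funs v) weight $ n" for n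
  proof (induction n rule: less_induct)
    case (less n)
    have rec: "gf (branch_funs y) weight $ n = (if n < 2 then 1 $ n else (\<sigma> * gf (branch_funs v) weight ^ (card X - 1) - 1) $ (n - 2))"
      if y: "y \<in> X" for y
    proof (cases "n < 2")
      case True thus ?thesis by (simp add: gf_branch_funs_rec[OF y] fps_X_power_mult_nth)
    next
      case False
      let ?I = "X - {inv y}"
      have "(\<Prod>x\<in>?I. gf (branch_funs x) weight) $ k = (gf (branch_funs v) weight ^ card ?I) $ k" if "k \<le> n - 2" for k
        using that less False finite_X by (intro prod_nth_cong[where n = "n - 2"]) auto
      hence "(\<sigma> * (\<Prod>x\<in>?I. gf (branch_funs x) weight)) $ (n - 2) = (\<sigma> * gf (branch_funs v) weight ^ card ?I) $ (n - 2)"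
        by (simp add: fps_mult_nth)
      thus ?thesis using False y X_inv
        by (simp add: gf_branch_funs_rec[OF y] gf_funs_on_prod fps_X_power_mult_nth)
    qed
    show ?case by (intro ballI) (simp only: rec assms(1))
  qed
  note main = this
  show ?thesis
  proof (rule fps_ext)
    fix n
    show "gf (branch_funs y) weight $ n = gf (branch_funs v) weight $ n" using bspec[OF main[of n] assms(2)] .
  qed
qed

lemma gf_funs_on:
  assumes "v \<in> X" "I \<subseteq> X" shows "gf (funs_on I) weight = \<sigma> * gf (branch_funs v) weight ^ card I"
proof -
  have "(\<Prod>y\<in>I. gf (branch_funs y) weight) = (\<Prod>y\<in>I. gf (branch_funs v) weight)"
  proof (rule prod.cong[OF HOL.refl])
    fix y assume "y \<in> I"
    thus "gf (branch_funs y) weight = gf (branch_funs v) weight" using assms by (intro gf_branch_funs_eq) auto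
  qed
  thus ?thesis using gf_funs_on_prod[OF assms(2)] by simp
qed

end

section \<open>Subtrees of the Cayley graph\<close>

context tree_group
begin

definition parent :: "'l \<Rightarrow> 'l" where "parent q = ev (butlast (nf q))"

lemma parent_props:
  assumes "q \<in> carrier L" "q \<noteq> \<one>"
  shows "parent q \<in> carrier L" "nf (parent q) = butlast (nf q)" "last (nf q) \<in> X"
    "q = parent q \<otimes> last (nf q)" "length (nf q) = Suc (length (nf (parent q)))"
proof -
  have ne: "nf q \<noteq> []" using assms nf_Nil_iff by blast
  have r: "reduced (butlast (nf q) @ [last (nf q)])" using ne nf_props(1)[OF assms(1)] by simp
  hence rb: "reduced (butlast (nf q))" and l: "last (nf q) \<in> X"
    by (auto simp: reduced_append reduced_Cons)
  show "parent q \<in> carrier L" unfolding parent_def using reduced_sub[OF rb] by simp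
  show n: "nf (parent q) = butlast (nf q)" unfolding parent_def using nf_ev[OF rb] .
  show "last (nf q) \<in> X" by (fact l)
  show "length (nf q) = Suc (length (nf (parent q)))" using ne n by simp
  have "ev (butlast (nf q) @ [last (nf q)]) = parent q \<otimes> ev [last (nf q)]"
    unfolding parent_def using reduced_sub[OF rb] l by (intro ev_append) auto
  thus "q = parent q \<otimes> last (nf q)" using ne nf_props(2)[OF assms(1)] l by simp
qed

lemma parent_inverse:
  assumes "p \<in> carrier L" "q \<in> carrier L" "nf q = nf p @ [x]" shows "parent q = p" "q \<noteq> \<one>"
  using assms nf_props(2)[OF assms(1)] by (auto simp: parent_def)

text \<open>Multiplying by a generator on the right appends a letter to the reduced word or deletes the last one.\<close>

lemma cayley_edges:
  "snd (cayley_graph L X) = {{q, parent q} | q. q \<in> carrier L \<and> q \<noteq> \<one>}"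
proof (intro subset_antisym subsetI)
  fix e assume "e \<in> snd (cayley_graph L X)"
  then obtain g x where e: "e = {g, g \<otimes> x}" and g: "g \<in> carrier L" and x: "x \<in> X"
    by (auto simp: cayley_graph_def)
  show "e \<in> {{q, parent q} | q. q \<in> carrier L \<and> q \<noteq> \<one>}"
  proof (cases "nf g \<noteq> [] \<and> last (nf g) = inv x")
    case False
    have "nf (g \<otimes> x) = nf g @ [x]"
    proof (rule nf_eqI)
      have "last (nf g) = inv x" if "nf g \<noteq> []" "x = inv last (nf g)"
        using that nf_props(1)[OF g] by (metis X_carrier inv_inv last_in_set reduced_def subsetD)
      thus "reduced (nf g @ [x])" using False nf_props(1)[OF g] x by (auto simp: reduced_append reduced_Cons)
      show "ev (nf g @ [x]) = g \<otimes> x"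
        using ev_append[of "nf g" "[x]"] nf_props[OF g] reduced_sub x by simp
    qed
    from parent_inverse[OF g _ this] have "parent (g \<otimes> x) = g" "g \<otimes> x \<noteq> \<one>" using g x by auto
    thus ?thesis using e g x by (auto intro!: exI[of _ "g \<otimes> x"])
  next
    case True
    hence g1: "g \<noteq> \<one>" using g nf_Nil_iff by blast
    note p = parent_props[OF g g1]
    have "g \<otimes> x = parent g" using p(1,4) True x by (metis X_carrier inv_closed inv_solve_right m_closed)
    thus ?thesis using e g g1 by auto
  qed
next
  fix e assume "e \<in> {{q, parent q} | q. q \<in> carrier L \<and> q \<noteq> \<one>}"
  then obtain q where q: "e = {q, parent q}" "q \<in> carrier L" "q \<noteq> \<one>" by blast
  note p = parent_props[OF q(2,3)]
  have "e = {parent q, parent q \<otimes> last (nf q)}" using p(4) q(1) by (simp flip: p(4) add: insert_commute)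
  thus "e \<in> snd (cayley_graph L X)" using p(1,3) unfolding cayley_graph_def by auto
qed

text \<open>A subtree in \<open>subtrees_at L X v\<close> is determined by its set of vertices other than \<open>\<one>\<close>.\<close>

definition shapes :: "'l \<Rightarrow> 'l set set" where
  "shapes v = {V. finite V \<and> V \<subseteq> branch v \<and> (\<forall>q\<in>V. parent q \<noteq> \<one> \<longrightarrow> parent q \<in> V)}"

definition inner :: "'l set \<Rightarrow> 'l set" where "inner V = {p \<in> V. \<exists>q\<in>V. parent q = p}"

definition tree_of :: "'l set \<Rightarrow> 'l ugraph" where
  "tree_of V = (insert \<one> V, {{q, parent q} | q. q \<in> V})"

lemma branch_not_one: "q \<in> branch v \<Longrightarrow> q \<in> carrier L \<and> q \<noteq> \<one>"
  using branch_carrier one_notin_branch by blast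

lemma shapes_closed:
  assumes "V \<in> shapes v" "q \<in> V" "p \<in> carrier L" "p \<noteq> \<one>" "prefix (nf p) (nf q)"
  shows "p \<in> V"
  using assms
proof (induction "length (nf q)" arbitrary: q rule: less_induct)
  case less
  have q: "q \<in> carrier L" "q \<noteq> \<one>" using less.prems branch_not_one by (auto simp: shapes_def)
  note pp = parent_props[OF q]
  show ?case
  proof (cases "nf p = nf q")
    case True thus ?thesis using nf_inj less.prems q by metis
  next
    case False
    hence pre: "prefix (nf p) (nf (parent q))" using less.prems(5) pp(2)
      by (metis append_butlast_last_id butlast.simps(1) prefix_order.eq_iff prefix_snoc)
    hence "parent q \<noteq> \<one>" using less.prems nf_Nil_iff by auto
    hence "parent q \<in> V" using less.prems by (auto simp: shapes_def)
    thus ?thesis using less.hyps[of "parent q"] pp(5) pre less.prems(1,3,4) by simp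
  qed
qed

lemma prefix_butlast_iff:
  assumes "ws \<noteq> []" "prefix us ws" "\<not> prefix us (butlast ws)" shows "us = ws"
  using assms by (metis append_butlast_last_id prefix_snoc)

text \<open>A walk from \<open>q\<close> to the root must leave the set of descendants of \<open>q\<close>, and it can only do so
  through the edge from \<open>q\<close> to its parent.\<close>

lemma subtree_parent_edge:
  assumes "is_subgraph T (cayley_graph L X)" "ug_connected T" "\<one> \<in> fst T" "q \<in> fst T" "q \<noteq> \<one>"
  shows "{q, parent q} \<in> snd T"
proof (rule ccontr)
  assume no: "{q, parent q} \<notin> snd T"
  have q: "q \<in> carrier L" using assms by (auto simp: is_subgraph_def cayley_graph_def)
  let ?r = "{(p, q). {p, q} \<in> snd T}"
  have "(q, \<one>) \<in> ?r\<^sup>*" using assms by (auto simp: ug_connected_def)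
  hence "prefix (nf q) (nf \<one>)"
  proof (induction rule: rtrancl_induct)
    case base show ?case by simp
  next
    case (step a b)
    from step(2) have ab: "{a, b} \<in> snd T" by simp
    then obtain c where c: "{a, b} = {c, parent c}" "c \<in> carrier L" "c \<noteq> \<one>"
    proof -
      have "{a, b} \<in> snd (cayley_graph L X)" using ab assms(1) by (auto simp: is_subgraph_def)
      thus thesis using that unfolding cayley_edges by blast
    qed
    note pc = parent_props[OF c(2,3)]
    have ne: "nf c \<noteq> []" using c nf_Nil_iff by blast
    show ?case
    proof (cases "a = c")
      case True
      hence b: "b = parent c" using c(1) by (metis doubleton_eq_iff)
      show ?thesis
      proof (rule ccontr)
        assume "\<not> prefix (nf q) (nf b)"
        hence "nf q = nf c" using prefix_butlast_iff[OF ne] step.IH True b pc by simp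
        hence "q = c" using nf_inj q c by blast
        thus False using no ab True b by simp
      qed
    next
      case False
      hence "a = parent c" "b = c" using c(1) by (metis doubleton_eq_iff)+
      moreover have "prefix (butlast (nf c)) (nf c)" by (rule prefixI[of _ _ "[last (nf c)]"]) (use ne in simp)
      ultimately show ?thesis using step.IH pc by (metis prefix_order.trans)
    qed
  qed
  thus False using assms(5) q nf_Nil_iff by simp
qed

text \<open>Of a vertex of maximal length on a cycle, both neighbours would be the parent. The root is
  always a leaf because \<open>v\<close> is its only possible child; the other vertices have a parent, so they
  are leaves if and only if they have no child.\<close>

lemma tree_of_shape:
  assumes "v \<in> X" "V \<in> shapes v"
  shows "tree_of V \<in> subtrees_at L X v" "leaves (tree_of V) = insert \<one> (V - inner V)"
proof -
  let ?T = "tree_of V"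
  have V: "finite V" "V \<subseteq> branch v" "\<And>q. q \<in> V \<Longrightarrow> parent q = \<one> \<or> parent q \<in> V"
    using assms(2) by (auto simp: shapes_def)
  have Vc: "q \<in> carrier L" "q \<noteq> \<one>" if "q \<in> V" for q using that V(2) branch_not_one by auto
  have edge: "\<exists>c\<in>V. {a, b} = {c, parent c}" if "{a, b} \<in> snd ?T" for a b
    using that by (auto simp: tree_of_def)
  have sub: "is_subgraph ?T (cayley_graph L X)"
  proof -
    have "snd ?T \<subseteq> {{q, parent q} | q. q \<in> carrier L \<and> q \<noteq> \<one>}"
      using Vc by (auto simp only: tree_of_def snd_conv)
    moreover have "fst ?T \<subseteq> fst (cayley_graph L X)" "\<forall>e\<in>snd ?T. e \<subseteq> fst ?T"
      using V Vc by (auto simp: tree_of_def cayley_graph_def)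
    ultimately show ?thesis by (simp add: is_subgraph_def cayley_edges)
  qed
  have to_one: "(q, \<one>) \<in> {(p, q). {p, q} \<in> snd ?T}\<^sup>*" if "q \<in> insert \<one> V" for q
    using that
  proof (induction "length (nf q)" arbitrary: q rule: less_induct)
    case less
    show ?case
    proof (cases "q = \<one>")
      case False
      hence q: "q \<in> V" using less by auto
      have "(parent q, \<one>) \<in> {(p, q). {p, q} \<in> snd ?T}\<^sup>*"
        using less.hyps[of "parent q"] parent_props(5)[OF Vc[OF q]] V(3)[OF q] by auto
      moreover have "(q, parent q) \<in> {(p, q). {p, q} \<in> snd ?T}" using q by (auto simp: tree_of_def)
      ultimately show ?thesis by (rule converse_rtrancl_into_rtrancl[rotated])
    qed simp
  qed
  have conn: "ug_connected ?T"
  proof -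
    have "sym {(p, q). {p, q} \<in> snd ?T}" by (auto simp: sym_def insert_commute)
    hence "sym ({(p, q). {p, q} \<in> snd ?T}\<^sup>*)" by (rule sym_rtrancl)
    thus ?thesis using to_one unfolding ug_connected_def
      by (auto simp: tree_of_def dest: symD intro: rtrancl_trans)
  qed
  \<comment> \<open>\<open>s\<close> and \<open>p\<close> are the cyclic successor and predecessor of the index \<open>i\<close> of a longest vertex.\<close>
  have acyclic: "\<not> ug_cycle ?T vs" for vs
  proof
    assume c: "ug_cycle ?T vs"
    let ?n = "length vs"
    have n: "3 \<le> ?n" "distinct vs" using c by (auto simp: ug_cycle_def)
    have e: "{vs ! i, vs ! (Suc i mod ?n)} \<in> snd ?T" if "i < ?n" for i
    proof (cases "Suc i < ?n")
      case True thus ?thesis using c by (simp add: ug_cycle_def)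
    next
      case False
      hence "Suc i = ?n" using that by simp
      hence "i = ?n - 1" "vs \<noteq> []" by auto
      thus ?thesis using c n by (simp add: ug_cycle_def last_conv_nth hd_conv_nth)
    qed
    have "\<exists>i<?n. \<forall>j<?n. length (nf (vs ! j)) \<le> length (nf (vs ! i))"
    proof -
      have "finite ((\<lambda>i. length (nf (vs ! i))) ` {..<?n})" "(\<lambda>i. length (nf (vs ! i))) ` {..<?n} \<noteq> {}"
        using n by (auto simp: lessThan_empty_iff)
      from Max_in[OF this] Max_ge[OF this(1)] show ?thesis
        by (smt (verit) imageE image_eqI lessThan_iff)
    qed
    then obtain i where i: "i < ?n" "\<And>j. j < ?n \<Longrightarrow> length (nf (vs ! j)) \<le> length (nf (vs ! i))" by blast
    have nb: "vs ! j = parent (vs ! i)" if j: "j < ?n" "{vs ! i, vs ! j} \<in> snd ?T" for j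
    proof -
      obtain q where q: "q \<in> V" "{vs ! i, vs ! j} = {q, parent q}" using edge[OF j(2)] by blast
      have "vs ! j \<noteq> q \<or> vs ! i \<noteq> parent q" using i(2)[OF j(1)] parent_props(5)[OF Vc[OF q(1)]] by auto
      thus ?thesis using q(2) by (metis doubleton_eq_iff)
    qed
    define s where "s = Suc i mod ?n"
    define p where "p = (if i = 0 then ?n - 1 else i - 1)"
    have s: "s < ?n" "{vs ! i, vs ! s} \<in> snd ?T" using e[OF i(1)] n i by (auto simp: s_def intro!: mod_less_divisor)
    have p: "p < ?n" "Suc p mod ?n = i" using n i by (auto simp: p_def)
    hence "{vs ! i, vs ! p} \<in> snd ?T" using e[OF p(1)] by (simp add: insert_commute)
    hence "vs ! s = vs ! p" using nb s p by metis
    hence "s = p" using n(2) s p nth_eq_iff_index_eq by blast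
    thus False using n i by (auto simp: s_def p_def mod_Suc split: if_splits)
  qed
  have adj: "u = v" if u: "u \<in> fst ?T" "{\<one>, u} \<in> snd (cayley_graph L X)" for u
  proof -
    obtain q where q: "{\<one>, u} = {q, parent q}" "q \<in> carrier L" "q \<noteq> \<one>"
      using u(2) unfolding cayley_edges by blast
    hence uq: "u = q" "parent u = \<one>" by (metis doubleton_eq_iff)+
    hence "u \<in> branch v" using u(1) q V(2) by (auto simp: tree_of_def)
    then obtain ws where ws: "nf u = v # ws" by (auto simp: branch_def)
    have "butlast (nf u) = []" using parent_props(2)[of u] uq q by simp
    hence "nf u = [v]" using ws by (cases ws) auto
    thus ?thesis using nf_gen[OF assms(1)] nf_inj uq q assms(1) by (metis X_carrier)
  qed
  show "?T \<in> subtrees_at L X v"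
    using sub conn acyclic adj V(1) by (auto simp: subtrees_at_def is_tree_def) (auto simp: tree_of_def)
  have fin: "finite {e \<in> snd ?T. u \<in> e}" for u
    using V(1) by (simp add: tree_of_def Setcompr_eq_image)
  have leaf: "valence ?T u \<le> 1 \<longleftrightarrow> u = \<one> \<or> u \<notin> inner V" if u: "u \<in> insert \<one> V" for u
  proof (cases "u = \<one>")
    case True
    have "{e \<in> snd ?T. u \<in> e} \<subseteq> {{v, \<one>}}"
    proof
      fix e assume "e \<in> {e \<in> snd ?T. u \<in> e}"
      then obtain q where q: "q \<in> V" "e = {q, parent q}" "parent q = \<one>" using True Vc
        by (auto simp: tree_of_def)
      have "{\<one>, q} \<in> snd (cayley_graph L X)" unfolding cayley_edges using q Vc
        by (auto simp: insert_commute intro!: exI[of _ q])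
      hence "q = v" using adj q by (auto simp: tree_of_def)
      thus "e \<in> {{v, \<one>}}" using q by simp
    qed
    hence "card {e \<in> snd ?T. u \<in> e} \<le> card {{v, \<one>}}" by (intro card_mono) auto
    thus ?thesis using True by (simp add: valence_def)
  next
    case False
    hence uV: "u \<in> V" using u by simp
    show ?thesis
    proof (cases "u \<in> inner V")
      case True
      then obtain q where q: "q \<in> V" "parent q = u" by (auto simp: inner_def)
      have "parent u \<noteq> q" using parent_props(5)[OF Vc[OF q(1)]] parent_props(5)[OF Vc[OF uV]] q(2) by auto
      hence ne: "{u, parent u} \<noteq> {q, u}" using parent_props(5)[OF Vc[OF q(1)]] q(2) by (auto simp: doubleton_eq_iff)
      have "{{u, parent u}, {q, u}} \<subseteq> {e \<in> snd ?T. u \<in> e}" using uV q by (auto simp: tree_of_def)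
      hence "card {{u, parent u}, {q, u}} \<le> valence ?T u" unfolding valence_def
        by (intro card_mono fin)
      thus ?thesis using ne True False by simp
    next
      case not_inner: False
      have "{e \<in> snd ?T. u \<in> e} = {{u, parent u}}" using uV not_inner by (auto simp: tree_of_def inner_def)
      thus ?thesis using not_inner by (simp add: valence_def)
    qed
  qed
  show "leaves ?T = insert \<one> (V - inner V)"
  proof -
    have "leaves ?T = {u \<in> insert \<one> V. valence ?T u \<le> 1}" by (simp add: leaves_def tree_of_def)
    also have "\<dots> = {u \<in> insert \<one> V. u = \<one> \<or> u \<notin> inner V}" using leaf by blast
    finally show ?thesis by auto
  qed
qed

lemma tree_of_surj:
  assumes "v \<in> X" "T \<in> subtrees_at L X v"
  shows "fst T - {\<one>} \<in> shapes v" "tree_of (fst T - {\<one>}) = T"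
proof -
  let ?V = "fst T - {\<one>}"
  have T: "is_subgraph T (cayley_graph L X)" "ug_connected T" "finite (fst T)" "\<one> \<in> fst T"
    and adj: "\<And>u. u \<in> fst T \<Longrightarrow> {\<one>, u} \<in> snd (cayley_graph L X) \<Longrightarrow> u = v"
    using assms(2) by (auto simp: subtrees_at_def is_tree_def)
  have Vc: "q \<in> carrier L" "q \<noteq> \<one>" if "q \<in> ?V" for q
    using that T(1) by (auto simp: is_subgraph_def cayley_graph_def)
  have edge: "{q, parent q} \<in> snd T" if "q \<in> ?V" for q
    using subtree_parent_edge[OF T(1,2,4)] that by simp
  hence parent: "parent q \<in> fst T" if "q \<in> ?V" for q using T(1) that unfolding is_subgraph_def by blast
  have "q \<in> branch v" if "q \<in> ?V" for q
    using that
  proof (induction "length (nf q)" arbitrary: q rule: less_induct)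
    case less
    note q = Vc[OF less.prems]
    note pq = parent_props[OF q]
    show ?case
    proof (cases "parent q = \<one>")
      case True
      hence "{\<one>, q} \<in> snd (cayley_graph L X)" unfolding cayley_edges using q
        by (auto simp: insert_commute intro!: exI[of _ q])
      hence "q = v" using adj less.prems by blast
      thus ?thesis using gen_in_branch assms(1) by simp
    next
      case False
      hence "parent q \<in> branch v" using less.hyps[of "parent q"] parent[OF less.prems] pq(5) by simp
      moreover have "nf q = nf (parent q) @ [last (nf q)]" using pq(2) q nf_Nil_iff by simp
      ultimately show ?thesis using q by (auto simp: branch_def)
    qed
  qed
  thus "?V \<in> shapes v" using T parent by (auto simp: shapes_def)
  have "snd T = {{q, parent q} | q. q \<in> ?V}"
  proof
    show "{{q, parent q} | q. q \<in> ?V} \<subseteq> snd T" using edge by blast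
    show "snd T \<subseteq> {{q, parent q} | q. q \<in> ?V}"
    proof
      fix e assume e: "e \<in> snd T"
      then obtain q where q: "e = {q, parent q}" "q \<in> carrier L" "q \<noteq> \<one>"
        using T(1) unfolding is_subgraph_def cayley_edges by blast
      moreover have "e \<subseteq> fst T" using e T(1) by (simp add: is_subgraph_def)
      ultimately show "e \<in> {{q, parent q} | q. q \<in> ?V}" by blast
    qed
  qed
  thus "tree_of ?V = T" using T(4) by (auto simp: tree_of_def insert_absorb intro!: prod_eqI)
qed

lemma subtree_count_shapes:
  assumes "v \<in> X"
  shows "subtree_count L X v i j = card {V \<in> shapes v. card (inner V) = i \<and> card (V - inner V) = j}"
proof -
  have "bij_betw tree_of (shapes v) (subtrees_at L X v)"
  proof (rule bij_betw_byWitness[where f' = "\<lambda>T. fst T - {\<one>}"])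
    show "\<forall>V\<in>shapes v. fst (tree_of V) - {\<one>} = V"
      using branch_not_one by (auto simp: shapes_def tree_of_def)
    show "\<forall>T\<in>subtrees_at L X v. tree_of (fst T - {\<one>}) = T" using tree_of_surj assms by blast
    show "tree_of ` shapes v \<subseteq> subtrees_at L X v" using tree_of_shape assms by blast
    show "(\<lambda>T. fst T - {\<one>}) ` subtrees_at L X v \<subseteq> shapes v" using tree_of_surj assms by blast
  qed
  moreover have "fst (tree_of V) - leaves (tree_of V) = inner V" "leaves (tree_of V) - {\<one>} = V - inner V"
    if "V \<in> shapes v" for V
  proof -
    have "\<one> \<notin> V" using that one_notin_branch by (auto simp: shapes_def)
    thus "fst (tree_of V) - leaves (tree_of V) = inner V" "leaves (tree_of V) - {\<one>} = V - inner V"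
      using tree_of_shape(2)[OF assms that] by (auto simp: tree_of_def inner_def)
  qed
  ultimately have "bij_betw tree_of {V \<in> shapes v. card (inner V) = i \<and> card (V - inner V) = j}
     {T \<in> subtrees_at L X v. card (fst T - leaves T) = i \<and> card (leaves T - {\<one>}) = j}"
  proof -
    assume b: "bij_betw tree_of (shapes v) (subtrees_at L X v)"
      and c: "\<And>V. V \<in> shapes v \<Longrightarrow> fst (tree_of V) - leaves (tree_of V) = inner V"
        "\<And>V. V \<in> shapes v \<Longrightarrow> leaves (tree_of V) - {\<one>} = V - inner V"
    let ?A = "{V \<in> shapes v. card (inner V) = i \<and> card (V - inner V) = j}"
    have "inj_on tree_of ?A" using b by (auto simp: bij_betw_def inj_on_def)
    moreover have "tree_of ` ?A = {T \<in> tree_of ` shapes v. card (fst T - leaves T) = i \<and> card (leaves T - {\<one>}) = j}"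
      using c by auto
    ultimately show ?thesis using b by (simp add: bij_betw_def)
  qed
  from bij_betw_same_card[OF this] show ?thesis by (simp add: subtree_count_def)
qed

text \<open>The nonempty prefixes of a member are members too, so members are no longer than the shape is
  large.\<close>

lemma finite_shapes: "finite {V \<in> shapes v. card V \<le> n}"
proof -
  let ?ball = "ev ` {ws. set ws \<subseteq> X \<and> length ws \<le> n}"
  have "V \<subseteq> ?ball" if V: "V \<in> shapes v" "card V \<le> n" for V
  proof
    fix q assume q: "q \<in> V"
    have qc: "q \<in> carrier L" using V q branch_not_one by (auto simp: shapes_def)
    note r = nf_props[OF qc]
    have "ev (take k (nf q)) \<in> V \<and> nf (ev (take k (nf q))) = take k (nf q)"
      if k: "k \<in> {1..length (nf q)}" for k
    proof -
      have red: "reduced (take k (nf q))"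
        using r(1) by (metis append_take_drop_id reduced_append)
      hence n: "nf (ev (take k (nf q))) = take k (nf q)" by (rule nf_ev)
      moreover have "ev (take k (nf q)) \<noteq> \<one>"
        using n k by (metis One_nat_def Suc_le_D atLeastAtMost_iff length_0_conv length_take list.size(3) min.absorb2 nat.simps(3) nf_one)
      ultimately show ?thesis
        using shapes_closed[OF V(1) q, of "ev (take k (nf q))"] reduced_sub[OF red] take_is_prefix by auto
    qed
    hence "card ((\<lambda>k. ev (take k (nf q))) ` {1..length (nf q)}) \<le> card V"
      and "inj_on (\<lambda>k. ev (take k (nf q))) {1..length (nf q)}"
      using V(1) by (auto intro!: card_mono simp: shapes_def inj_on_def)
        (metis atLeastAtMost_iff length_take min.absorb2)
    hence "length (nf q) \<le> n" using V(2) by (simp add: card_image)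
    thus "q \<in> ?ball" using r by (intro image_eqI[of _ _ "nf q"]) (auto simp: reduced_def)
  qed
  hence "{V \<in> shapes v. card V \<le> n} \<subseteq> Pow ?ball" by blast
  moreover have "finite ?ball" using finite_lists_length_le[OF finite_X] by (rule finite_imageI)
  ultimately show ?thesis by (meson finite_Pow_iff finite_subset)
qed

end

context wreath_tree
begin

lemma spanned_shape: "f \<in> branch_funs v \<Longrightarrow> spanned f \<in> shapes v"
proof -
  assume f: "f \<in> branch_funs v"
  hence fF: "f \<in> F" "supp f \<subseteq> branch v" by (auto simp: branch_funs_def)
  have "spanned f \<subseteq> branch v"
    using fF(2) prefix_branch supp_carrier unfolding spanned_def by blast
  moreover have "parent q \<in> spanned f" if q: "q \<in> spanned f" "parent q \<noteq> \<one>" for q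
  proof -
    obtain j where j: "j \<in> supp f" "prefix (nf q) (nf j)" "q \<in> carrier L" "q \<noteq> \<one>"
      using q(1) unfolding spanned_def by blast
    note p = parent_props[OF j(3,4)]
    have "prefix (butlast (nf q)) (nf q)" by (metis append_butlast_last_id prefixI prefix_order.order_refl butlast.simps(1))
    hence "prefix (nf (parent q)) (nf j)" using j(2) p(2) by (metis prefix_order.trans)
    thus ?thesis using j(1) p(1) q(2) unfolding spanned_def by blast
  qed
  ultimately show ?thesis using fF by (simp add: shapes_def)
qed

text \<open>A finite tree is spanned by its leaves, and a leaf is not on the path from \<open>\<one>\<close> to any other
  vertex.\<close>

lemma spanned_eq_iff:
  assumes "V \<in> shapes v" "f \<in> branch_funs v"
  shows "spanned f = V \<longleftrightarrow> supp f \<subseteq> V \<and> V - inner V \<subseteq> supp f"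
proof
  assume V: "spanned f = V"
  have "\<one> \<notin> supp f" using assms(2) one_notin_branch by (auto simp: branch_funs_def)
  hence "supp f \<subseteq> V" using supp_spanned V by blast
  moreover have "q \<in> supp f" if q: "q \<in> V" "q \<notin> inner V" for q
  proof (rule ccontr)
    assume no: "q \<notin> supp f"
    obtain j where j: "j \<in> supp f" "prefix (nf q) (nf j)" and qc: "q \<in> carrier L" "q \<noteq> \<one>"
      using q(1) V by (auto simp: spanned_def)
    have jc: "j \<in> carrier L" using j supp_carrier by blast
    have "nf q \<noteq> nf j" using no j nf_inj qc jc by metis
    then obtain x ws where w: "nf j = nf q @ x # ws" using j(2)
      by (metis append.right_neutral neq_Nil_conv prefixE)
    let ?c = "ev (nf q @ [x])"
    have red: "reduced (nf q @ [x])" using nf_props(1)[OF jc] w by (auto simp: reduced_append reduced_Cons)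
    have c: "nf ?c = nf q @ [x]" "?c \<in> carrier L" using nf_ev[OF red] ev_closed[OF reduced_sub[OF red]] by auto
    have "parent ?c = q" "?c \<noteq> \<one>" using parent_inverse[OF qc(1) c(2,1)] by auto
    moreover have "?c \<in> V" unfolding V[symmetric] spanned_def
      using c calculation j(1) w by (auto intro!: bexI[of _ j])
    ultimately show False using q by (auto simp: inner_def)
  qed
  ultimately show "supp f \<subseteq> V \<and> V - inner V \<subseteq> supp f" by blast
next
  assume a: "supp f \<subseteq> V \<and> V - inner V \<subseteq> supp f"
  have fin: "finite V" and Vc: "\<And>q. q \<in> V \<Longrightarrow> q \<in> carrier L \<and> q \<noteq> \<one>"
    using assms(1) branch_not_one by (auto simp: shapes_def)
  have "spanned f \<subseteq> V" using a shapes_closed[OF assms(1)] by (auto simp: spanned_def)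
  moreover have "p \<in> spanned f" if p: "p \<in> V" for p
  proof -
    let ?A = "{q \<in> V. prefix (nf p) (nf q)}"
    have "finite ((\<lambda>q. length (nf q)) ` ?A)" "(\<lambda>q. length (nf q)) ` ?A \<noteq> {}" using fin p by auto
    from Max_in[OF this] Max_ge[OF this(1)]
    obtain q where q: "q \<in> ?A" "\<And>q'. q' \<in> ?A \<Longrightarrow> length (nf q') \<le> length (nf q)" by fastforce
    have "q \<notin> inner V"
    proof
      assume "q \<in> inner V"
      then obtain c where c: "c \<in> V" "parent c = q" by (auto simp: inner_def)
      note pc = parent_props[of c]
      have "prefix (butlast (nf c)) (nf c)" by (metis append_butlast_last_id prefixI prefix_order.order_refl butlast.simps(1))
      hence "prefix (nf p) (nf c)" using q(1) c pc(2) Vc by (auto intro: prefix_order.trans)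
      thus False using q(2)[of c] c pc(5) Vc by auto
    qed
    hence "q \<in> supp f" using a q by auto
    thus ?thesis using q(1) Vc p by (auto simp: spanned_def)
  qed
  ultimately show "spanned f = V" by blast
qed

text \<open>The vertices contribute independently: arbitrary values at inner vertices, nontrivial ones at
  leaves, and \<open>z\<^sup>2\<close> for the edge to the parent.\<close>

lemma gf_spanned:
  assumes "V \<in> shapes v"
  shows "gf {f \<in> branch_funs v. spanned f = V} weight =
    (fps_X\<^sup>2 * \<sigma>) ^ card (inner V) * (fps_X\<^sup>2 * (\<sigma> - 1)) ^ card (V - inner V)"
proof -
  have fin: "finite V" and Vb: "V \<subseteq> branch v" and Vc: "\<And>q. q \<in> V \<Longrightarrow> q \<in> carrier L"
    using assms(1) branch_not_one by (auto simp: shapes_def)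
  define A where "A = (\<lambda>p. if p \<in> inner V then carrier G else carrier G - {\<one>\<^bsub>G\<^esub>})"
  have fl: "fin_levels (A p) (\<lambda>g. 2 + glen g)" for p
    by (rule fin_levels_subset[OF fin_levels_G]) (auto simp: A_def)
  let ?S = "{f \<in> branch_funs v. spanned f = V}"
  have bij: "bij_betw (\<lambda>f. restrict f V) ?S (PiE V A)"
  proof (rule bij_betw_byWitness[where f' = "\<lambda>f. \<lambda>i\<in>carrier L. if i \<in> V then f i else \<one>\<^bsub>G\<^esub>"])
    show "\<forall>f\<in>?S. (\<lambda>i\<in>carrier L. if i \<in> V then restrict f V i else \<one>\<^bsub>G\<^esub>) = f"
    proof
      fix f assume f: "f \<in> ?S"
      hence "supp f \<subseteq> V" "f \<in> F" using spanned_eq_iff[OF assms] by (auto simp: branch_funs_def)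
      thus "(\<lambda>i\<in>carrier L. if i \<in> V then restrict f V i else \<one>\<^bsub>G\<^esub>) = f"
        by (intro ext) (auto simp: F_iff supp_def PiE_def extensional_def)
    qed
    show "\<forall>f\<in>PiE V A. restrict (\<lambda>i\<in>carrier L. if i \<in> V then f i else \<one>\<^bsub>G\<^esub>) V = f"
      using Vc by (auto intro!: ext simp: PiE_def extensional_def restrict_def)
    show "(\<lambda>f. restrict f V) ` ?S \<subseteq> PiE V A"
    proof
      fix g assume "g \<in> (\<lambda>f. restrict f V) ` ?S"
      then obtain f where f: "f \<in> ?S" "g = restrict f V" by blast
      have s: "V - inner V \<subseteq> supp f" "f \<in> F" using f spanned_eq_iff[OF assms] by (auto simp: branch_funs_def)
      have "f p \<in> A p" if "p \<in> V" for p
        using that s Vc[OF that] unfolding A_def supp_def by (cases "p \<in> inner V") auto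
      thus "g \<in> PiE V A" using f(2) by auto
    qed
    show "(\<lambda>f. \<lambda>i\<in>carrier L. if i \<in> V then f i else \<one>\<^bsub>G\<^esub>) ` PiE V A \<subseteq> ?S"
    proof
      fix g assume "g \<in> (\<lambda>f. \<lambda>i\<in>carrier L. if i \<in> V then f i else \<one>\<^bsub>G\<^esub>) ` PiE V A"
      then obtain f where f: "f \<in> PiE V A" "g = (\<lambda>i\<in>carrier L. if i \<in> V then f i else \<one>\<^bsub>G\<^esub>)" by blast
      have fA: "f p \<in> A p" if "p \<in> V" for p using f(1) that by auto
      have s: "supp g \<subseteq> V" unfolding f(2) supp_def by auto
      have o: "V - inner V \<subseteq> supp g"
      proof
        fix p assume p: "p \<in> V - inner V"
        thus "p \<in> supp g" using fA[of p] Vc[of p] unfolding f(2) supp_def A_def by auto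
      qed
      have "f p \<in> carrier G" if "p \<in> V" for p using fA[OF that] by (auto simp: A_def split: if_splits)
      hence "g \<in> F" using finite_subset[OF s fin] unfolding F_iff f(2) by auto
      hence "g \<in> branch_funs v" using s Vb by (auto simp: branch_funs_def)
      thus "g \<in> ?S" using spanned_eq_iff[OF assms] s o by blast
    qed
  qed
  have weight: "(\<Sum>p\<in>V. 2 + glen (restrict f V p)) = weight f" if f: "f \<in> ?S" for f
  proof -
    have "supp f \<subseteq> V" using f spanned_eq_iff[OF assms] by blast
    hence "(\<Sum>i\<in>supp f. glen (f i)) = (\<Sum>i\<in>V. glen (f i))" using fin Vc by (intro weight_sum_superset) auto
    hence "weight f = (\<Sum>p\<in>V. 2) + (\<Sum>p\<in>V. glen (f p))" using f by (simp add: weight_def)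
    also have "\<dots> = (\<Sum>p\<in>V. 2 + glen (f p))" by (simp only: sum.distrib)
    also have "\<dots> = (\<Sum>p\<in>V. 2 + glen (restrict f V p))" by (rule sum.cong) auto
    finally show ?thesis by (rule HOL.sym)
  qed
  have "gf ?S weight = gf (PiE V A) (\<lambda>f. \<Sum>p\<in>V. 2 + glen (f p))"
    using gf_bij[OF bij, where w = weight and w' = "\<lambda>f. \<Sum>p\<in>V. 2 + glen (f p)"] weight by blast
  also have "\<dots> = (\<Prod>p\<in>V. gf (A p) (\<lambda>g. 2 + glen g))"
    using gf_PiE[where A = A and w = "\<lambda>_ g. 2 + glen g", OF fin fl] by blast
  also have "\<dots> = (\<Prod>p\<in>V. if p \<in> inner V then fps_X\<^sup>2 * \<sigma> else fps_X\<^sup>2 * (\<sigma> - 1))"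
  proof (rule prod.cong[OF HOL.refl])
    fix p
    have "carrier G = {\<one>\<^bsub>G\<^esub>} \<union> (carrier G - {\<one>\<^bsub>G\<^esub>})" by auto
    hence "\<sigma> = gf {\<one>\<^bsub>G\<^esub>} glen + gf (carrier G - {\<one>\<^bsub>G\<^esub>}) glen"
      unfolding sigma_gf using gf_Un[of "{\<one>\<^bsub>G\<^esub>}" glen "carrier G - {\<one>\<^bsub>G\<^esub>}"]
        fin_levels_subset[OF fin_levels_G, of "carrier G - {\<one>\<^bsub>G\<^esub>}" glen]
      by (metis Diff_disjoint Diff_subset fin_levels_finite finite.emptyI finite_insert order_refl)
    hence "gf (carrier G - {\<one>\<^bsub>G\<^esub>}) glen = \<sigma> - 1" by (simp add: gf_singleton)
    thus "gf (A p) (\<lambda>g. 2 + glen g) = (if p \<in> inner V then fps_X\<^sup>2 * \<sigma> else fps_X\<^sup>2 * (\<sigma> - 1))"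
      by (cases "p \<in> inner V") (simp_all only: A_def if_True if_False gf_shift sigma_gf[symmetric])
  qed
  also have "\<dots> = (fps_X\<^sup>2 * \<sigma>) ^ card (inner V) * (fps_X\<^sup>2 * (\<sigma> - 1)) ^ card (V - inner V)"
  proof -
    have "inner V \<subseteq> V" by (auto simp: inner_def)
    hence "V \<inter> {p. p \<in> inner V} = inner V" "V \<inter> - {p. p \<in> inner V} = V - inner V" by auto
    thus ?thesis by (simp add: prod.If_cases[OF fin])
  qed
  finally show ?thesis .
qed

text \<open>The functions on a branch are sorted by the subtree that they span. A function of weight \<open>n\<close>
  spans at most \<open>n\<close> vertices, so it is accounted for by the indices \<open>i, j \<le> n\<close> in \<open>fps_compose2\<close>.\<close>

lemma gf_branch_funs:
  assumes "v \<in> X"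
  shows "gf (branch_funs v) weight = fps_compose2 (\<lambda>i j. of_nat (subtree_count L X v i j))
    (fps_X\<^sup>2 * \<sigma>) (fps_X\<^sup>2 * (\<sigma> - 1))"
proof (rule fps_ext)
  fix n
  define g where "g = (\<lambda>i j. ((fps_X\<^sup>2 * \<sigma>) ^ i * (fps_X\<^sup>2 * (\<sigma> - 1)) ^ j) $ n)"
  define I where "I = (\<lambda>V. (card (inner V), card (V - inner V)))"
  let ?S = "{V \<in> shapes v. I V \<in> {0..n} \<times> {0..n}}"
  have cV: "card V = card (inner V) + card (V - inner V)" if "V \<in> shapes v" for V
  proof -
    have "finite V" "inner V \<subseteq> V" using that by (auto simp: shapes_def inner_def)
    thus ?thesis by (metis card_Diff_subset card_mono finite_subset le_add_diff_inverse)
  qed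
  have finS: "finite ?S"
    by (rule finite_subset[OF _ finite_shapes[of v "n + n"]]) (use cV in \<open>force simp: I_def\<close>)
  have "{f \<in> branch_funs v. weight f = n} = (\<Union>V\<in>?S. {f \<in> {f \<in> branch_funs v. spanned f = V}. weight f = n})"
  proof -
    have "spanned f \<in> ?S" if "f \<in> branch_funs v" "weight f = n" for f
    proof -
      have s: "spanned f \<in> shapes v" using spanned_shape that by blast
      have "card (spanned f) \<le> n" using that(2) by (simp add: weight_def)
      thus ?thesis using s cV[OF s] by (simp add: I_def)
    qed
    thus ?thesis by blast
  qed
  moreover have "card (\<Union>V\<in>?S. {f \<in> {f \<in> branch_funs v. spanned f = V}. weight f = n}) =
      (\<Sum>V\<in>?S. card {f \<in> {f \<in> branch_funs v. spanned f = V}. weight f = n})"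
  proof (intro card_UN_disjoint finS ballI impI)
    fix V
    show "finite {f \<in> {f \<in> branch_funs v. spanned f = V}. weight f = n}"
      by (rule finite_subset[of _ "{f \<in> branch_funs v. weight f = n}"]) (use fin_levels_branch_funs[of v] in \<open>auto simp: fin_levels_def\<close>)
  qed auto
  ultimately have "gf (branch_funs v) weight $ n = (\<Sum>V\<in>?S. gf {f \<in> branch_funs v. spanned f = V} weight $ n)"
    by (simp add: gf_nth)
  also have "\<dots> = (\<Sum>V\<in>?S. case I V of (i, j) \<Rightarrow> g i j)"
    by (rule sum.cong) (auto simp: gf_spanned g_def I_def)
  also have "\<dots> = (\<Sum>p\<in>{0..n} \<times> {0..n}. \<Sum>V\<in>{V \<in> ?S. I V = p}. case I V of (i, j) \<Rightarrow> g i j)"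
    by (rule sum.group[symmetric, OF finS]) auto
  also have "\<dots> = (\<Sum>p\<in>{0..n} \<times> {0..n}. of_nat (subtree_count L X v (fst p) (snd p)) * g (fst p) (snd p))"
  proof (rule sum.cong[OF HOL.refl])
    fix p assume p: "p \<in> {0..n} \<times> {0..n}"
    have "(\<Sum>V\<in>{V \<in> ?S. I V = p}. case I V of (i, j) \<Rightarrow> g i j) = (\<Sum>V\<in>{V \<in> ?S. I V = p}. g (fst p) (snd p))"
      by (rule sum.cong) (auto simp: case_prod_unfold)
    moreover have "{V \<in> ?S. I V = p} = {V \<in> shapes v. card (inner V) = fst p \<and> card (V - inner V) = snd p}"
      using p by (auto simp: I_def)
    ultimately show "(\<Sum>V\<in>{V \<in> ?S. I V = p}. case I V of (i, j) \<Rightarrow> g i j) =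
       of_nat (subtree_count L X v (fst p) (snd p)) * g (fst p) (snd p)"
      by (simp only: subtree_count_shapes[OF assms] sum_constant)
  qed
  also have "\<dots> = (\<Sum>i=0..n. \<Sum>j=0..n. of_nat (subtree_count L X v i j) * g i j)"
    by (simp add: sum.cartesian_product case_prod_unfold)
  finally show "gf (branch_funs v) weight $ n = fps_compose2 (\<lambda>i j. of_nat (subtree_count L X v i j))
    (fps_X\<^sup>2 * \<sigma>) (fps_X\<^sup>2 * (\<sigma> - 1)) $ n"
    by (simp add: fps_compose2_def g_def)
qed

end

section \<open>Conjugacy in a group\<close>

context group
begin

definition conjugate :: "'a \<Rightarrow> 'a \<Rightarrow> bool" where
  "conjugate g h \<longleftrightarrow> g \<in> carrier G \<and> h \<in> carrier G \<and> (\<exists>k\<in>carrier G. k \<otimes> g = h \<otimes> k)"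

lemma conjugate_refl: "g \<in> carrier G \<Longrightarrow> conjugate g g"
  unfolding conjugate_def by auto

lemma conjugate_sym: assumes "conjugate g h" shows "conjugate h g"
proof -
  obtain k where k: "k \<in> carrier G" "k \<otimes> g = h \<otimes> k" and gh: "g \<in> carrier G" "h \<in> carrier G"
    using assms by (auto simp: conjugate_def)
  have "inv k \<otimes> h = inv k \<otimes> (h \<otimes> k) \<otimes> inv k" using k(1) gh by (simp add: m_assoc)
  also have "\<dots> = inv k \<otimes> (k \<otimes> g) \<otimes> inv k" using k by simp
  also have "\<dots> = g \<otimes> inv k" using k(1) gh by (simp flip: m_assoc)
  finally show ?thesis using k(1) gh by (auto simp: conjugate_def)
qed

lemma conjugate_trans: assumes "conjugate g h" "conjugate h l" shows "conjugate g l"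
proof -
  obtain k k' where k: "k \<in> carrier G" "k \<otimes> g = h \<otimes> k" "k' \<in> carrier G" "k' \<otimes> h = l \<otimes> k'"
    and c: "g \<in> carrier G" "h \<in> carrier G" "l \<in> carrier G"
    using assms by (auto simp: conjugate_def)
  have "k' \<otimes> k \<otimes> g = k' \<otimes> h \<otimes> k" using k(1-3) c by (simp add: m_assoc)
  also have "\<dots> = l \<otimes> (k' \<otimes> k)" unfolding k(4) using k(1,3) c by (simp add: m_assoc)
  finally show ?thesis using k c by (auto simp: conjugate_def)
qed

lemma conjugate_comm: "a \<in> carrier G \<Longrightarrow> b \<in> carrier G \<Longrightarrow> conjugate (a \<otimes> b) (b \<otimes> a)"
  unfolding conjugate_def by (auto simp: m_assoc intro!: bexI[of _ b])

lemma mem_conj_class_iff: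
  assumes "g \<in> carrier G" shows "h \<in> conj_class G g \<longleftrightarrow> conjugate g h"
proof
  assume "h \<in> conj_class G g"
  then obtain k where "k \<in> carrier G" "h = k \<otimes> g \<otimes> inv k" by (auto simp: conj_class_def)
  thus "conjugate g h" using assms by (auto simp: conjugate_def m_assoc intro!: bexI[of _ k])
next
  assume "conjugate g h"
  then obtain k where k: "k \<in> carrier G" "k \<otimes> g = h \<otimes> k" "h \<in> carrier G" by (auto simp: conjugate_def)
  have "h = k \<otimes> g \<otimes> inv k" using k by (simp add: m_assoc)
  thus "h \<in> conj_class G g" using k(1) by (auto simp: conj_class_def)
qed

lemma conj_class_eq_iff:
  assumes "g \<in> carrier G" "h \<in> carrier G"
  shows "conj_class G g = conj_class G h \<longleftrightarrow> conjugate g h"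
proof
  assume "conj_class G g = conj_class G h"
  thus "conjugate g h" using mem_conj_class_iff assms conjugate_refl by blast
next
  assume "conjugate g h"
  thus "conj_class G g = conj_class G h"
    using mem_conj_class_iff assms conjugate_sym conjugate_trans by blast
qed

definition inf_order :: "'a \<Rightarrow> bool" where
  "inf_order g \<longleftrightarrow> (\<forall>n>0. g [^] (n::nat) \<noteq> \<one>)"

lemma inf_order_iff: assumes "g \<in> carrier G" shows "inf_order g \<longleftrightarrow> ord g = 0"
proof -
  have "inf_order g \<longleftrightarrow> (\<forall>n>0. \<not> ord g dvd n)"
    unfolding inf_order_def using pow_eq_id[OF assms] by simp
  thus ?thesis by (cases "ord g = 0") auto
qed

lemma inf_order_conjugate: assumes "conjugate g h" "inf_order g" shows "inf_order h"
proof -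
  obtain k where k: "k \<in> carrier G" "k \<otimes> g = h \<otimes> k" and c: "g \<in> carrier G" "h \<in> carrier G"
    using assms(1) by (auto simp: conjugate_def)
  have pow: "k \<otimes> g [^] (n::nat) = h [^] n \<otimes> k" for n
  proof (induction n)
    case (Suc n)
    have "k \<otimes> g [^] Suc n = k \<otimes> g [^] n \<otimes> g" using k c by (simp add: m_assoc)
    also have "\<dots> = h [^] n \<otimes> (k \<otimes> g)" using Suc k(1) c by (simp add: m_assoc)
    also have "\<dots> = h [^] Suc n \<otimes> k" using k c by (simp add: m_assoc)
    finally show ?case .
  qed (use k in simp)
  show ?thesis unfolding inf_order_def
  proof (intro allI impI)
    fix n :: nat assume n: "n > 0"
    show "h [^] n \<noteq> \<one>"
    proof
      assume "h [^] n = \<one>"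
      hence "k \<otimes> g [^] n = k" using pow[of n] k by simp
      hence "g [^] n = \<one>" using k(1) c by simp
      thus False using assms(2) n by (simp add: inf_order_def)
    qed
  qed
qed

lemma inf_order_inv: assumes "g \<in> carrier G" "inf_order g" shows "inf_order (inv g)"
  unfolding inf_order_def
proof (intro allI impI)
  fix n :: nat assume n: "n > 0"
  show "inv g [^] n \<noteq> \<one>"
    using assms n nat_pow_inv[OF assms(1), of n] inv_eq_1_iff[of "g [^] n"] by (auto simp: inf_order_def)
qed

lemma inf_order_inj:
  assumes "g \<in> carrier G" "inf_order g" "h \<in> carrier G"
  shows "inj (\<lambda>n::nat. g [^] n \<otimes> h)"
proof (rule linorder_injI)
  fix m n :: nat assume mn: "m < n"
  show "g [^] m \<otimes> h \<noteq> g [^] n \<otimes> h"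
  proof
    assume "g [^] m \<otimes> h = g [^] n \<otimes> h"
    hence "g [^] m = g [^] n" using assms by simp
    moreover have "g [^] n = g [^] m \<otimes> g [^] (n - m)" using mn assms by (simp add: nat_pow_mult)
    ultimately have "g [^] (n - m) = \<one>" using assms(1) by (metis l_cancel_one' nat_pow_closed)
    thus False using assms(2) mn by (auto simp: inf_order_def)
  qed
qed

end

lemma not_successively:
  "\<not> successively P xs \<Longrightarrow> \<exists>as u v bs. xs = as @ u # v # bs \<and> \<not> P u v"
proof (induction P xs rule: successively.induct)
  case (3 P x y xs)
  show ?case
  proof (cases "P x y")
    case True
    then obtain as u v bs where "y # xs = as @ u # v # bs" "\<not> P u v" using 3 by auto
    thus ?thesis by (intro exI[of _ "x # as"]) auto
  next
    case False thus ?thesis by (intro exI[of _ "[]"]) auto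
  qed
qed auto

section \<open>Conjugacy classes as decorated cyclic words\<close>

context wreath_tree
begin

text \<open>The cursor moves along \<open>x\<close>, then \<open>f\<close> is written around its new position.\<close>

definition letter_elem :: "'l \<times> ('l \<Rightarrow> 'g) \<Rightarrow> ('l \<Rightarrow> 'g) \<times> 'l" where
  "letter_elem u = (shift (fst u) (snd u), fst u)"

definition decorated :: "('l \<times> ('l \<Rightarrow> 'g)) list \<Rightarrow> bool" where
  "decorated us \<longleftrightarrow> set us \<subseteq> X \<times> F"

definition Phi :: "('l \<times> ('l \<Rightarrow> 'g)) list \<Rightarrow> ('l \<Rightarrow> 'g) \<times> 'l" where
  "Phi us = W.ev (map letter_elem us)"

definition total_weight :: "('l \<times> ('l \<Rightarrow> 'g)) list \<Rightarrow> nat" where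
  "total_weight us = sum_list (map (\<lambda>u. 1 + weight (snd u)) us)"

text \<open>Consecutive generators do not cancel, and the label stays off the two branches through which the
  cursor word enters and leaves the vertex.\<close>

definition compatible :: "'l \<times> ('l \<Rightarrow> 'g) \<Rightarrow> 'l \<times> ('l \<Rightarrow> 'g) \<Rightarrow> bool" where
  "compatible u u' \<longleftrightarrow> fst u' \<noteq> inv (fst u) \<and> supp (snd u) \<inter> branch (inv (fst u)) = {} \<and>
     supp (snd u) \<inter> branch (fst u') = {}"

text \<open>Appending the first letter makes the condition on neighbours cyclic.\<close>

definition good :: "('l \<times> ('l \<Rightarrow> 'g)) list \<Rightarrow> bool" where
  "good us \<longleftrightarrow> us \<noteq> [] \<and> decorated us \<and> successively compatible (us @ [hd us])"

lemma decorated_simps [simp]: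
  "decorated []" "decorated (u # us) \<longleftrightarrow> fst u \<in> X \<and> snd u \<in> F \<and> decorated us" "decorated (us @ vs) \<longleftrightarrow> decorated us \<and> decorated vs"
  by (auto simp: decorated_def mem_Times_iff)

lemma total_weight_simps [simp]:
  "total_weight [] = 0" "total_weight (u # us) = Suc (weight (snd u)) + total_weight us" "total_weight (us @ vs) = total_weight us + total_weight vs"
  by (auto simp: total_weight_def)

lemma letter_elem_closed [simp]: "fst u \<in> X \<Longrightarrow> snd u \<in> F \<Longrightarrow> letter_elem u \<in> carrier W"
  by (simp add: letter_elem_def W_carrier)

lemma Phi_Nil [simp]: "Phi [] = \<one>\<^bsub>W\<^esub>" by (simp add: Phi_def)
lemma Phi_Cons [simp]: "Phi (u # us) = letter_elem u \<otimes>\<^bsub>W\<^esub> Phi us" by (simp add: Phi_def)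

lemma Phi_closed [simp]: "decorated us \<Longrightarrow> Phi us \<in> carrier W"
  by (induction us) auto

lemma Phi_append [simp]: "decorated us \<Longrightarrow> decorated vs \<Longrightarrow> Phi (us @ vs) = Phi us \<otimes>\<^bsub>W\<^esub> Phi vs"
  by (induction us) (auto simp: W.m_assoc)

lemma gen_W [simp]: "x \<in> X \<Longrightarrow> (fone, x) \<in> carrier W" by (simp add: W_carrier)
lemma fun_W [simp]: "f \<in> F \<Longrightarrow> (f, \<one>) \<in> carrier W" by (simp add: W_carrier)

lemma letter_elem_right: "x \<in> X \<Longrightarrow> f \<in> F \<Longrightarrow> g \<in> F \<Longrightarrow> letter_elem (x, f) \<otimes>\<^bsub>W\<^esub> (g, \<one>) = letter_elem (x, pmul f g)"
  by (simp add: letter_elem_def shift_pmul)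

lemma letter_elem_left: "x \<in> X \<Longrightarrow> f \<in> F \<Longrightarrow> g \<in> F \<Longrightarrow> (shift x g, \<one>) \<otimes>\<^bsub>W\<^esub> letter_elem (x, f) = letter_elem (x, pmul g f)"
  by (simp add: letter_elem_def shift_pmul)

lemma letter_elem_back:
  assumes "x \<in> X" "f \<in> F" "g \<in> F"
  shows "letter_elem (x, f) \<otimes>\<^bsub>W\<^esub> letter_elem (inv x, g) = (pmul (shift x f) g, \<one>)"
  using assms by (simp add: letter_elem_def shift_shift)

lemma has_word_Phi: "decorated us \<Longrightarrow> W.has_word Z (total_weight us) (Phi us)"
proof (induction us)
  case Nil show ?case using W.has_word_one by simp
next
  case (Cons u us)
  have u: "fst u \<in> X" "snd u \<in> F" using Cons.prems by auto
  have "W.has_word Z (1 + weight (snd u)) ((fone, fst u) \<otimes>\<^bsub>W\<^esub> (snd u, \<one>))"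
    by (intro W.has_word_mult Z_sub has_word_gen has_word_fun u)
  moreover have "(fone, fst u) \<otimes>\<^bsub>W\<^esub> (snd u, \<one>) = letter_elem u" using u by (simp add: letter_elem_def)
  ultimately have "W.has_word Z (1 + weight (snd u) + total_weight us) (letter_elem u \<otimes>\<^bsub>W\<^esub> Phi us)"
    using W.has_word_mult[OF Z_sub] Cons by (metis decorated_simps(2))
  thus ?case by simp
qed

subsection \<open>Rotations\<close>

lemma good_rotate1: "good us \<Longrightarrow> good (rotate1 us)"
  by (cases us) (auto simp: good_def successively_append_iff successively_Cons split: if_splits)

lemma good_rotate: "good us \<Longrightarrow> good (rotate n us)"
  by (induction n) (auto simp: good_rotate1)

lemma total_weight_rotate [simp]: "total_weight (rotate n us) = total_weight us"
proof (induction n)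
  case (Suc n)
  have "total_weight (rotate1 vs) = total_weight vs" for vs by (cases vs) auto
  thus ?case using Suc by simp
qed simp

lemma conjugate_swap: "decorated us \<Longrightarrow> decorated vs \<Longrightarrow> W.conjugate (Phi (us @ vs)) (Phi (vs @ us))"
  by (simp add: W.conjugate_comm)

lemma conjugate_rotate: "decorated us \<Longrightarrow> W.conjugate (Phi us) (Phi (rotate n us))"
proof -
  assume "decorated us"
  hence "decorated (take (n mod length us) us @ drop (n mod length us) us)" by simp
  hence d: "decorated (take (n mod length us) us)" "decorated (drop (n mod length us) us)"
    unfolding decorated_simps by auto
  show ?thesis using conjugate_swap[OF d] by (simp add: rotate_drop_take del: Phi_append)
qed

subsection \<open>Every class with infinite cursor contains a good word\<close>

text \<open>A trailing function is absorbed by the last letter. Up to conjugacy, this also disposes of a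
  leading function.\<close>

lemma append_fun:
  assumes "decorated us" "us \<noteq> []" "h \<in> F"
  shows "\<exists>vs. decorated vs \<and> vs \<noteq> [] \<and> Phi vs = Phi us \<otimes>\<^bsub>W\<^esub> (h, \<one>) \<and> total_weight vs \<le> total_weight us + weight h
    \<and> length vs = length us"
proof -
  obtain ts x f where us: "us = ts @ [(x, f)]" using assms(2) by (metis prod.exhaust rev_exhaust)
  have d: "decorated ts" "x \<in> X" "f \<in> F" using assms us by auto
  have "Phi (ts @ [(x, pmul f h)]) = Phi us \<otimes>\<^bsub>W\<^esub> (h, \<one>)"
    using d assms(3) by (simp add: us W.m_assoc letter_elem_right)
  moreover have "total_weight (ts @ [(x, pmul f h)]) \<le> total_weight us + weight h"
    using us weight_pmul[of f h] d assms(3) by simp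
  ultimately show ?thesis using us d assms(3) by (intro exI[of _ "ts @ [(x, pmul f h)]"]) auto
qed

text \<open>A generator from \<open>X\<close> opens a new letter, and a generator from \<open>Y\<close> multiplies the leading function.
  Either of them adds at most \<open>1\<close> to the total weight, as weights are subadditive.\<close>

lemma word_decorated:
  assumes "set ws \<subseteq> Z"
  shows "\<exists>f us. f \<in> F \<and> decorated us \<and> W.ev ws = (f, \<one>) \<otimes>\<^bsub>W\<^esub> Phi us \<and> weight f + total_weight us \<le> length ws"
  using assms
proof (induction ws)
  case Nil show ?case by (intro exI[of _ fone] exI[of _ "[]"]) (auto simp: W_one)
next
  case (Cons w ws)
  then obtain f us where IH: "f \<in> F" "decorated us" "W.ev ws = (f, \<one>) \<otimes>\<^bsub>W\<^esub> Phi us" "weight f + total_weight us \<le> length ws"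
    by auto
  from Cons.prems consider x where "x \<in> X" "w = (fone, x)" | y where "y \<in> Y" "w = (wreath_vec G L y, \<one>)"
    by (auto simp: Z_eq)
  thus ?case
  proof cases
    case 1
    have "W.ev (w # ws) = (fone, x) \<otimes>\<^bsub>W\<^esub> (f, \<one>) \<otimes>\<^bsub>W\<^esub> Phi us"
      using IH 1 by (simp add: W.m_assoc del: W_mult)
    also have "(fone, x) \<otimes>\<^bsub>W\<^esub> (f, \<one>) = letter_elem (x, f)" using IH 1 by (simp add: letter_elem_def)
    finally show ?thesis using IH 1
      by (intro exI[of _ fone] exI[of _ "(x, f) # us"]) (auto simp: W_one[symmetric])
  next
    case 2
    let ?y = "wreath_vec G L y"
    have yG: "y \<in> carrier G" using 2 Y_sub by auto
    note y = wreath_vec_F[OF yG]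
    have "weight ?y = glen y"
    proof -
      have "supp ?y \<inter> branch x = {}" for x using y(2) one_notin_branch by blast
      from weight_no_branch(2)[OF y(1) this] show ?thesis by (simp add: wreath_vec_def)
    qed
    moreover have "glen y \<le> 1" using G.word_length_le[OF G.has_word_gen] 2 Y_sub by blast
    ultimately have "weight (pmul ?y f) \<le> 1 + weight f" using weight_pmul[OF y(1) IH(1)] by simp
    moreover have "W.ev (w # ws) = (?y, \<one>) \<otimes>\<^bsub>W\<^esub> (f, \<one>) \<otimes>\<^bsub>W\<^esub> Phi us"
      using IH 2 y by (simp add: W.m_assoc del: W_mult)
    ultimately show ?thesis using IH y
      by (intro exI[of _ "pmul ?y f"] exI[of _ us]) auto
  qed
qed

lemma snd_W_mult: "a \<in> carrier W \<Longrightarrow> b \<in> carrier W \<Longrightarrow> snd (a \<otimes>\<^bsub>W\<^esub> b) = snd a \<otimes> snd b"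
  by (cases a; cases b) simp

lemma snd_conjugate: assumes "W.conjugate a b" shows "conjugate (snd a) (snd b)"
proof -
  obtain k where k: "k \<in> carrier W" "k \<otimes>\<^bsub>W\<^esub> a = b \<otimes>\<^bsub>W\<^esub> k" "a \<in> carrier W" "b \<in> carrier W"
    using assms by (auto simp: W.conjugate_def)
  have "snd k \<otimes> snd a = snd b \<otimes> snd k" using k snd_W_mult by metis
  thus ?thesis using k by (auto simp: conjugate_def W_carrier)
qed

lemma snd_Phi: "decorated us \<Longrightarrow> snd (Phi us) = ev (map fst us)"
proof (induction us)
  case (Cons u us)
  thus ?case by (simp add: snd_W_mult) (simp add: letter_elem_def)
qed (simp add: W_one)

text \<open>A decorated word that is not good can be simplified: cancel two letters, or hand the part of
  a decoration that lies on a branch along the cyclic word over to the neighbouring letter. The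
  former may leave the weight unchanged but shortens the word.\<close>

lemma not_good_simplify:
  assumes "decorated us" "us \<noteq> []" "\<not> good us" "inf_order (snd (Phi us))"
  shows "\<exists>vs. decorated vs \<and> vs \<noteq> [] \<and> W.conjugate (Phi us) (Phi vs) \<and> total_weight vs \<le> total_weight us \<and>
    total_weight vs + length vs < total_weight us + length us"
proof -
  obtain as u u' bs where dec: "us @ [hd us] = as @ u # u' # bs" "\<not> compatible u u'"
    using not_successively assms unfolding good_def by blast
  have "\<exists>zs. decorated (zs @ [u]) \<and> hd (zs @ [u]) = u' \<and> W.conjugate (Phi us) (Phi (zs @ [u])) \<and> total_weight (zs @ [u]) = total_weight us
    \<and> length (zs @ [u]) = length us"
  proof (cases bs rule: rev_cases)
    case Nil
    hence "us = as @ [u]" "hd us = u'" using dec(1) by (metis append_Cons append_Nil append_assoc butlast_snoc last_snoc)+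
    thus ?thesis using assms W.conjugate_refl[OF Phi_closed[OF assms(1)]] by (intro exI[of _ as]) auto
  next
    case (snoc bs' b)
    hence us: "us = (as @ [u]) @ (u' # bs')" using dec(1) by (metis append.assoc append_Cons append_Nil butlast_snoc)
    hence "W.conjugate (Phi us) (Phi ((u' # bs') @ (as @ [u])))" using assms(1) conjugate_swap by (metis decorated_simps(3))
    thus ?thesis using us assms(1) by (intro exI[of _ "u' # bs' @ as"]) auto
  qed
  then obtain zs where zs: "decorated (zs @ [u])" "hd (zs @ [u]) = u'" "W.conjugate (Phi us) (Phi (zs @ [u]))"
    "total_weight (zs @ [u]) = total_weight us" "length (zs @ [u]) = length us" by blast
  obtain x f where u: "u = (x, f)" "x \<in> X" "f \<in> F" using zs(1) by (cases u) auto
  have xi: "x \<in> carrier L" "inv x \<in> X" using u X_inv by auto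
  have inf: "inf_order (snd (Phi (zs @ [u])))" using inf_order_conjugate[OF snd_conjugate[OF zs(3)]] assms(4) by blast
  have goal: ?thesis if "decorated vs" "vs \<noteq> []" "W.conjugate (Phi (zs @ [u])) (Phi vs)" "total_weight vs \<le> total_weight (zs @ [u])"
    "total_weight vs + length vs < total_weight (zs @ [u]) + length (zs @ [u])" for vs
    using that zs W.conjugate_trans by metis
  from dec(2) consider "fst u' = inv x" | "supp f \<inter> branch (inv x) \<noteq> {}"
    | "supp f \<inter> branch (fst u') \<noteq> {}" by (auto simp: compatible_def u)
  thus ?thesis
  proof cases
    \<comment> \<open>Cancelling generators: with three or more letters, the two letters are merged into the one before
      them; with fewer, the cursor would have finite order.\<close>
    case 1
    show ?thesis
    proof (cases zs)
      case Nil
      hence "inv x = x" using zs(2) 1 u(1) by (metis append_Nil fst_conv list.sel(1))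
      hence "x \<otimes> x = \<one>" using xi by (metis r_inv)
      hence "x [^] (2::nat) = \<one>" using xi by (simp add: numeral_2_eq_2)
      moreover have "snd (Phi (zs @ [u])) = x"
        using zs(1) u xi Nil by (subst snd_Phi) auto
      ultimately have False using inf unfolding inf_order_def by (metis zero_less_numeral)
      thus ?thesis ..
    next
      case (Cons z ys)
      obtain f' where z: "z = (inv x, f')" "f' \<in> F" using Cons zs 1 by (cases z) auto
      show ?thesis
      proof (cases ys rule: rev_cases)
        case Nil
        hence "snd (Phi (zs @ [u])) = \<one>" using Cons z u xi zs(1) by (subst snd_Phi) auto
        hence False using inf unfolding inf_order_def by (metis nat_pow_one zero_less_one)
        thus ?thesis ..
      next
        case (snoc ts w)
        obtain y g where w: "w = (y, g)" by (cases w)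
        have d: "decorated ts" "y \<in> X" "g \<in> F" using zs(1) Cons snoc w by auto
        have zsu: "zs @ [u] = [z] @ (ts @ [w, u])" using Cons snoc by simp
        let ?q = "pmul (shift x f) f'"
        have q: "?q \<in> F" using u z xi by simp
        have "Phi ((ts @ [w, u]) @ [z]) = Phi ts \<otimes>\<^bsub>W\<^esub> (letter_elem (y, g) \<otimes>\<^bsub>W\<^esub> (letter_elem (x, f) \<otimes>\<^bsub>W\<^esub> letter_elem (inv x, f')))"
          using d u w z xi by (simp add: W.m_assoc)
        also have "\<dots> = Phi (ts @ [(y, pmul g ?q)])"
          using d u z q by (simp add: letter_elem_back letter_elem_right)
        finally have "Phi ((ts @ [w, u]) @ [z]) = Phi (ts @ [(y, pmul g ?q)])" .
        moreover have "W.conjugate (Phi (zs @ [u])) (Phi ((ts @ [w, u]) @ [z]))"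
          unfolding zsu using d u w z xi by (intro conjugate_swap) auto
        ultimately have c: "W.conjugate (Phi (zs @ [u])) (Phi (ts @ [(y, pmul g ?q)]))" by simp
        have "weight (pmul g ?q) \<le> weight g + (2 + weight f + weight f')"
          using weight_pmul[OF d(3) q] weight_pmul[of "shift x f" f'] weight_shift_le[OF u(2,3)] u z xi by simp
        hence "total_weight (ts @ [(y, pmul g ?q)]) \<le> total_weight (zs @ [u])" using zsu u z w by simp
        moreover have "length (ts @ [(y, pmul g ?q)]) < length (zs @ [u])" using zsu by simp
        ultimately show ?thesis using d q c by (intro goal[of "ts @ [(y, pmul g ?q)]"]) auto
      qed
    qed
  next
    \<comment> \<open>The label reaches back into the branch along which the cursor came: the preceding letter in the
      cyclic order takes over that part.\<close>
    case 2
    let ?y = "inv x"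
    let ?h = "pull ?y f" and ?f = "cut (- branch ?y) f"
    note h = pull_props[OF xi(2) u(3)]
    have wf: "weight f = weight ?f + 2 + weight ?h" using weight_pull[OF xi(2) u(3) 2] .
    have fe: "f = pmul (shift ?y ?h) ?f" using cut_pmul(2)[OF u(3), of "branch ?y"] h(3) by simp
    have d: "decorated zs" "decorated ((x, ?f) # zs)" using zs(1) u by auto
    have hF: "?h \<in> F" "?f \<in> F" "shift ?y ?h \<in> F" using h u xi by auto
    have "shift x f = pmul ?h (shift x ?f)"
      by (subst fe) (use hF xi u in \<open>simp add: shift_pmul shift_shift\<close>)
    hence "letter_elem (x, f) = (?h, \<one>) \<otimes>\<^bsub>W\<^esub> letter_elem (x, ?f)" using hF u xi by (simp add: letter_elem_def)
    hence "Phi ([u] @ zs) = (?h, \<one>) \<otimes>\<^bsub>W\<^esub> Phi ((x, ?f) # zs)"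
      using d hF u by (simp add: W.m_assoc)
    hence "W.conjugate (Phi ([u] @ zs)) (Phi ((x, ?f) # zs) \<otimes>\<^bsub>W\<^esub> (?h, \<one>))"
      using W.conjugate_comm[OF fun_W[OF hF(1)] Phi_closed[OF d(2)]] by simp
    moreover have "W.conjugate (Phi (zs @ [u])) (Phi ([u] @ zs))" using zs(1) u d by (intro conjugate_swap) auto
    ultimately have c: "W.conjugate (Phi (zs @ [u])) (Phi ((x, ?f) # zs) \<otimes>\<^bsub>W\<^esub> (?h, \<one>))" using W.conjugate_trans by blast
    obtain vs where vs: "decorated vs" "vs \<noteq> []" "Phi vs = Phi ((x, ?f) # zs) \<otimes>\<^bsub>W\<^esub> (?h, \<one>)"
      "total_weight vs \<le> total_weight ((x, ?f) # zs) + weight ?h" "length vs = length ((x, ?f) # zs)"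
      using append_fun[OF d(2) _ hF(1)] by blast
    show ?thesis by (rule goal[of vs]) (use vs c wf u in auto)
  next
    \<comment> \<open>The label reaches ahead into the branch along which the cursor leaves: the next letter takes over.
      It may be the same letter, if there is only one.\<close>
    case 3
    let ?y = "fst u'"
    have y: "?y \<in> X" using zs(1,2) by (cases zs) auto
    let ?h = "pull ?y f" and ?f = "cut (- branch ?y) f"
    note h = pull_props[OF y u(3)]
    have wf: "weight f = weight ?f + 2 + weight ?h" using weight_pull[OF y u(3) 3] .
    have fe: "f = pmul ?f (shift ?y ?h)" using cut_pmul(1)[OF u(3), of "branch ?y"] h(3) by simp
    have hF: "?h \<in> F" "?f \<in> F" "shift ?y ?h \<in> F" using h u y by auto
    have d: "decorated zs" "decorated (zs @ [(x, ?f)])" using zs(1) u hF by auto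
    have "letter_elem (x, f) = letter_elem (x, ?f) \<otimes>\<^bsub>W\<^esub> (shift ?y ?h, \<one>)"
      by (subst fe) (simp only: letter_elem_right[OF u(2) hF(2,3)])
    hence "Phi (zs @ [u]) = Phi (zs @ [(x, ?f)]) \<otimes>\<^bsub>W\<^esub> (shift ?y ?h, \<one>)"
      using d hF u by (simp add: W.m_assoc)
    hence c: "W.conjugate (Phi (zs @ [u])) ((shift ?y ?h, \<one>) \<otimes>\<^bsub>W\<^esub> Phi (zs @ [(x, ?f)]))"
      using W.conjugate_comm[OF Phi_closed[OF d(2)] fun_W[OF hF(3)]] by simp
    obtain g ts where ts: "zs @ [(x, ?f)] = (?y, g) # ts"
    proof (cases zs)
      case Nil
      hence "?y = x" using zs(2) u by auto
      thus ?thesis using that Nil by auto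
    next
      case (Cons z zs')
      thus ?thesis using that zs(2) by (cases z) auto
    qed
    have gd: "g \<in> F" "decorated ts" using d(2) unfolding ts by auto
    have "(shift ?y ?h, \<one>) \<otimes>\<^bsub>W\<^esub> Phi (zs @ [(x, ?f)]) = Phi ((?y, pmul ?h g) # ts)"
      unfolding ts using gd hF y letter_elem_left[OF y gd(1) hF(1)] by (simp add: W.m_assoc[symmetric])
    moreover have "total_weight ((?y, pmul ?h g) # ts) < total_weight (zs @ [u])"
    proof -
      have "total_weight ((?y, pmul ?h g) # ts) \<le> total_weight (zs @ [(x, ?f)]) + weight ?h"
        unfolding ts using weight_pmul[OF hF(1) gd(1)] by simp
      thus ?thesis using wf u by simp
    qed
    moreover have "length ((?y, pmul ?h g) # ts) = length (zs @ [u])"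
      using arg_cong[OF ts, of length] by simp
    ultimately show ?thesis using c gd hF y by (intro goal[of "(?y, pmul ?h g) # ts"]) auto
  qed
qed

text \<open>A shortest word for \<open>w\<close> gives a decorated word of at most that weight. Among all decorated words
  that are conjugate to \<open>w\<close> and not heavier, one with the least sum of weight and number of letters
  is good.\<close>

lemma good_representative:
  assumes "w \<in> carrier W" "inf_order (snd w)"
  shows "\<exists>us. good us \<and> W.conjugate w (Phi us) \<and> total_weight us \<le> word_length W Z w"
proof -
  obtain n where "W.has_word Z n w" using has_word_W assms(1) by blast
  from W.word_lengthE[OF this]
  obtain ws where ws: "set ws \<subseteq> Z" "length ws = word_length W Z w" "W.ev ws = w" by metis
  obtain f us where us: "f \<in> F" "decorated us" "w = (f, \<one>) \<otimes>\<^bsub>W\<^esub> Phi us" "weight f + total_weight us \<le> word_length W Z w"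
    using word_decorated[OF ws(1)] ws by auto
  have "us \<noteq> []"
  proof
    assume "us = []"
    hence "snd w = \<one>" using us by (simp add: W_one)
    thus False using assms(2) unfolding inf_order_def by (metis nat_pow_one zero_less_one)
  qed
  then obtain vs where vs: "decorated vs" "vs \<noteq> []" "Phi vs = Phi us \<otimes>\<^bsub>W\<^esub> (f, \<one>)" "total_weight vs \<le> total_weight us + weight f"
    using append_fun[OF us(2) _ us(1)] by blast
  have cv: "W.conjugate w (Phi vs)" unfolding us(3) vs(3) using us by (intro W.conjugate_comm) auto
  define P where "P = (\<lambda>vs. decorated vs \<and> vs \<noteq> [] \<and> W.conjugate w (Phi vs) \<and> total_weight vs \<le> word_length W Z w)"
  have "P vs" using vs us(4) cv by (simp add: P_def)
  from ex_has_least_nat[of P, OF this, of "\<lambda>vs. total_weight vs + length vs"]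
  obtain vs' where v: "P vs'" "\<And>y. P y \<Longrightarrow> total_weight vs' + length vs' \<le> total_weight y + length y" by blast
  have "good vs'"
  proof (rule ccontr)
    assume "\<not> good vs'"
    moreover have "inf_order (snd (Phi vs'))" using v(1) inf_order_conjugate[OF snd_conjugate[of w "Phi vs'"]] assms(2) by (auto simp: P_def)
    ultimately obtain y where y: "decorated y" "y \<noteq> []" "W.conjugate (Phi vs') (Phi y)" "total_weight y \<le> total_weight vs'"
      "total_weight y + length y < total_weight vs' + length vs'"
      using not_good_simplify v(1) unfolding P_def by metis
    moreover have "W.conjugate w (Phi y)" using y(3) v(1) W.conjugate_trans unfolding P_def by blast
    ultimately have "P y" using v(1) unfolding P_def by simp
    thus False using v(2)[of y] y(5) by simp
  qed
  thus ?thesis using v(1) by (auto simp: P_def)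
qed

end

section \<open>Good words are determined up to rotation\<close>

context tree_group
begin

lemma pow_Suc_left:
  "g \<in> carrier L \<Longrightarrow> h \<in> carrier L \<Longrightarrow> g [^] Suc k \<otimes> h = g \<otimes> (g [^] k \<otimes> h)"
  by (simp only: nat_pow_Suc2 m_assoc nat_pow_closed)

lemma ev_map_inv: "set ws \<subseteq> carrier L \<Longrightarrow> ev (rev (map (m_inv L) ws)) = inv (ev ws)"
proof (induction ws)
  case (Cons x ws)
  have "ev (rev (map (m_inv L) ws) @ [inv x]) = ev (rev (map (m_inv L) ws)) \<otimes> ev [inv x]"
    using Cons.prems by (intro ev_append) auto
  thus ?case using Cons by (simp add: inv_mult_group del: foldr_append)
qed simp

lemma nf_inv: assumes "g \<in> carrier L" shows "nf (inv g) = rev (map (m_inv L) (nf g))"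
proof (rule nf_eqI)
  have r: "set (nf g) \<subseteq> X" "successively (\<lambda>x y. y \<noteq> inv x) (nf g)"
    using nf_props(1)[OF assms] by (auto simp: reduced_def)
  show "reduced (rev (map (m_inv L) (nf g)))"
    unfolding reduced_def
  proof
    show "set (rev (map (m_inv L) (nf g))) \<subseteq> X" using r(1) X_inv by auto
    show "successively (\<lambda>x y. y \<noteq> inv x) (rev (map (m_inv L) (nf g)))"
      unfolding successively_rev successively_map
      by (rule successively_mono[OF r(2)]) (use r(1) in \<open>metis X_carrier inv_inv subsetD\<close>)
  qed
  show "ev (rev (map (m_inv L) (nf g))) = inv g"
    using ev_map_inv[of "nf g"] nf_props(2)[OF assms] r(1) X_sub by simp
qed

end

context wreath_tree
begin

text \<open>The end marker \<open>(y, fone)\<close> turns the condition on consecutive letters of a cyclic word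
  into one on a linear word that is followed by \<open>y\<close>.\<close>

definition chain :: "('l \<times> ('l \<Rightarrow> 'g)) list \<Rightarrow> 'l \<Rightarrow> bool" where
  "chain us y \<longleftrightarrow> successively compatible (us @ [(y, fone)])"

lemma chain_Cons:
  "chain (u # us) y \<longleftrightarrow> compatible u (if us = [] then (y, fone) else hd us) \<and> chain us y"
  by (auto simp: chain_def successively_Cons)

lemma chain_Nil [simp]: "chain [] y" by (simp add: chain_def)

lemma good_chain: "good us \<Longrightarrow> chain us (fst (hd us))"
  unfolding good_def chain_def successively_append_iff by (auto simp: compatible_def)

lemma good_hd: "good us \<Longrightarrow> fst (hd us) \<in> X"
  by (cases us) (auto simp: good_def)

lemma snd_Phi_closed: "decorated us \<Longrightarrow> snd (Phi us) \<in> carrier L"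
  using Phi_closed[of us] by (cases "Phi us") (auto simp: W_carrier)

lemma fst_Phi_F: "decorated us \<Longrightarrow> fst (Phi us) \<in> F"
  using Phi_closed[of us] by (cases "Phi us") (auto simp: W_carrier)

lemma fst_Phi_Cons:
  assumes "decorated (u # us)"
  shows "fst (Phi (u # us)) = shift (fst u) (pmul (snd u) (fst (Phi us)))"
proof -
  obtain P b where P: "Phi us = (P, b)" by (cases "Phi us")
  have "P \<in> F" using fst_Phi_F[of us] assms P by simp
  thus ?thesis using assms P by (simp add: letter_elem_def shift_pmul)
qed

lemma snd_Phi_Cons: "decorated (u # us) \<Longrightarrow> snd (Phi (u # us)) = fst u \<otimes> snd (Phi us)"
  by (simp add: snd_W_mult) (simp add: letter_elem_def)

text \<open>With \<open>b\<close> the cursor of \<open>Phi us\<close> and \<open>S\<close> the branch of its first letter, the function lives on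
  \<open>S - b S\<close>, which meets every orbit of \<open>b\<close> at most once.\<close>

lemma Phi_supp:
  assumes "decorated us" "us \<noteq> []" "chain us y" "y \<in> X"
  shows "supp (fst (Phi us)) \<subseteq> branch (fst (hd us))"
    and "\<And>j. j \<in> branch y \<Longrightarrow> nf (snd (Phi us) \<otimes> j) = map fst us @ nf j"
    and "\<And>j. j \<in> branch y \<Longrightarrow> snd (Phi us) \<otimes> j \<notin> supp (fst (Phi us))"
proof -
  have "supp (fst (Phi us)) \<subseteq> branch (fst (hd us)) \<and>
    (\<forall>j\<in>branch y. nf (snd (Phi us) \<otimes> j) = map fst us @ nf j \<and>
       snd (Phi us) \<otimes> j \<in> branch (fst (hd us)) \<and> snd (Phi us) \<otimes> j \<notin> supp (fst (Phi us)))"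
    using assms(1,2,3)
  proof (induction us)
    case (Cons u us)
    obtain x f where u: "u = (x, f)" "x \<in> X" "f \<in> F" using Cons.prems by (cases u) auto
    have x: "x \<in> carrier L" using u by simp
    define y' where "y' = (if us = [] then y else fst (hd us))"
    have compatible: "y' \<noteq> inv x" "supp f \<inter> branch (inv x) = {}" "supp f \<inter> branch y' = {}"
      using Cons.prems(3) by (auto simp: chain_Cons u compatible_def y'_def split: if_splits)
    have d: "decorated us" "decorated (u # us)" using Cons.prems by auto
    let ?P = "fst (Phi us)" and ?b = "snd (Phi us)"
    have P: "?P \<in> F" and b: "?b \<in> carrier L" using fst_Phi_F snd_Phi_closed d by auto
    have IH: "supp ?P \<subseteq> branch y'"
      "\<And>j. j \<in> branch y \<Longrightarrow> nf (?b \<otimes> j) = map fst us @ nf j"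
      "\<And>j. j \<in> branch y \<Longrightarrow> ?b \<otimes> j \<in> branch y'"
      "\<And>j. j \<in> branch y \<Longrightarrow> ?b \<otimes> j \<notin> supp ?P"
    proof -
      have "supp ?P \<subseteq> branch y' \<and> (\<forall>j\<in>branch y. nf (?b \<otimes> j) = map fst us @ nf j \<and>
        ?b \<otimes> j \<in> branch y' \<and> ?b \<otimes> j \<notin> supp ?P)"
      proof (cases "us = []")
        case True
        thus ?thesis using branch_carrier by (auto simp: y'_def W_one)
      next
        case False
        thus ?thesis using Cons.IH d Cons.prems(3) by (simp add: y'_def chain_Cons)
      qed
      thus "supp ?P \<subseteq> branch y'"
        "\<And>j. j \<in> branch y \<Longrightarrow> nf (?b \<otimes> j) = map fst us @ nf j"
        "\<And>j. j \<in> branch y \<Longrightarrow> ?b \<otimes> j \<in> branch y'"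
        "\<And>j. j \<in> branch y \<Longrightarrow> ?b \<otimes> j \<notin> supp ?P" by blast+
    qed
    have out: "i \<notin> branch (inv x)" if "i \<in> supp f \<union> supp ?P \<or> i \<in> branch y'" for i
      using that compatible IH(1) branch_disjoint by blast
    have s: "supp (fst (Phi (u # us))) = (\<otimes>) x ` supp (pmul f ?P)"
      using fst_Phi_Cons[OF d(2)] u x by (simp add: supp_shift)
    have "supp (fst (Phi (u # us))) \<subseteq> branch x"
      unfolding s
    proof
      fix i assume "i \<in> (\<otimes>) x ` supp (pmul f ?P)"
      then obtain j where j: "i = x \<otimes> j" "j \<in> supp f \<union> supp ?P" using supp_pmul by blast
      hence "j \<notin> branch (inv x)" "j \<in> carrier L" using out supp_carrier by blast+
      thus "i \<in> branch x" using j(1) mult_gen_branch[OF u(2)] by blast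
    qed
    moreover have "nf (snd (Phi (u # us)) \<otimes> j) = map fst (u # us) @ nf j \<and>
       snd (Phi (u # us)) \<otimes> j \<in> branch x \<and> snd (Phi (u # us)) \<otimes> j \<notin> supp (fst (Phi (u # us)))"
      if j: "j \<in> branch y" for j
    proof -
      have jc: "j \<in> carrier L" "?b \<otimes> j \<in> carrier L" using j branch_carrier b by auto
      have e: "snd (Phi (u # us)) \<otimes> j = x \<otimes> (?b \<otimes> j)"
        using snd_Phi_Cons[OF d(2)] u x jc b by (simp add: m_assoc)
      have nb: "?b \<otimes> j \<notin> branch (inv x)" using out IH(3)[OF j] by blast
      have "?b \<otimes> j \<notin> supp f" using compatible(3) IH(3)[OF j] by blast
      hence "?b \<otimes> j \<notin> supp (pmul f ?P)" using IH(4)[OF j] supp_pmul by blast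
      hence "x \<otimes> (?b \<otimes> j) \<notin> (\<otimes>) x ` supp (pmul f ?P)"
        using x jc supp_carrier by (auto simp: image_iff)
      thus ?thesis unfolding e s
        using nf_mult_gen[OF u(2) jc(2) nb] mult_gen_branch[OF u(2) jc(2) nb] IH(2)[OF j] u by simp
    qed
    ultimately show ?case using u by simp
  qed simp
  thus "supp (fst (Phi us)) \<subseteq> branch (fst (hd us))"
    "\<And>j. j \<in> branch y \<Longrightarrow> nf (snd (Phi us) \<otimes> j) = map fst us @ nf j"
    "\<And>j. j \<in> branch y \<Longrightarrow> snd (Phi us) \<otimes> j \<notin> supp (fst (Phi us))" by blast+
qed

text \<open>The labels can be read off from the function one letter at a time: the first label is trivial on
  the branch that carries all the others.\<close>

lemma Phi_inj:
  assumes "decorated us" "decorated vs" "chain us y" "chain vs y" "y \<in> X" "map fst us = map fst vs"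
    "fst (Phi us) = fst (Phi vs)"
  shows "us = vs"
  using assms
proof (induction us arbitrary: vs)
  case Nil thus ?case by simp
next
  case (Cons u us)
  then obtain x f g vs' where uv: "u = (x, f)" "vs = (x, g) # vs'" and m: "map fst us = map fst vs'"
    by (cases u; cases vs) auto
  define y' where "y' = (if us = [] then y else fst (hd us))"
  have e: "us = [] \<longleftrightarrow> vs' = []" "us \<noteq> [] \<Longrightarrow> fst (hd us) = fst (hd vs')"
    using m by (cases us; cases vs'; auto)+
  have d: "x \<in> X" "f \<in> F" "g \<in> F" "decorated us" "decorated vs'" and c: "chain us y" "chain vs' y"
    using Cons.prems uv by (auto simp: chain_Cons)
  have fg: "supp f \<inter> branch y' = {}" "supp g \<inter> branch y' = {}"
    using Cons.prems(3,4) e by (auto simp: uv chain_Cons compatible_def y'_def split: if_splits)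
  let ?P = "fst (Phi us)" and ?Q = "fst (Phi vs')"
  have PQ: "?P \<in> F" "?Q \<in> F" using d fst_Phi_F by auto
  have PQb: "supp ?P \<subseteq> branch y'" "supp ?Q \<subseteq> branch y'"
  proof -
    show "supp ?P \<subseteq> branch y'"
      using Phi_supp(1)[OF d(4) _ c(1) Cons.prems(5)] by (cases "us = []") (auto simp: y'_def W_one)
    show "supp ?Q \<subseteq> branch y'"
      using Phi_supp(1)[OF d(5) _ c(2) Cons.prems(5)] e by (cases "us = []") (auto simp: y'_def W_one)
  qed
  have "shift x (pmul f ?P) = shift x (pmul g ?Q)"
    using Cons.prems(1,2,7) fst_Phi_Cons[of u us] fst_Phi_Cons[of "(x, g)" vs'] uv by simp
  hence "shift (inv x) (shift x (pmul f ?P)) = shift (inv x) (shift x (pmul g ?Q))" by simp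
  hence eq: "pmul f ?P = pmul g ?Q" using d PQ by (simp add: shift_shift)
  have pt: "f i = g i \<and> ?P i = ?Q i" if i: "i \<in> carrier L" for i
  proof -
    have "f i \<otimes>\<^bsub>G\<^esub> ?P i = g i \<otimes>\<^bsub>G\<^esub> ?Q i" using arg_cong[OF eq, of "\<lambda>h. h i"] i by simp
    moreover have "f i = \<one>\<^bsub>G\<^esub> \<and> g i = \<one>\<^bsub>G\<^esub> \<or> ?P i = \<one>\<^bsub>G\<^esub> \<and> ?Q i = \<one>\<^bsub>G\<^esub>"
      using fg PQb i unfolding supp_def by blast
    ultimately show ?thesis using i d PQ by auto
  qed
  have "f = g" "?P = ?Q" by (rule F_eqI; use pt d PQ in blast)+
  thus ?case using Cons.IH[OF d(4,5) c Cons.prems(5) m] uv by simp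
qed

lemma good_reduced: "good us \<Longrightarrow> reduced (map fst us)"
  unfolding good_def reduced_def decorated_def successively_append_iff successively_map
  by (auto intro: successively_mono simp: compatible_def)

lemma good_nf: "good us \<Longrightarrow> nf (snd (Phi us)) = map fst us"
  using good_reduced snd_Phi nf_ev by (simp add: good_def)

text \<open>With \<open>b\<close> the cursor, the reduced word of \<open>b\<^sup>k x\<close> is longer than that of \<open>x\<close> by \<open>k\<close> times the number
  of letters.\<close>

lemma good_inf_order: assumes "good us" shows "inf_order (snd (Phi us))"
  unfolding inf_order_def
proof (intro allI impI notI)
  fix n :: nat assume n: "n > 0" and e: "snd (Phi us) [^] n = \<one>"
  let ?b = "snd (Phi us)" and ?x = "fst (hd us)"
  have d: "decorated us" "us \<noteq> []" "chain us ?x" "?x \<in> X"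
    using assms good_chain good_hd by (auto simp: good_def)
  have b: "?b \<in> carrier L" using snd_Phi_closed d by blast
  have "length (nf (?b [^] k \<otimes> ?x)) = k * length us + 1 \<and> ?b [^] k \<otimes> ?x \<in> branch ?x" for k :: nat
  proof (induction k)
    case 0
    show ?case using d gen_in_branch nf_gen by simp
  next
    case (Suc k)
    let ?j = "?b [^] k \<otimes> ?x"
    have e: "?b [^] Suc k \<otimes> ?x = ?b \<otimes> ?j" using b d by (intro pow_Suc_left) auto
    have n: "nf (?b \<otimes> ?j) = map fst us @ nf ?j" using Phi_supp(2)[OF d] Suc by blast
    have "?b \<otimes> ?j \<in> branch ?x" using n d(2) b d(4) by (cases us) (auto simp: branch_def)
    thus ?case unfolding e using n Suc by simp
  qed
  from this[of n] have "n * length us = 0" using e d(4) nf_gen by simp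
  thus False using n d(2) by simp
qed

lemma fin_supp_orbit:
  assumes "f \<in> F" "c \<in> carrier L" "inf_order c" "g \<in> carrier L" "\<And>k::nat. f (c [^] k \<otimes> g) = t"
  shows "t = \<one>\<^bsub>G\<^esub>"
proof (rule ccontr)
  assume "t \<noteq> \<one>\<^bsub>G\<^esub>"
  hence "range (\<lambda>k::nat. c [^] k \<otimes> g) \<subseteq> supp f" using assms by (auto simp: supp_def)
  hence "finite (range (\<lambda>k::nat. c [^] k \<otimes> g))" using assms(1) finite_supp finite_subset by metis
  thus False using finite_imageD inf_order_inj[OF assms(2,3,4)] infinite_UNIV_nat by blast
qed

text \<open>A finitely supported \<open>\<theta>\<close> conjugating one good word to another with the same cursor is constant
  along each half of an orbit of the cursor, hence trivial wherever it could matter.\<close>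

lemma good_conj_base:
  assumes us: "good us" and vs: "good vs" and \<theta>: "\<theta> \<in> F"
    and eq: "(\<theta>, \<one>) \<otimes>\<^bsub>W\<^esub> Phi us = Phi vs \<otimes>\<^bsub>W\<^esub> (\<theta>, \<one>)"
  shows "us = vs"
proof -
  obtain P b where P: "Phi us = (P, b)" by (cases "Phi us")
  obtain Q b' where Q: "Phi vs = (Q, b')" by (cases "Phi vs")
  have d: "decorated us" "decorated vs" using us vs by (auto simp: good_def)
  have PF: "P \<in> F" "Q \<in> F" "b \<in> carrier L" "b' \<in> carrier L"
    using Phi_closed[OF d(1)] Phi_closed[OF d(2)] P Q by (auto simp: W_carrier)
  have b': "b' = b" and eqf: "pmul \<theta> P = pmul Q (shift b \<theta>)" using eq P Q PF \<theta> by auto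
  have m: "map fst us = map fst vs" using good_nf[OF us] good_nf[OF vs] P Q b' by simp
  define x where "x = fst (hd us)"
  have ne: "us \<noteq> []" "vs \<noteq> []" using us vs by (auto simp: good_def)
  have x': "fst (hd vs) = x" using m ne by (cases us; cases vs) (auto simp: x_def)
  have x: "x \<in> X" and ch: "chain us x" "chain vs x"
    using good_chain[OF us] good_chain[OF vs] good_hd[OF us] x' by (auto simp: x_def)
  have inf: "inf_order b" using good_inf_order[OF us] P by simp
  have S: "supp P \<subseteq> branch x" "supp Q \<subseteq> branch x"
    "\<And>j. j \<in> branch x \<Longrightarrow> b \<otimes> j \<notin> supp P" "\<And>j. j \<in> branch x \<Longrightarrow> b \<otimes> j \<notin> supp Q"
    "\<And>j. j \<in> branch x \<Longrightarrow> b \<otimes> j \<in> branch x"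
  proof -
    show "supp P \<subseteq> branch x" "supp Q \<subseteq> branch x"
      using Phi_supp(1)[OF d(1) ne(1) ch(1) x] Phi_supp(1)[OF d(2) ne(2) ch(2) x] P Q x' by (auto simp: x_def)
    show "\<And>j. j \<in> branch x \<Longrightarrow> b \<otimes> j \<notin> supp P" "\<And>j. j \<in> branch x \<Longrightarrow> b \<otimes> j \<notin> supp Q"
      using Phi_supp(3)[OF d(1) ne(1) ch(1) x] Phi_supp(3)[OF d(2) ne(2) ch(2) x] P Q b' by auto
    show "b \<otimes> j \<in> branch x" if "j \<in> branch x" for j
    proof -
      have "nf (b \<otimes> j) = map fst us @ nf j" using Phi_supp(2)[OF d(1) ne(1) ch(1) x that] P by simp
      hence "nf (b \<otimes> j) = x # (map fst (tl us) @ nf j)" using ne(1) by (cases us) (auto simp: x_def)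
      thus ?thesis using branch_carrier[OF that] PF(3) by (auto simp: branch_def)
    qed
  qed
  have rel: "\<theta> i \<otimes>\<^bsub>G\<^esub> P i = Q i \<otimes>\<^bsub>G\<^esub> \<theta> (inv b \<otimes> i)" if "i \<in> carrier L" for i
    using arg_cong[OF eqf, of "\<lambda>h. h i"] that by simp
  have step: "\<theta> i = \<theta> (inv b \<otimes> i)" if "i \<in> carrier L" "i \<notin> supp P" "i \<notin> supp Q" for i
    using rel[OF that(1)] that \<theta> PF by (simp add: supp_def)
  have "P i = Q i" if i: "i \<in> carrier L" for i
  proof (cases "i \<in> supp P \<or> i \<in> supp Q")
    case False thus ?thesis using i by (simp add: supp_def)
  next
    case True
    have iS: "i \<in> branch x" and inb: "inv b \<otimes> i \<notin> branch x"
    proof -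
      show "i \<in> branch x" using True S by blast
      show "inv b \<otimes> i \<notin> branch x"
        using True S(3,4)[of "inv b \<otimes> i"] i PF by (auto simp: inv_mult_cancel)
    qed
    have fw: "b [^] k \<otimes> i \<in> branch x" for k :: nat
    proof (induction k)
      case (Suc k)
      have "b [^] Suc k \<otimes> i = b \<otimes> (b [^] k \<otimes> i)"
        using PF i by (intro pow_Suc_left) auto
      thus ?case using S(5)[OF Suc] by simp
    qed (use iS i in simp)
    have "\<theta> (b [^] k \<otimes> i) = \<theta> i" for k :: nat
    proof (induction k)
      case (Suc k)
      let ?j = "b [^] k \<otimes> i"
      have jc: "?j \<in> carrier L" using PF i by simp
      have e: "b [^] Suc k \<otimes> i = b \<otimes> ?j"
        using PF i by (intro pow_Suc_left) auto
      have "\<theta> (b \<otimes> ?j) = \<theta> (inv b \<otimes> (b \<otimes> ?j))"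
        by (rule step) (use S(3,4)[OF fw[of k]] PF jc in auto)
      thus ?case unfolding e using Suc PF jc by (simp add: inv_mult_cancel)
    qed (use i in simp)
    \<comment> \<open>Forward along the orbit, \<open>\<theta>\<close> is constant from \<open>i\<close> on.\<close>
    hence t1: "\<theta> i = \<one>\<^bsub>G\<^esub>" using fin_supp_orbit[OF \<theta> PF(3) inf i] by blast
    let ?c = "inv b" and ?g = "inv b \<otimes> i"
    have g: "?g \<in> carrier L" "?c \<in> carrier L" using PF i by auto
    have bw: "?c [^] k \<otimes> ?g \<notin> branch x" for k :: nat
    proof (induction k)
      case (Suc k)
      have "?c [^] Suc k \<otimes> ?g = ?c \<otimes> (?c [^] k \<otimes> ?g)"
        using g by (intro pow_Suc_left) auto
      thus ?case using S(5)[of "?c \<otimes> (?c [^] k \<otimes> ?g)"] Suc PF g by (auto simp: inv_mult_cancel)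
    qed (use inb g in simp)
    have "\<theta> (?c [^] k \<otimes> ?g) = \<theta> ?g" for k :: nat
    proof (induction k)
      case (Suc k)
      let ?j = "?c [^] k \<otimes> ?g"
      have jc: "?j \<in> carrier L" using g by simp
      have e: "?c [^] Suc k \<otimes> ?g = ?c \<otimes> ?j"
        using g by (intro pow_Suc_left) auto
      have "\<theta> ?j = \<theta> (?c \<otimes> ?j)" by (rule step) (use S(1,2) bw[of k] jc in auto)
      thus ?case unfolding e using Suc by simp
    qed (use g in simp)
    \<comment> \<open>Backward, it is constant from \<open>inv b \<otimes> i\<close> on.\<close>
    hence t2: "\<theta> ?g = \<one>\<^bsub>G\<^esub>" using fin_supp_orbit[OF \<theta> g(2) inf_order_inv[OF PF(3) inf] g(1)] by blast
    show ?thesis using rel[OF i] t1 t2 PF i by simp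
  qed
  hence "P = Q" using PF by (intro F_eqI) auto
  thus ?thesis using Phi_inj[OF d ch x m] P Q by simp
qed

text \<open>The cursor of a conjugator is shortened letter by letter, rotating the word each time. This
  works because conjugating a cyclically reduced word by a nontrivial one without any cancellation
  gives a word that is not cyclically reduced.\<close>

lemma good_conj_rotation:
  assumes "good us" "good vs" "k \<in> carrier W" "k \<otimes>\<^bsub>W\<^esub> Phi us = Phi vs \<otimes>\<^bsub>W\<^esub> k"
  shows "\<exists>m. vs = rotate m us"
  using assms
proof (induction "length (nf (snd k))" arbitrary: us k rule: less_induct)
  case less
  obtain \<theta> c where k: "k = (\<theta>, c)" by (cases k)
  have kc: "\<theta> \<in> F" "c \<in> carrier L" using less.prems(3) k by (auto simp: W_carrier)
  have d: "decorated us" "us \<noteq> []" using less.prems by (auto simp: good_def)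
  have dv: "decorated vs" "vs \<noteq> []" using less.prems by (auto simp: good_def)
  show ?case
  proof (cases "c = \<one>")
    case True
    hence "us = vs" using good_conj_base[OF less.prems(1,2) kc(1)] less.prems(4) k by simp
    thus ?thesis by (intro exI[of _ 0]) simp
  next
    case False
    note pc = parent_props[OF kc(2) False]
    let ?y = "last (nf c)"
    have nec: "nf c \<noteq> []" using False nf_Nil_iff kc by blast
    have lc: "length (nf (parent c)) < length (nf (snd k))" using pc(5) k by simp
    have parc: "c \<otimes> inv ?y = parent c"
      using pc(1,3,4) by (metis X_carrier inv_closed inv_solve_right m_closed)
    show ?thesis
    proof (cases "?y = inv (fst (hd us))")
      case True
      obtain u us' where us: "us = u # us'" using d by (cases us) auto
      have u: "fst u \<in> X" "snd u \<in> F" "decorated us'" using d us by auto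
      let ?k = "k \<otimes>\<^bsub>W\<^esub> letter_elem u"
      have "snd ?k = parent c"
        using True us u kc parc k by (simp add: letter_elem_def)
      moreover have "?k \<otimes>\<^bsub>W\<^esub> Phi (rotate1 us) = Phi vs \<otimes>\<^bsub>W\<^esub> ?k"
      proof -
        have "?k \<otimes>\<^bsub>W\<^esub> Phi (rotate1 us) = k \<otimes>\<^bsub>W\<^esub> Phi us \<otimes>\<^bsub>W\<^esub> letter_elem u"
          using us u less.prems(3) by (simp add: W.m_assoc)
        also have "\<dots> = Phi vs \<otimes>\<^bsub>W\<^esub> k \<otimes>\<^bsub>W\<^esub> letter_elem u" using less.prems(4) by simp
        finally show ?thesis using u less.prems(3) dv by (simp add: W.m_assoc)
      qed
      ultimately obtain m where "vs = rotate m (rotate1 us)"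
        using less.hyps[of ?k "rotate1 us"] lc good_rotate1[OF less.prems(1)] less.prems(2,3) u
        by (metis W.m_closed letter_elem_closed)
      thus ?thesis by (intro exI[of _ "m + 1"]) (simp add: rotate1_rotate_swap)
    next
      case not_first: False
      show ?thesis
      proof (cases "?y = fst (last us)")
        case True
        obtain u us' where us: "us = us' @ [u]" using d by (cases us rule: rev_cases) auto
        have u: "fst u \<in> X" "snd u \<in> F" "decorated us'" using d us by auto
        have su: "letter_elem u \<in> carrier W" using u by simp
        let ?k = "k \<otimes>\<^bsub>W\<^esub> inv\<^bsub>W\<^esub> (letter_elem u)"
        have kW: "?k \<in> carrier W" using su less.prems(3) by simp
        have sk: "snd ?k = parent c"
        proof -
          have "snd ?k \<otimes> fst u = c"
          proof -
            have "snd (?k \<otimes>\<^bsub>W\<^esub> letter_elem u) = snd ?k \<otimes> fst u"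
              using snd_W_mult[OF kW su] by (simp add: letter_elem_def)
            moreover have "?k \<otimes>\<^bsub>W\<^esub> letter_elem u = k" using su less.prems(3) by (simp add: W.m_assoc)
            ultimately show ?thesis using k by simp
          qed
          moreover have "snd ?k \<in> carrier L" using kW by (auto simp: W_carrier)
          ultimately have "snd ?k = c \<otimes> inv (fst u)" using u(1) by (metis X_carrier inv_solve_right kc(2))
          thus ?thesis using parc True us by simp
        qed
        let ?vs = "u # us'"
        have vrot: "?vs = rotate (length us - 1) us"
        proof -
          have "rotate (length us') (us' @ [u]) = [u] @ us'" by (rule rotate_append)
          thus ?thesis using us by simp
        qed
        hence g: "good ?vs" using good_rotate[OF less.prems(1)] by metis
        have "?k \<otimes>\<^bsub>W\<^esub> Phi ?vs = Phi vs \<otimes>\<^bsub>W\<^esub> ?k"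
        proof -
          have "?k \<otimes>\<^bsub>W\<^esub> Phi ?vs = k \<otimes>\<^bsub>W\<^esub> Phi us'"
          proof -
            have "inv\<^bsub>W\<^esub> (letter_elem u) \<otimes>\<^bsub>W\<^esub> (letter_elem u \<otimes>\<^bsub>W\<^esub> Phi us') = Phi us'"
              using su Phi_closed[OF u(3)] by (simp flip: W.m_assoc)
            thus ?thesis using u(3) su less.prems(3) by (simp add: W.m_assoc)
          qed
          also have "\<dots> = k \<otimes>\<^bsub>W\<^esub> Phi us \<otimes>\<^bsub>W\<^esub> inv\<^bsub>W\<^esub> (letter_elem u)"
            using us u su less.prems(3) by (simp add: W.m_assoc)
          also have "\<dots> = Phi vs \<otimes>\<^bsub>W\<^esub> ?k" using less.prems(3,4) su dv by (simp add: W.m_assoc)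
          finally show ?thesis .
        qed
        then obtain m where "vs = rotate m ?vs"
          using less.hyps[of ?k ?vs] lc sk g less.prems(2) kW by auto
        thus ?thesis using vrot rotate_rotate by metis
      next
        \<comment> \<open>No letter of \<open>c\<close> cancels: \<open>c b c\<inverse>\<close> is reduced as it stands, and its ends are inverse letters.\<close>
        case not_last: False
        let ?b = "snd (Phi us)" and ?b' = "snd (Phi vs)"
        have b: "?b \<in> carrier L" "?b' \<in> carrier L" using d dv snd_Phi_closed by auto
        let ?xs = "map fst us" and ?r = "rev (map (m_inv L) (nf c))"
        have nb: "nf ?b = ?xs" "nf ?b' = map fst vs" using good_nf less.prems by auto
        have rx: "reduced ?xs" using good_reduced less.prems by auto
        have rc: "reduced (nf c)" "reduced ?r" using nf_props(1) kc nf_inv[OF kc(2)] by (metis inv_closed)+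
        have "c \<otimes> ?b = ?b' \<otimes> c"
        proof -
          have "snd (k \<otimes>\<^bsub>W\<^esub> Phi us) = snd (Phi vs \<otimes>\<^bsub>W\<^esub> k)" using less.prems(4) by simp
          thus ?thesis using snd_W_mult less.prems(3) d dv k by simp
        qed
        hence b'e: "?b' = c \<otimes> (?b \<otimes> inv c)" using b kc by (metis inv_closed inv_solve_right m_assoc m_closed)
        have ya: "?y \<in> X" using pc by blast
        have lastX: "fst (last us) \<in> X" using d by (cases us rule: rev_cases) auto
        have hdX: "fst (hd us) \<in> X" using d by (cases us) auto
        have hr: "?r \<noteq> []" "hd ?r = inv ?y" using nec by (auto simp: hd_rev last_map)
        have rxr: "reduced (?xs @ ?r)"
          using rx rc(2) hr d(2) not_last ya lastX by (auto simp: reduced_append last_map)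
        have "hd (?xs @ ?r) = fst (hd us)" using d(2) by (simp add: hd_map hd_append)
        moreover have "fst (hd us) \<noteq> inv ?y" using not_first ya hdX by (metis X_carrier inv_inv)
        ultimately have red: "reduced (nf c @ (?xs @ ?r))" using rc(1) rxr by (auto simp: reduced_append)
        have "ev (nf c @ (?xs @ ?r)) = ?b'"
        proof -
          have e1: "ev (nf c @ (?xs @ ?r)) = ev (nf c) \<otimes> ev (?xs @ ?r)"
            by (rule ev_append[OF reduced_sub[OF rc(1)] reduced_sub[OF rxr]])
          have e2: "ev (?xs @ ?r) = ev ?xs \<otimes> ev ?r"
            by (rule ev_append[OF reduced_sub[OF rx] reduced_sub[OF rc(2)]])
          have e3: "ev ?r = inv c" using nf_props(2)[of "inv c"] nf_inv[OF kc(2)] kc(2) by simp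
          have e4: "ev ?xs = ?b" using nf_props(2)[OF b(1)] nb(1) by simp
          show ?thesis unfolding e1 e2 e3 e4 using b'e nf_props(2)[OF kc(2)] by simp
        qed
        from nf_eqI[OF red this] have xs': "map fst vs = nf c @ ?xs @ ?r" unfolding nb(2) .
        have "fst (hd vs) = hd (nf c)"
          using xs' nec dv(2) by (metis hd_append2 hd_map)
        moreover have "fst (last vs) = inv (hd (nf c))"
        proof -
          have "last (map fst vs) = last ?r" using xs' hr by simp
          thus ?thesis using dv(2) nec by (simp add: last_map last_rev hd_map)
        qed
        moreover have "hd (nf c) \<in> carrier L" using reduced_sub[OF rc(1)] nec by (cases "nf c") auto
        ultimately have "fst (hd vs) = inv (fst (last vs))" by simp
        moreover have "compatible (last vs) (hd vs)"
          using less.prems(2) by (auto simp: good_def successively_append_iff)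
        ultimately show ?thesis by (simp add: compatible_def)
      qed
    qed
  qed
qed

text \<open>Conversely to \<open>good_conj_rotation\<close>, moving a prefix to the end of a word conjugates its value.\<close>

lemma conj_class_Phi_eq_iff:
  assumes "good us" "good vs"
  shows "conj_class W (Phi us) = conj_class W (Phi vs) \<longleftrightarrow> (\<exists>m. vs = rotate m us)"
proof -
  have c: "Phi us \<in> carrier W" "Phi vs \<in> carrier W" using assms by (auto simp: good_def)
  show ?thesis
    unfolding W.conj_class_eq_iff[OF c]
    using good_conj_rotation[OF assms] conjugate_rotate assms unfolding W.conjugate_def good_def by blast
qed

text \<open>A shortest element of the class has a good representative that is not heavier, and by uniqueness
  that is a rotation of \<open>us\<close>.\<close>

lemma class_length_Phi:
  assumes "good us" shows "class_length W Z (conj_class W (Phi us)) = total_weight us"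
proof -
  let ?C = "conj_class W (Phi us)"
  have d: "decorated us" and c: "Phi us \<in> carrier W" using assms by (auto simp: good_def)
  have mem: "Phi us \<in> ?C" using W.mem_conj_class_iff[OF c] W.conjugate_refl[OF c] by blast
  have ex: "\<exists>n. \<exists>h\<in>?C. word_length W Z h = n" using mem by blast
  have "class_length W Z ?C \<le> word_length W Z (Phi us)"
    unfolding class_length_def using mem by (intro Least_le) blast
  also have "\<dots> \<le> total_weight us" by (rule W.word_length_le[OF has_word_Phi[OF d]])
  finally have 1: "class_length W Z ?C \<le> total_weight us" .
  obtain h where h: "h \<in> ?C" "word_length W Z h = class_length W Z ?C"
    using LeastI_ex[OF ex] unfolding class_length_def by blast
  have conjugate: "W.conjugate (Phi us) h" using h(1) W.mem_conj_class_iff[OF c] by blast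
  have "inf_order (snd h)" using inf_order_conjugate[OF snd_conjugate[OF conjugate] good_inf_order[OF assms]] .
  moreover have "h \<in> carrier W" using conjugate by (simp add: W.conjugate_def)
  ultimately obtain vs where vs: "good vs" "W.conjugate h (Phi vs)" "total_weight vs \<le> word_length W Z h"
    using good_representative by blast
  have cv: "Phi vs \<in> carrier W" using vs by (auto simp: good_def)
  have "conj_class W (Phi us) = conj_class W (Phi vs)"
    using W.conj_class_eq_iff[OF c cv] W.conjugate_trans[OF conjugate vs(2)] by blast
  then obtain m where "vs = rotate m us" using conj_class_Phi_eq_iff[OF assms vs(1)] by blast
  hence "total_weight us \<le> class_length W Z ?C" using vs(3) h(2) by simp
  thus ?thesis using 1 by simp
qed

lemma infinite_cursor_classes_eq:
  "infinite_cursor_classes G L = (\<lambda>us. conj_class W (Phi us)) ` {us. good us}"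
proof (intro subset_antisym subsetI)
  fix C assume "C \<in> infinite_cursor_classes G L"
  then obtain w where w: "w \<in> carrier W" "ord (snd w) = 0" "C = conj_class W w"
    by (auto simp: infinite_cursor_classes_def)
  have "snd w \<in> carrier L" using w(1) by (auto simp: W_carrier)
  hence "inf_order (snd w)" using inf_order_iff w(2) by blast
  then obtain us where us: "good us" "W.conjugate w (Phi us)" using good_representative w(1) by blast
  hence "C = conj_class W (Phi us)"
    using w W.conj_class_eq_iff[of w "Phi us"] by (auto simp: W.conjugate_def)
  thus "C \<in> (\<lambda>us. conj_class W (Phi us)) ` {us. good us}" using us by blast
next
  fix C assume "C \<in> (\<lambda>us. conj_class W (Phi us)) ` {us. good us}"
  then obtain us where us: "good us" "C = conj_class W (Phi us)" by blast
  have d: "decorated us" using us by (simp add: good_def)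
  have "ord (snd (Phi us)) = 0"
    using inf_order_iff[OF snd_Phi_closed[OF d]] good_inf_order[OF us(1)] by blast
  thus "C \<in> infinite_cursor_classes G L"
    unfolding infinite_cursor_classes_def using us(2) Phi_closed[OF d] by blast
qed

end

section \<open>Necklaces\<close>

lemma rotate_eq_mod:
  assumes "length xs = n" "n > 0" shows "rotate ((i + j) mod n) xs = rotate i (rotate j xs)"
  using assms rotate_conv_mod[of "i + j" xs] by (simp add: rotate_rotate)

text \<open>Burnside's lemma: the class of \<open>us0\<close> contributes the number of pairs of a word \<open>us\<close> in it and a
  rotation fixing \<open>us\<close>. There are as many rotations fixing \<open>us\<close> as rotations taking \<open>us0\<close> to \<open>us\<close>, and
  the latter add up to \<open>n\<close>.\<close>

lemma rotation_burnside:
  fixes U :: "'a list set"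
  assumes fin: "finite U" and len: "\<And>us. us \<in> U \<Longrightarrow> length us = n" and n: "n > 0"
    and rot: "\<And>us i. us \<in> U \<Longrightarrow> rotate i us \<in> U"
    and q: "\<And>us vs. us \<in> U \<Longrightarrow> vs \<in> U \<Longrightarrow> q us = q vs \<longleftrightarrow> (\<exists>m. vs = rotate m us)"
  shows "(\<Sum>i<n. card {us \<in> U. rotate i us = us}) = n * card (q ` U)"
proof -
  define st where "st = (\<lambda>us :: 'a list. card {i \<in> {..<n}. rotate i us = us})"
  have "(\<Sum>i<n. card {us \<in> U. rotate i us = us}) = (\<Sum>us\<in>U. st us)"
  proof -
    have "(\<Sum>i<n. card {us \<in> U. rotate i us = us}) = (\<Sum>i<n. \<Sum>us\<in>U. if rotate i us = us then 1 else 0)"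
      using fin by (intro sum.cong) (auto simp: sum.If_cases Int_def)
    also have "\<dots> = (\<Sum>us\<in>U. \<Sum>i<n. if rotate i us = us then 1 else 0)" by (rule sum.swap)
    also have "\<dots> = (\<Sum>us\<in>U. st us)"
      unfolding st_def by (intro sum.cong) (auto simp: sum.If_cases Int_def)
    finally show ?thesis .
  qed
  also have "\<dots> = (\<Sum>c\<in>q ` U. \<Sum>us\<in>{us \<in> U. q us = c}. st us)"
    by (rule sum.image_gen[OF fin])
  also have "\<dots> = (\<Sum>c\<in>q ` U. n)"
  proof (rule sum.cong[OF HOL.refl])
    fix c assume "c \<in> q ` U"
    then obtain us0 where us0: "us0 \<in> U" "q us0 = c" by blast
    have l: "length us0 = n" using len us0 by blast
    have cls: "{us \<in> U. q us = c} = (\<lambda>i. rotate i us0) ` {..<n}"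
    proof (intro subset_antisym subsetI)
      fix us assume "us \<in> {us \<in> U. q us = c}"
      then obtain m where m: "us = rotate m us0" using q[OF us0(1)] us0(2) by blast
      hence "us = rotate (m mod n) us0" using rotate_conv_mod[of m us0] l by simp
      thus "us \<in> (\<lambda>i. rotate i us0) ` {..<n}" using n by auto
    next
      fix us assume "us \<in> (\<lambda>i. rotate i us0) ` {..<n}"
      then obtain i where i: "us = rotate i us0" by blast
      hence "us \<in> U" using rot us0 by blast
      thus "us \<in> {us \<in> U. q us = c}" using q[OF us0(1), of us] i us0(2) by auto
    qed
    have "st us = card {i \<in> {..<n}. rotate i us0 = us}" if us: "us \<in> {us \<in> U. q us = c}" for us
    proof -
      obtain j where j: "j < n" "us = rotate j us0" using us cls by auto
      have lu: "length us = n" using j l by simp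
      have "bij_betw (\<lambda>i. (i + j) mod n) {i \<in> {..<n}. rotate i us = us} {i \<in> {..<n}. rotate i us0 = us}"
      proof (rule bij_betw_byWitness[where f' = "\<lambda>i. (i + (n - j)) mod n"])
        show "\<forall>i\<in>{i \<in> {..<n}. rotate i us = us}. ((i + j) mod n + (n - j)) mod n = i"
        proof
          fix i assume i: "i \<in> {i \<in> {..<n}. rotate i us = us}"
          have "((i + j) mod n + (n - j)) mod n = ((i + j) + (n - j)) mod n" by (rule mod_add_left_eq)
          also have "(i + j) + (n - j) = i + n" using j(1) by simp
          finally show "((i + j) mod n + (n - j)) mod n = i" using i by simp
        qed
        show "\<forall>i\<in>{i \<in> {..<n}. rotate i us0 = us}. ((i + (n - j)) mod n + j) mod n = i"
          using j(1) by (auto simp: mod_add_left_eq)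
        show "(\<lambda>i. (i + j) mod n) ` {i \<in> {..<n}. rotate i us = us} \<subseteq> {i \<in> {..<n}. rotate i us0 = us}"
          using rotate_eq_mod[OF l n, of _ j] j n by auto
        show "(\<lambda>i. (i + (n - j)) mod n) ` {i \<in> {..<n}. rotate i us0 = us} \<subseteq> {i \<in> {..<n}. rotate i us = us}"
        proof
          fix x assume "x \<in> (\<lambda>i. (i + (n - j)) mod n) ` {i \<in> {..<n}. rotate i us0 = us}"
          then obtain i where i: "x = (i + (n - j)) mod n" "rotate i us0 = us" by auto
          have "rotate x us = rotate i (rotate (n - j) (rotate j us0))"
            using rotate_eq_mod[OF lu n, of i "n - j"] i(1) j(2) by simp
          also have "\<dots> = rotate i us0" using j(1) l by (simp add: rotate_rotate del: rotate_Suc)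
          finally show "x \<in> {i \<in> {..<n}. rotate i us = us}" using i n by simp
        qed
      qed
      from bij_betw_same_card[OF this] show ?thesis by (simp add: st_def)
    qed
    hence "(\<Sum>us\<in>{us \<in> U. q us = c}. st us) = (\<Sum>us\<in>{us \<in> U. q us = c}. card {i \<in> {..<n}. rotate i us0 = us})"
      by (rule sum.cong[OF HOL.refl])
    also have "\<dots> = (\<Sum>us\<in>(\<lambda>i. rotate i us0) ` {..<n}. \<Sum>i\<in>{i \<in> {..<n}. rotate i us0 = us}. 1)"
      unfolding cls by simp
    also have "\<dots> = (\<Sum>i<n. 1)" by (rule sum.image_gen[symmetric]) simp
    finally show "(\<Sum>us\<in>{us \<in> U. q us = c}. st us) = n" by simp
  qed
  finally show ?thesis by (simp add: mult.commute)
qed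

lemma rotate_mult_fixed: "rotate i us = us \<Longrightarrow> rotate (i * k) us = us"
proof (induction k)
  case (Suc k)
  have "rotate (i * Suc k) us = rotate i (rotate (i * k) us)" by (simp add: rotate_rotate)
  thus ?case using Suc by simp
qed simp

text \<open>By Bezout, rotation by \<open>gcd i n\<close> is an iterate of rotation by \<open>i\<close>.\<close>

lemma rotate_gcd_iff:
  assumes "length us = n" "i > 0"
  shows "rotate i us = us \<longleftrightarrow> rotate (gcd i n) us = us"
proof
  assume i: "rotate i us = us"
  obtain x y where xy: "i * x = n * y + gcd i n" using bezout_nat[of i n] assms(2) by auto
  have "us = rotate (gcd i n + n * y) us" using rotate_mult_fixed[OF i, of x] xy by (simp add: add.commute)
  also have "\<dots> = rotate (gcd i n) (rotate (n * y) us)" by (simp add: rotate_rotate)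
  also have "rotate (n * y) us = us" using assms(1) by simp
  finally show "rotate (gcd i n) us = us" by simp
next
  assume "rotate (gcd i n) us = us"
  from rotate_mult_fixed[OF this, of "i div gcd i n"] show "rotate i us = us" by simp
qed

definition power_word :: "nat \<Rightarrow> 'a list \<Rightarrow> 'a list" where
  "power_word r vs = concat (replicate r vs)"

lemma power_word_simps [simp]:
  "power_word 0 vs = []" "power_word (Suc r) vs = vs @ power_word r vs"
  "length (power_word r vs) = r * length vs"
  by (induction r) (auto simp: power_word_def)

lemma power_word_commute: "power_word r vs @ vs = vs @ power_word r vs"
  by (induction r) auto

lemma commute_power_word:
  assumes "d @ t = t @ d" "length d = k * length t" shows "d = power_word k t"
  using assms
proof (induction k arbitrary: d)
  case (Suc k)
  have "length t \<le> length d" using Suc.prems(2) by simp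
  hence "take (length t) d = t" using arg_cong[OF Suc.prems(1), of "take (length t)"] by simp
  then obtain d' where d: "d = t @ d'" by (metis append_take_drop_id)
  have "d' = power_word k t" using Suc.prems d by (intro Suc.IH) auto
  thus ?case using d by simp
qed simp

text \<open>If rotation by \<open>s\<close> fixes a word, its first \<open>s\<close> letters commute with the remaining ones, whose
  number is a multiple of \<open>s\<close>; so these are a power of the first \<open>s\<close> letters.\<close>

lemma bij_betw_power_word:
  assumes "s > 0" "r > 0"
  shows "bij_betw (power_word r) {vs. length vs = s} {us. length us = r * s \<and> rotate s us = us}"
proof (rule bij_betw_byWitness[where f' = "take s"])
  obtain k where r: "r = Suc k" using assms by (cases r) auto
  show "\<forall>vs\<in>{vs. length vs = s}. take s (power_word r vs) = vs" by (auto simp: r)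
  show "power_word r ` {vs. length vs = s} \<subseteq> {us. length us = r * s \<and> rotate s us = us}"
    by (auto simp: r power_word_commute rotate_append)
  show *: "\<forall>us\<in>{us. length us = r * s \<and> rotate s us = us}. power_word r (take s us) = us"
  proof
    fix us assume us: "us \<in> {us. length us = r * s \<and> rotate s us = us}"
    let ?t = "take s us" and ?d = "drop s us"
    have lt: "length ?t = s" "length ?d = k * s" using us by (auto simp: r)
    have "rotate (length ?t) (?t @ ?d) = ?d @ ?t" by (rule rotate_append)
    hence "?d @ ?t = ?t @ ?d" using us lt by simp
    hence "?d = power_word k ?t" using lt by (intro commute_power_word) auto
    hence "power_word r ?t = ?t @ ?d" by (simp add: r)
    thus "power_word r ?t = us" by simp
  qed
  show "take s ` {us. length us = r * s \<and> rotate s us = us} \<subseteq> {vs. length vs = s}"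
    by (auto simp: r)
qed

lemma successively_power_word:
  assumes "vs \<noteq> []" "r > 0"
  shows "successively P (power_word r vs @ [hd vs]) \<longleftrightarrow> successively P (vs @ [hd vs])"
proof -
  have hd: "hd (power_word k vs @ [hd vs]) = hd vs" for k using assms(1) by (cases k) auto
  have "successively P (vs @ [hd vs]) \<Longrightarrow> successively P (power_word k vs @ [hd vs])" for k
    using assms(1) hd by (induction k) (auto simp: successively_append_iff)
  moreover obtain k where "r = Suc k" using assms(2) by (cases r) auto
  ultimately show ?thesis using assms(1) hd[of k] by (auto simp: successively_append_iff)
qed

section \<open>Counting cyclically reduced words\<close>

context tree_group
begin

definition adj :: "'l \<Rightarrow> 'l \<Rightarrow> bool" where "adj x y \<longleftrightarrow> y \<noteq> inv x"

definition walks :: "'l \<Rightarrow> nat \<Rightarrow> 'l \<Rightarrow> 'l list set" where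
  "walks a s b = {ws. length ws = s \<and> set ws \<subseteq> X \<and> successively adj (a # ws) \<and> last (a # ws) = b}"

definition cyc_words :: "nat \<Rightarrow> 'l list set" where
  "cyc_words s = {xs. length xs = s \<and> set xs \<subseteq> X \<and> successively adj (xs @ [hd xs])}"

text \<open>The powers of \<open>J - P\<close>, with \<open>J\<close> the all-one matrix on the generators and \<open>P\<close> the permutation matrix of
  inversion, are \<open>\<alpha> s J + (- P)\<^sup>s\<close>.\<close>

fun \<alpha> :: "nat \<Rightarrow> int" where
  "\<alpha> 0 = 0"
| "\<alpha> (Suc s) = (int (card X) - 1) * \<alpha> s + (- 1) ^ s"

text \<open>The \<open>s\<close>-th iterate of inversion.\<close>

definition iota :: "nat \<Rightarrow> 'l \<Rightarrow> 'l" where "iota s x = (if even s then x else inv x)"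

lemma iota_X: "x \<in> X \<Longrightarrow> iota s x \<in> X" using X_inv by (simp add: iota_def)

lemma iota_iff: "x \<in> X \<Longrightarrow> b \<in> X \<Longrightarrow> iota s x = b \<longleftrightarrow> x = iota s b"
  using X_carrier by (auto simp: iota_def)

lemma finite_walks: "finite (walks a s b)"
  by (rule finite_subset[OF _ finite_lists_length_eq[OF finite_X, of s]]) (auto simp: walks_def)

lemma finite_cyc_words: "finite (cyc_words s)"
  by (rule finite_subset[OF _ finite_lists_length_eq[OF finite_X, of s]]) (auto simp: cyc_words_def)

lemma walks_Suc: "walks a (Suc s) b = (\<Union>x\<in>X - {inv a}. (#) x ` walks x s b)"
proof (intro subset_antisym subsetI)
  fix ws assume ws: "ws \<in> walks a (Suc s) b"
  then obtain x vs where "ws = x # vs" by (cases ws) (auto simp: walks_def)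
  moreover have "x \<in> X - {inv a}" "vs \<in> walks x s b"
    using ws calculation by (auto simp: walks_def adj_def split: if_splits)
  ultimately show "ws \<in> (\<Union>x\<in>X - {inv a}. (#) x ` walks x s b)" by blast
qed (auto simp: walks_def adj_def)

text \<open>These are the entries of \<open>(J - P)\<^sup>s\<close>. The recursion for \<open>\<alpha>\<close> comes from \<open>J\<^sup>2 = card X J\<close> and
  \<open>P J = J P = J\<close>.\<close>

lemma card_walks:
  assumes "a \<in> X" "b \<in> X"
  shows "int (card (walks a s b)) = \<alpha> s + (- 1) ^ s * (if iota s a = b then 1 else 0)"
  using assms
proof (induction s arbitrary: a)
  case 0
  have "walks a 0 b = (if a = b then {[]} else {})" by (auto simp: walks_def)
  thus ?case by (simp add: iota_def)
next
  case (Suc s)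
  let ?\<delta> = "\<lambda>x. if iota s x = b then 1 else 0 :: int"
  have ia: "inv a \<in> X" using X_inv Suc.prems by blast
  have "card (walks a (Suc s) b) = (\<Sum>x\<in>X - {inv a}. card ((#) x ` walks x s b))"
    unfolding walks_Suc using finite_X finite_walks by (intro card_UN_disjoint) auto
  also have "\<dots> = (\<Sum>x\<in>X - {inv a}. card (walks x s b))"
    by (intro sum.cong card_image) auto
  finally have "int (card (walks a (Suc s) b)) = (\<Sum>x\<in>X - {inv a}. \<alpha> s + (- 1) ^ s * ?\<delta> x)"
    using Suc by (simp add: of_nat_sum)
  also have "\<dots> = int (card (X - {inv a})) * \<alpha> s + (- 1) ^ s * (\<Sum>x\<in>X - {inv a}. ?\<delta> x)"
    by (simp add: sum.distrib sum_distrib_left)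
  also have "(\<Sum>x\<in>X - {inv a}. ?\<delta> x) = (\<Sum>x\<in>X. ?\<delta> x) - ?\<delta> (inv a)"
    using finite_X ia by (simp add: sum_diff1)
  also have "(\<Sum>x\<in>X. ?\<delta> x) = (\<Sum>x\<in>X. if x = iota s b then 1 else 0)"
    using iota_iff Suc.prems by (intro sum.cong) auto
  also have "\<dots> = 1" using finite_X iota_X Suc.prems by simp
  also have "int (card (X - {inv a})) = int (card X) - 1"
  proof -
    have "card X > 0" using finite_X ia card_gt_0_iff by blast
    thus ?thesis using finite_X ia by (simp add: of_nat_diff)
  qed
  also have "iota s (inv a) = iota (Suc s) a" using Suc.prems by (simp add: iota_def)
  finally show ?case by (simp add: algebra_simps)
qed

text \<open>Cyclically reduced words are closed walks, so the number is a trace. The trace of \<open>P\<^sup>s\<close> is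
  \<open>card X\<close> for even \<open>s\<close> and the number of involutions for odd \<open>s\<close>.\<close>

lemma card_cyc_words:
  assumes "s > 0" "card X = 2 * m + n" "card {x \<in> X. inv x = x} = n"
  shows "int (card (cyc_words s)) = (2 * int m + int n - 1) ^ s + (- 1) ^ s * (int m + int n - 1) + int m"
proof -
  have bij: "bij_betw (\<lambda>xs. (hd xs, tl xs @ [hd xs])) (cyc_words s) (Sigma X (\<lambda>a. walks a s a))"
  proof (rule bij_betw_byWitness[where f' = "\<lambda>(a, ws). a # butlast ws"])
    show "\<forall>xs\<in>cyc_words s. (\<lambda>(a, ws). a # butlast ws) (hd xs, tl xs @ [hd xs]) = xs"
      using assms(1) by (auto simp: cyc_words_def)
    show "\<forall>p\<in>Sigma X (\<lambda>a. walks a s a). (hd ((\<lambda>(a, ws). a # butlast ws) p),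
        tl ((\<lambda>(a, ws). a # butlast ws) p) @ [hd ((\<lambda>(a, ws). a # butlast ws) p)]) = p"
    proof
      fix p assume p: "p \<in> Sigma X (\<lambda>a. walks a s a)"
      obtain a ws where aw: "p = (a, ws)" by (cases p)
      hence "ws \<noteq> []" "last ws = a" using p assms(1) by (auto simp: walks_def split: if_splits)
      thus "(hd ((\<lambda>(a, ws). a # butlast ws) p),
        tl ((\<lambda>(a, ws). a # butlast ws) p) @ [hd ((\<lambda>(a, ws). a # butlast ws) p)]) = p"
        using aw append_butlast_last_id by fastforce
    qed
    show "(\<lambda>xs. (hd xs, tl xs @ [hd xs])) ` cyc_words s \<subseteq> Sigma X (\<lambda>a. walks a s a)"
    proof
      fix p assume "p \<in> (\<lambda>xs. (hd xs, tl xs @ [hd xs])) ` cyc_words s"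
      then obtain xs where xs: "xs \<in> cyc_words s" "p = (hd xs, tl xs @ [hd xs])" by blast
      then obtain a ws where "xs = a # ws" using assms(1) by (cases xs) (auto simp: cyc_words_def)
      thus "p \<in> Sigma X (\<lambda>a. walks a s a)" using xs by (auto simp: cyc_words_def walks_def)
    qed
    show "(\<lambda>(a, ws). a # butlast ws) ` Sigma X (\<lambda>a. walks a s a) \<subseteq> cyc_words s"
    proof
      fix xs assume "xs \<in> (\<lambda>(a, ws). a # butlast ws) ` Sigma X (\<lambda>a. walks a s a)"
      then obtain a ws where aw: "a \<in> X" "ws \<in> walks a s a" "xs = a # butlast ws" by auto
      hence ne: "ws \<noteq> []" and l: "last ws = a" using assms(1) by (auto simp: walks_def split: if_splits)
      have "butlast ws @ [a] = ws" using ne l append_butlast_last_id by fastforce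
      moreover have "set (butlast ws) \<subseteq> X" using aw(2) by (auto simp: walks_def dest: in_set_butlastD)
      ultimately show "xs \<in> cyc_words s" using aw ne by (auto simp: cyc_words_def walks_def)
    qed
  qed
  have "card (cyc_words s) = (\<Sum>a\<in>X. card (walks a s a))"
    using bij_betw_same_card[OF bij] finite_X finite_walks by (simp add: card_SigmaI)
  hence "int (card (cyc_words s)) = (\<Sum>a\<in>X. \<alpha> s + (- 1) ^ s * (if iota s a = a then 1 else 0))"
    using card_walks by (simp add: of_nat_sum)
  also have "\<dots> = int (card X) * \<alpha> s + (- 1) ^ s * int (card {a \<in> X. iota s a = a})"
    using finite_X by (simp add: sum.distrib sum_distrib_left[symmetric] sum.If_cases Int_def)
  also have "int (card X) * \<alpha> s = (int (card X) - 1) ^ s - (- 1) ^ s"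
    by (induction s) (auto simp: algebra_simps)
  also have "int (card {a \<in> X. iota s a = a}) = (if even s then 2 * int m + int n else int n)"
    using assms(2,3) by (simp add: iota_def)
  finally show ?thesis using assms(2) by (auto simp: algebra_simps)
qed

end

section \<open>The series of the classes with infinite cursor\<close>

lemma sum_divisor_pairs:
  fixes h :: "nat \<Rightarrow> nat \<Rightarrow> rat"
  assumes "\<And>r s. r * s > m \<Longrightarrow> h r s = 0"
  shows "(\<Sum>n\<in>{1..m}. \<Sum>s | s dvd n. h (n div s) s) = (\<Sum>r<m. \<Sum>s<m. h (Suc r) (Suc s))"
proof -
  let ?A = "Sigma {1..m} (\<lambda>n. {s. s dvd n})"
  let ?B = "{p \<in> {1..m} \<times> {1..m}. fst p * snd p \<le> m}"
  have fd: "finite {s. s dvd n}" if "n \<in> {1..m}" for n :: nat using that by (intro finite_divisors_nat) auto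
  have bij: "bij_betw (\<lambda>p. (fst p div snd p, snd p)) ?A ?B"
  proof (rule bij_betw_byWitness[where f' = "\<lambda>p. (fst p * snd p, snd p)"])
    show "(\<lambda>p. (fst p div snd p, snd p)) ` ?A \<subseteq> ?B"
    proof
      fix p assume "p \<in> (\<lambda>p. (fst p div snd p, snd p)) ` ?A"
      then obtain n s where p: "p = (n div s, s)" "n \<in> {1..m}" "s dvd n" by auto
      then obtain k where k: "n = s * k" by (elim dvdE)
      hence "s > 0" "k > 0" using p(2) by auto
      moreover from this have "s \<le> m" "k \<le> m" using k p(2) order.trans[of s n m] order.trans[of k n m] by auto
      ultimately show "p \<in> ?B" using p k by (auto simp: mult.commute)
    qed
    show "(\<lambda>p. (fst p * snd p, snd p)) ` ?B \<subseteq> ?A" by auto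
  qed auto
  have "(\<Sum>n\<in>{1..m}. \<Sum>s | s dvd n. h (n div s) s) = (\<Sum>p\<in>?A. h (fst p div snd p) (snd p))"
    using fd by (subst sum.Sigma) (auto simp: case_prod_unfold)
  also have "\<dots> = (\<Sum>p\<in>?B. h (fst p) (snd p))"
    using sum.reindex_bij_betw[OF bij, of "\<lambda>p. h (fst p) (snd p)"] by simp
  also have "\<dots> = (\<Sum>p\<in>{1..m} \<times> {1..m}. h (fst p) (snd p))"
  proof (intro sum.mono_neutral_left ballI)
    fix p assume "p \<in> {1..m} \<times> {1..m} - ?B"
    hence "fst p * snd p > m" by auto
    thus "h (fst p) (snd p) = 0" by (rule assms)
  qed auto
  also have "\<dots> = (\<Sum>r\<in>{1..m}. \<Sum>s\<in>{1..m}. h r s)"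
    by (simp add: sum.cartesian_product case_prod_unfold)
  also have "\<dots> = (\<Sum>r<m. \<Sum>s<m. h (Suc r) (Suc s))"
    by (simp add: sum.atLeast1_atMost_eq)
  finally show ?thesis .
qed

text \<open>The coefficient at \<open>n\<close> is already correct in every partial sum from the \<open>n\<close>-th on.\<close>

lemma fps_sums_nth:
  fixes f :: "nat \<Rightarrow> rat fps"
  assumes "\<And>s n. n \<le> s \<Longrightarrow> f s $ n = 0"
  shows "f sums Abs_fps (\<lambda>n. \<Sum>s<n. f s $ n)"
  unfolding sums_def
proof (rule tendsto_fpsI)
  fix n
  have "(\<Sum>s<k. f s) $ n = Abs_fps (\<lambda>n. \<Sum>s<n. f s $ n) $ n" if "k \<ge> n" for k
  proof -
    have "(\<Sum>s<k. f s $ n) = (\<Sum>s<n. f s $ n)"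
      using that assms by (intro sum.mono_neutral_right) auto
    thus ?thesis by (simp add: fps_sum_nth)
  qed
  thus "\<forall>\<^sub>F k in sequentially. (\<Sum>s<k. f s) $ n = Abs_fps (\<lambda>n. \<Sum>s<n. f s $ n) $ n"
    using eventually_at_top_linorder by blast
qed

context wreath_tree
begin

lemma compatible_iff_funs_on:
  assumes "x \<in> X" "f \<in> F" "fst u \<in> X"
  shows "compatible (x, f) u \<longleftrightarrow> adj x (fst u) \<and> f \<in> funs_on (X - {inv x, fst u})"
  using branches_diff2[OF X_inv[OF assms(1)] assms(3)] assms(2) supp_carrier
  by (auto simp: compatible_def adj_def funs_on_def)

definition words_over :: "'l list \<Rightarrow> 'l \<Rightarrow> ('l \<times> ('l \<Rightarrow> 'g)) list set" where
  "words_over xs y = {us. decorated us \<and> map fst us = xs \<and> chain us y}"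

text \<open>The series of one decorated letter: \<open>z\<close> for the edge of the cycle, \<open>\<sigma>\<close> for the vertex, and a factor
  for each tree that hangs there. It is \<open>F_E\<close> by \<open>gf_branch_funs\<close>.\<close>

definition letter_series :: "'l \<Rightarrow> rat fps" where
  "letter_series v = fps_X * \<sigma> * gf (branch_funs v) weight ^ (card X - 2)"

text \<open>Every label has \<open>card X - 2\<close> directions to spread into, because the two excluded ones differ by
  reducedness.\<close>

lemma gf_words_over:
  assumes "v \<in> X" "set xs \<subseteq> X" "y \<in> X" "successively adj (xs @ [y])"
  shows "gf (words_over xs y) total_weight = letter_series v ^ length xs \<and> fin_levels (words_over xs y) total_weight"
  using assms(2,4)
proof (induction xs)
  case Nil
  have "words_over [] y = {[]}" by (auto simp: words_over_def)
  thus ?case by (simp add: gf_singleton fin_levels_finite)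
next
  case (Cons x xs)
  define y' where "y' = hd (xs @ [y])"
  have x: "x \<in> X" "y' \<in> X" "adj x y'" using Cons.prems assms(3) by (auto simp: y'_def successively_Cons hd_append)
  let ?A = "funs_on (X - {inv x, y'})"
  have IH: "gf (words_over xs y) total_weight = letter_series v ^ length xs" "fin_levels (words_over xs y) total_weight"
    using Cons by (auto simp: successively_Cons)
  have compatible: "compatible (x, f) (if us = [] then (y, fone) else hd us) \<longleftrightarrow> f \<in> ?A"
    if "f \<in> F" "us \<in> words_over xs y" for f us
  proof -
    let ?u = "if us = [] then (y, fone) else hd us"
    have "fst ?u = y'" using that(2) by (cases us) (auto simp: words_over_def y'_def)
    thus ?thesis using compatible_iff_funs_on[OF x(1) that(1), of ?u] x by simp
  qed
  have bij: "bij_betw (\<lambda>p. (x, fst p) # snd p) (?A \<times> words_over xs y) (words_over (x # xs) y)"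
  proof (rule bij_betw_byWitness[where f' = "\<lambda>us. (snd (hd us), tl us)"])
    show "\<forall>us\<in>words_over (x # xs) y. (x, fst (snd (hd us), tl us)) # snd (snd (hd us), tl us) = us"
      by (auto simp: words_over_def)
    show "(\<lambda>p. (x, fst p) # snd p) ` (?A \<times> words_over xs y) \<subseteq> words_over (x # xs) y"
    proof
      fix us assume "us \<in> (\<lambda>p. (x, fst p) # snd p) ` (?A \<times> words_over xs y)"
      then obtain f ts where ft: "us = (x, f) # ts" "f \<in> ?A" "ts \<in> words_over xs y" by auto
      have "f \<in> F" using ft(2) by (simp add: funs_on_def)
      thus "us \<in> words_over (x # xs) y" using ft compatible[OF _ ft(3)] x(1)
        by (simp add: words_over_def chain_Cons)
    qed
    show "(\<lambda>us. (snd (hd us), tl us)) ` words_over (x # xs) y \<subseteq> ?A \<times> words_over xs y"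
    proof
      fix p assume "p \<in> (\<lambda>us. (snd (hd us), tl us)) ` words_over (x # xs) y"
      then obtain us where us: "us \<in> words_over (x # xs) y" "p = (snd (hd us), tl us)" by blast
      then obtain f ts where ft: "us = (x, f) # ts" by (cases us) (auto simp: words_over_def)
      have ts: "ts \<in> words_over xs y" "f \<in> F" using us(1) ft by (auto simp: words_over_def chain_Cons)
      have "compatible (x, f) (if ts = [] then (y, fone) else hd ts)" using us(1) ft by (auto simp: words_over_def chain_Cons)
      thus "p \<in> ?A \<times> words_over xs y" using compatible ts us(2) ft by simp
    qed
  qed auto
  let ?w = "\<lambda>p. weight (fst p) + total_weight (snd p)"
  have wl: "total_weight ((\<lambda>p. (x, fst p) # snd p) p) = 1 + ?w p" for p :: "('l \<Rightarrow> 'g) \<times> ('l \<times> ('l \<Rightarrow> 'g)) list" by simp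
  have flA: "fin_levels (?A \<times> words_over xs y) ?w" by (rule fin_levels_Times[OF fin_levels_funs_on IH(2)])
  have "fin_levels (?A \<times> words_over xs y) (\<lambda>p. 1 + ?w p)"
    by (rule fin_levels_subset[OF flA]) auto
  from fin_levels_bij[where w = "\<lambda>p. 1 + ?w p" and w' = total_weight, OF bij wl this] have fl: "fin_levels (words_over (x # xs) y) total_weight" .
  have "gf (words_over (x # xs) y) total_weight = gf (?A \<times> words_over xs y) (\<lambda>p. 1 + ?w p)"
    by (rule gf_bij[where w = "\<lambda>p. 1 + ?w p" and w' = total_weight, OF bij wl, symmetric])
  also have "\<dots> = fps_X * (gf ?A weight * gf (words_over xs y) total_weight)"
    by (simp only: gf_shift gf_Times[OF fin_levels_funs_on IH(2)] power_one_right)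
  also have "gf ?A weight = \<sigma> * gf (branch_funs v) weight ^ (card X - 2)"
  proof -
    have "inv x \<noteq> y'" using x(3) by (auto simp: adj_def)
    hence "card (X - {inv x, y'}) = card X - 2"
      using x X_inv finite_X by (simp add: card_Diff_subset)
    thus ?thesis using gf_funs_on[OF assms(1), of "X - {inv x, y'}"] by auto
  qed
  finally show ?case using fl IH(1) by (simp add: letter_series_def algebra_simps)
qed

lemma good_adj: "good us \<Longrightarrow> successively adj (map fst us @ [hd (map fst us)])"
proof -
  assume g: "good us"
  hence "successively (\<lambda>u v. adj (fst u) (fst v)) (us @ [hd us])"
    unfolding good_def by (auto elim!: successively_mono simp: compatible_def adj_def)
  hence "successively adj (map fst (us @ [hd us]))" unfolding successively_map .
  thus ?thesis using g by (simp add: hd_map good_def)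
qed

definition good_words :: "nat \<Rightarrow> ('l \<times> ('l \<Rightarrow> 'g)) list set" where
  "good_words s = {us. good us \<and> length us = s}"

lemma good_over: "xs \<noteq> [] \<Longrightarrow> {us. good us \<and> map fst us = xs} = words_over xs (hd xs)"
proof (intro subset_antisym subsetI)
  fix us assume "us \<in> {us. good us \<and> map fst us = xs}"
  thus "us \<in> words_over xs (hd xs)"
    using good_chain[of us] by (auto simp: words_over_def good_def hd_map)
next
  fix us assume xs: "xs \<noteq> []" and "us \<in> words_over xs (hd xs)"
  hence us: "decorated us" "map fst us = xs" "chain us (hd xs)" "us \<noteq> []" by (auto simp: words_over_def)
  hence "hd xs = fst (hd us)" by (auto simp: hd_map)
  hence "successively compatible (us @ [hd us])" using us(3)
    unfolding chain_def successively_append_iff by (auto simp: compatible_def)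
  thus "us \<in> {us. good us \<and> map fst us = xs}" using us by (simp add: good_def)
qed

lemma gf_good_words:
  assumes "v \<in> X" "s > 0"
  shows "gf (good_words s) total_weight = of_nat (card (cyc_words s)) * letter_series v ^ s" "fin_levels (good_words s) total_weight"
proof -
  have good_words: "good_words s = (\<Union>xs\<in>cyc_words s. words_over xs (hd xs))"
  proof -
    have "good_words s = (\<Union>xs\<in>cyc_words s. {us. good us \<and> map fst us = xs})"
    proof (intro subset_antisym subsetI)
      fix us assume us: "us \<in> good_words s"
      have "set (map fst us) \<subseteq> X" using us by (auto simp: good_words_def good_def decorated_def)
      hence "map fst us \<in> cyc_words s" using us good_adj[of us] by (simp add: good_words_def cyc_words_def)
      thus "us \<in> (\<Union>xs\<in>cyc_words s. {us. good us \<and> map fst us = xs})" using us by (auto simp: good_words_def)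
    qed (auto simp: good_words_def cyc_words_def)
    also have "\<dots> = (\<Union>xs\<in>cyc_words s. words_over xs (hd xs))"
    proof (rule SUP_cong[OF HOL.refl])
      fix xs assume "xs \<in> cyc_words s"
      hence "xs \<noteq> []" using assms(2) by (auto simp: cyc_words_def)
      thus "{us. good us \<and> map fst us = xs} = words_over xs (hd xs)" by (rule good_over)
    qed
    finally show ?thesis .
  qed
  have one: "gf (words_over xs (hd xs)) total_weight = letter_series v ^ s" "fin_levels (words_over xs (hd xs)) total_weight"
    if "xs \<in> cyc_words s" for xs
  proof -
    have c: "set xs \<subseteq> X" "hd xs \<in> X" "successively adj (xs @ [hd xs])" "length xs = s"
      using that assms(2) by (cases xs; auto simp: cyc_words_def)+
    from gf_words_over[OF assms(1) c(1,2,3)] c(4)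
    show "gf (words_over xs (hd xs)) total_weight = letter_series v ^ s" "fin_levels (words_over xs (hd xs)) total_weight" by auto
  qed
  have "gf (\<Union>xs\<in>cyc_words s. words_over xs (hd xs)) total_weight = (\<Sum>xs\<in>cyc_words s. gf (words_over xs (hd xs)) total_weight)
     \<and> fin_levels (\<Union>xs\<in>cyc_words s. words_over xs (hd xs)) total_weight"
    by (rule gf_UNION[OF finite_cyc_words]) (use one in \<open>auto simp: words_over_def\<close>)
  thus "gf (good_words s) total_weight = of_nat (card (cyc_words s)) * letter_series v ^ s" "fin_levels (good_words s) total_weight"
    unfolding good_words using one by auto
qed

lemma total_weight_ge_length: "length us \<le> total_weight us"
  by (induction us) auto

lemma total_weight_power_word: "total_weight (power_word r us) = r * total_weight us"
  by (induction r) auto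

lemma good_power_word:
  assumes "vs \<noteq> []" "r > 0" shows "good (power_word r vs) \<longleftrightarrow> good vs"
proof -
  obtain k where k: "r = Suc k" using assms by (cases r) auto
  have "decorated vs \<Longrightarrow> decorated (power_word k vs)" for k by (induction k) auto
  moreover have "hd (power_word r vs) = hd vs" using assms(1) k by simp
  ultimately show ?thesis
    using assms successively_power_word[OF assms, of compatible] k by (auto simp: good_def)
qed

text \<open>Rotation by \<open>i\<close> fixes a word of length \<open>n\<close> if and only if the word is a power of one of length
  \<open>s = gcd i n\<close>, and \<open>\<phi>(n/s)\<close> of the rotations belong to \<open>s\<close>.\<close>

lemma card_necklaces:
  assumes v: "v \<in> X" and n: "n > 0"
  shows "n * card ((\<lambda>us. conj_class W (Phi us)) ` {us \<in> good_words n. total_weight us = m}) =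
    (\<Sum>s | s dvd n. totient (n div s) * card {vs \<in> good_words s. (n div s) * total_weight vs = m})"
proof -
  let ?U = "{us \<in> good_words n. total_weight us = m}"
  define P where "P = (\<lambda>g. card {us \<in> ?U. rotate g us = us})"
  have lenU: "length us = n" if "us \<in> ?U" for us using that by (simp add: good_words_def)
  have "n * card ((\<lambda>us. conj_class W (Phi us)) ` ?U) = (\<Sum>i<n. P i)"
    unfolding P_def
  proof (rule rotation_burnside[symmetric])
    show "finite ?U" using gf_good_words(2)[OF v n] by (simp add: fin_levels_def)
    show "rotate i us \<in> ?U" if "us \<in> ?U" for us i
      using that good_rotate by (simp add: good_words_def)
    show "conj_class W (Phi us) = conj_class W (Phi vs) \<longleftrightarrow> (\<exists>m. vs = rotate m us)"
      if "us \<in> ?U" "vs \<in> ?U" for us vs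
      using that conj_class_Phi_eq_iff by (simp add: good_words_def)
  qed (use n lenU in auto)
  also have "\<dots> = (\<Sum>i\<in>{0<..n}. P i)"
  proof -
    have "{us \<in> ?U. rotate n us = us} = {us \<in> ?U. rotate 0 us = us}" using lenU by auto
    hence "P n = P 0" unfolding P_def by simp
    moreover have "{..<n} = insert 0 {0<..<n}" "{0<..n} = insert n {0<..<n}" using n by auto
    ultimately show ?thesis by simp
  qed
  also have "\<dots> = (\<Sum>i\<in>{0<..n}. P (gcd i n))"
  proof (rule sum.cong[OF HOL.refl])
    fix i assume "i \<in> {0<..n}"
    hence "{us \<in> ?U. rotate i us = us} = {us \<in> ?U. rotate (gcd i n) us = us}"
      using lenU rotate_gcd_iff by (metis (no_types, lifting) greaterThanAtMost_iff)
    thus "P i = P (gcd i n)" by (simp add: P_def)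
  qed
  also have "\<dots> = (\<Sum>s | s dvd n. \<Sum>i\<in>{i \<in> {0<..n}. gcd i n = s}. P (gcd i n))"
    using n by (intro sum.group[symmetric]) auto
  also have "\<dots> = (\<Sum>s | s dvd n. totient (n div s) * P s)"
  proof (rule sum.cong[OF HOL.refl])
    fix s assume s: "s \<in> {s. s dvd n}"
    have "(\<Sum>i\<in>{i \<in> {0<..n}. gcd i n = s}. P (gcd i n)) = (\<Sum>i\<in>{i \<in> {0<..n}. gcd i n = s}. P s)"
      by (rule sum.cong) auto
    thus "(\<Sum>i\<in>{i \<in> {0<..n}. gcd i n = s}. P (gcd i n)) = totient (n div s) * P s"
      using card_gcd_eq_totient[OF n, of s] s by simp
  qed
  also have "\<dots> = (\<Sum>s | s dvd n. totient (n div s) * card {vs \<in> good_words s. (n div s) * total_weight vs = m})"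
  proof (rule sum.cong[OF HOL.refl])
    fix s assume "s \<in> {s. s dvd n}"
    hence s: "s dvd n" by simp
    let ?r = "n div s"
    have r: "?r > 0" "s > 0" "?r * s = n" using s n by (auto elim!: dvdE)
    have "bij_betw (power_word ?r) {vs \<in> good_words s. ?r * total_weight vs = m} {us \<in> ?U. rotate s us = us}"
    proof -
      note b = bij_betw_power_word[OF r(2,1), where 'a = "'l \<times> ('l \<Rightarrow> 'g)"]
      have inj: "inj_on (power_word ?r) {vs \<in> good_words s. ?r * total_weight vs = m}"
        by (rule inj_on_subset[OF bij_betw_imp_inj_on[OF b]]) (auto simp: good_words_def)
      have "power_word ?r ` {vs \<in> good_words s. ?r * total_weight vs = m} = {us \<in> ?U. rotate s us = us}"
      proof (intro subset_antisym subsetI)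
        fix us assume "us \<in> power_word ?r ` {vs \<in> good_words s. ?r * total_weight vs = m}"
        then obtain vs where vs: "us = power_word ?r vs" "good vs" "length vs = s" "?r * total_weight vs = m"
          by (auto simp: good_words_def)
        have "vs \<noteq> []" using vs by (simp add: good_def)
        hence "good us" using good_power_word r vs by blast
        moreover have "length us = n" "total_weight us = m" using vs r by (auto simp: total_weight_power_word)
        moreover have "rotate s us = us" using bij_betwE[OF b] vs(1,3) by blast
        ultimately show "us \<in> {us \<in> ?U. rotate s us = us}" by (simp add: good_words_def)
      next
        fix us assume us: "us \<in> {us \<in> ?U. rotate s us = us}"
        hence "us \<in> {us. length us = ?r * s \<and> rotate s us = us}" using r by (simp add: good_words_def)
        then obtain vs where vs: "length vs = s" "us = power_word ?r vs"
          using bij_betw_imp_surj_on[OF b] by blast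
        have "vs \<noteq> []" using vs r by auto
        hence "good vs" using good_power_word r vs us by (auto simp: good_words_def)
        thus "us \<in> power_word ?r ` {vs \<in> good_words s. ?r * total_weight vs = m}"
          using vs us by (auto simp: good_words_def total_weight_power_word)
      qed
      thus ?thesis using inj by (simp add: bij_betw_def)
    qed
    from bij_betw_same_card[OF this] show "totient ?r * P s = totient ?r * card {vs \<in> good_words s. ?r * total_weight vs = m}"
      by (simp add: P_def)
  qed
  finally show ?thesis .
qed

text \<open>A good word has at most as many letters as its weight, which bounds the outer sum.\<close>

lemma conj_contribution_nth:
  assumes v: "v \<in> X"
  shows "conj_contribution W Z (infinite_cursor_classes G L) $ m =
    (\<Sum>n\<in>{1..m}. \<Sum>s | s dvd n. of_nat (totient (n div s)) / of_nat n *
       of_nat (card {vs \<in> good_words s. (n div s) * total_weight vs = m}))"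
proof -
  let ?q = "\<lambda>us. conj_class W (Phi us)"
  let ?U = "\<lambda>n :: nat. {us \<in> good_words n. total_weight us = m}"
  have "{C \<in> infinite_cursor_classes G L. class_length W Z C = m} = (\<Union>n\<in>{1..m}. ?q ` ?U n)"
  proof -
    have "{C \<in> infinite_cursor_classes G L. class_length W Z C = m} = ?q ` {us. good us \<and> total_weight us = m}"
      unfolding infinite_cursor_classes_eq using class_length_Phi by auto
    moreover have "{us. good us \<and> total_weight us = m} = (\<Union>n\<in>{1..m}. ?U n)"
    proof -
      have "length us \<in> {1..m}" if "good us" "total_weight us = m" for us
        using that total_weight_ge_length[of us] by (cases us) (auto simp: good_def)
      thus ?thesis by (auto simp: good_words_def)
    qed
    ultimately show ?thesis by auto
  qed
  moreover have "card (\<Union>n\<in>{1..m}. ?q ` ?U n) = (\<Sum>n\<in>{1..m}. card (?q ` ?U n))"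
  proof (rule card_UN_disjoint)
    show "\<forall>n\<in>{1..m}. finite (?q ` ?U n)" using gf_good_words(2)[OF v] by (auto simp: fin_levels_def)
    show "\<forall>n\<in>{1..m}. \<forall>n'\<in>{1..m}. n \<noteq> n' \<longrightarrow> ?q ` ?U n \<inter> ?q ` ?U n' = {}"
    proof (intro ballI impI)
      fix n n' :: nat assume nn: "n \<noteq> n'"
      show "?q ` ?U n \<inter> ?q ` ?U n' = {}"
      proof (rule ccontr)
        assume "?q ` ?U n \<inter> ?q ` ?U n' \<noteq> {}"
        then obtain us vs where uv: "us \<in> good_words n" "vs \<in> good_words n'" "?q us = ?q vs" by blast
        then obtain k where "vs = rotate k us" using conj_class_Phi_eq_iff by (auto simp: good_words_def)
        thus False using uv nn by (simp add: good_words_def)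
      qed
    qed
  qed simp
  ultimately have "conj_contribution W Z (infinite_cursor_classes G L) $ m = (\<Sum>n\<in>{1..m}. of_nat (card (?q ` ?U n)))"
    by (simp add: conj_contribution_def)
  also have "\<dots> = (\<Sum>n\<in>{1..m}. \<Sum>s | s dvd n. of_nat (totient (n div s)) / of_nat n *
       of_nat (card {vs \<in> good_words s. (n div s) * total_weight vs = m}))"
  proof (rule sum.cong[OF HOL.refl])
    fix n assume "n \<in> {1..m}"
    hence n: "n > 0" by simp
    have "(of_nat n :: rat) * of_nat (card (?q ` ?U n)) =
      (\<Sum>s | s dvd n. of_nat (totient (n div s)) * of_nat (card {vs \<in> good_words s. (n div s) * total_weight vs = m}))"
      using arg_cong[OF card_necklaces[OF v n, of m], of "of_nat :: nat \<Rightarrow> rat"] by simp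
    hence "(of_nat (card (?q ` ?U n)) :: rat) =
      (\<Sum>s | s dvd n. of_nat (totient (n div s)) * of_nat (card {vs \<in> good_words s. (n div s) * total_weight vs = m})) / of_nat n"
      using n by (simp add: field_simps)
    thus "of_nat (card (?q ` ?U n)) = (\<Sum>s | s dvd n. of_nat (totient (n div s)) / of_nat n *
       (of_nat (card {vs \<in> good_words s. (n div s) * total_weight vs = m}) :: rat))"
      by (simp add: sum_divide_distrib)
  qed
  finally show ?thesis .
qed

lemma necklace_term:
  assumes "v \<in> X" "r > 0" "s > 0"
  shows "(fps_const (of_nat (card (cyc_words s)) / of_nat s) * (letter_series v oo fps_X ^ r) ^ s) $ m =
    of_nat (card {vs \<in> good_words s. r * total_weight vs = m}) / of_nat s"
proof -
  have X0: "(fps_X ^ r :: rat fps) $ 0 = 0" using assms(2) by simp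
  have "gf (good_words s) (\<lambda>us. r * total_weight us) = fps_const (of_nat (card (cyc_words s))) * (letter_series v oo fps_X ^ r) ^ s"
    unfolding gf_scale[OF assms(2)] gf_good_words(1)[OF assms(1,3)]
    by (simp add: fps_compose_mult_distrib[OF X0] fps_compose_power[OF X0] fps_of_nat[symmetric])
  from arg_cong[OF this, of "\<lambda>f. f $ m"] show ?thesis
    by (simp add: gf_nth)
qed

text \<open>Both sums are rearrangements of the sum over \<open>n\<close> and its divisors \<open>s\<close>, with \<open>r = n/s\<close>: the term
  \<open>A r s\<close> starts in degree at least \<open>r s\<close>, so the sums converge coefficientwise.\<close>

lemma infinite_cursor_series:
  fixes c :: "nat \<Rightarrow> rat"
  assumes v: "v \<in> X" and c: "\<And>s. s > 0 \<Longrightarrow> c s = of_nat (card (cyc_words s))"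
  defines "A \<equiv> \<lambda>r s. fps_const (c s / of_nat s) * (letter_series v oo fps_X ^ r) ^ s"
  shows "(\<forall>r\<ge>1. summable (\<lambda>s. A r (Suc s))) \<and>
     (\<lambda>r. fps_const (of_nat (totient (Suc r)) / of_nat (Suc r)) * (\<Sum>s. A (Suc r) (Suc s)))
       sums conj_contribution W Z (infinite_cursor_classes G L)"
proof -
  define a where "a = (\<lambda>m r s. card {vs \<in> good_words s. r * total_weight vs = m})"
  have A: "A r s $ m = of_nat (a m r s) / of_nat s" if "r > 0" "s > 0" for r s m
    unfolding A_def a_def c[OF that(2)] by (rule necklace_term[OF v that])
  have a0: "a m r s = 0" if "m < r * s" for m r s
  proof -
    have "r * s \<le> r * total_weight vs" if "vs \<in> good_words s" for vs
      using that total_weight_ge_length[of vs] by (simp add: good_words_def)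
    hence "{vs \<in> good_words s. r * total_weight vs = m} = {}" using that by fastforce
    thus ?thesis by (simp only: a_def card.empty)
  qed
  have in_sums: "(\<lambda>s. A r (Suc s)) sums Abs_fps (\<lambda>n. \<Sum>s<n. A r (Suc s) $ n)" if r: "r > 0" for r
  proof (rule fps_sums_nth)
    fix s n :: nat assume "n \<le> s"
    hence "n < r * Suc s" using r by (metis One_nat_def Suc_leI le_imp_less_Suc less_le_trans mult.left_neutral mult_le_mono1)
    thus "A r (Suc s) $ n = 0" using A[OF r, of "Suc s" n] a0 by simp
  qed
  have inner: "(\<Sum>s. A (Suc r) (Suc s)) $ n = (\<Sum>s<n. of_nat (a n (Suc r) (Suc s)) / of_nat (Suc s))" for r n
  proof -
    have "(\<Sum>s. A (Suc r) (Suc s)) = Abs_fps (\<lambda>n. \<Sum>s<n. A (Suc r) (Suc s) $ n)"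
      by (rule sums_unique[OF in_sums, symmetric]) simp
    from arg_cong[OF this, of "\<lambda>f. f $ n"] show ?thesis
      by (simp only: fps_nth_Abs_fps A[OF zero_less_Suc zero_less_Suc])
  qed
  let ?B = "\<lambda>r. fps_const (of_nat (totient (Suc r)) / of_nat (Suc r)) * (\<Sum>s. A (Suc r) (Suc s))"
  have B: "?B r $ n = (\<Sum>s<n. of_nat (totient (Suc r)) / of_nat (Suc r) *
      (of_nat (a n (Suc r) (Suc s)) / of_nat (Suc s)))" for r n
    by (simp only: fps_mult_left_const_nth inner sum_distrib_left)
  have "?B sums Abs_fps (\<lambda>n. \<Sum>r<n. ?B r $ n)"
  proof (rule fps_sums_nth)
    fix r n :: nat assume rn: "n \<le> r"
    have "a n (Suc r) (Suc s) = 0" for s using rn by (intro a0) (simp add: less_Suc_eq_le trans_le_add1)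
    thus "?B r $ n = 0" unfolding B by simp
  qed
  also have "Abs_fps (\<lambda>n. \<Sum>r<n. ?B r $ n) = conj_contribution W Z (infinite_cursor_classes G L)"
  proof (rule fps_ext)
    fix m
    define h where "h = (\<lambda>r s. of_nat (totient r) / of_nat r * (of_nat (a m r s) / of_nat s) :: rat)"
    have "Abs_fps (\<lambda>n. \<Sum>r<n. ?B r $ n) $ m = (\<Sum>r<m. \<Sum>s<m. h (Suc r) (Suc s))"
      by (simp only: B h_def fps_nth_Abs_fps)
    also have "\<dots> = (\<Sum>n\<in>{1..m}. \<Sum>s | s dvd n. h (n div s) s)"
      by (rule sum_divisor_pairs[symmetric]) (simp add: h_def a0)
    also have "\<dots> = conj_contribution W Z (infinite_cursor_classes G L) $ m"
      unfolding conj_contribution_nth[OF v]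
    proof (intro sum.cong HOL.refl)
      fix n s assume "n \<in> {1..m}" and s: "s \<in> {s. s dvd n}"
      hence "n = n div s * s" by simp
      hence "(of_nat n :: rat) = of_nat (n div s) * of_nat s" by (metis of_nat_mult)
      thus "h (n div s) s = of_nat (totient (n div s)) / of_nat n * of_nat (card {vs \<in> good_words s. n div s * total_weight vs = m})"
        by (simp add: h_def a_def)
    qed
    finally show "Abs_fps (\<lambda>n. \<Sum>r<n. ?B r $ n) $ m = conj_contribution W Z (infinite_cursor_classes G L) $ m" .
  qed
  finally have "?B sums conj_contribution W Z (infinite_cursor_classes G L)" .
  moreover have "summable (\<lambda>s. A r (Suc s))" if "r \<ge> 1" for r
    using sums_summable[OF in_sums] that by simp
  ultimately show ?thesis by blast
qed

end

theorem proposition4p2: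
  fixes M N :: nat
    and G :: "('g, 'c) monoid_scheme" and Y :: "'g set"
    and v :: "lgen gword set"
  assumes "2 * M + N \<ge> 2"
    and "group G" and "finite Y" and "symmetric_generating_set G Y"
    and "v \<in> L_gens M N"
  shows "let A = (\<lambda>r s. fps_const
              (((2 * of_nat M + of_nat N - 1) ^ s + (- 1) ^ s * (of_nat M + of_nat N - 1) + of_nat M)
                / of_nat s)
            * (fps_compose (F_E M N v G Y) (fps_X ^ r)) ^ s)
    in (\<forall>r\<ge>1. summable (\<lambda>s. A r (Suc s))) \<and>
       (\<lambda>r. fps_const (of_nat (totient (Suc r)) / of_nat (Suc r)) * (\<Sum>s. A (Suc r) (Suc s)))
         sums conj_contribution (wreath G (L_group M N))
                (wreath_gens G (L_group M N) Y (L_gens M N))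
                (infinite_cursor_classes G (L_group M N))"
proof -
  interpret wreath_tree "L_group M N" "L_gens M N" G Y
    by (intro wreath_tree.intro L_tree_group wreath_tree_axioms.intro assms)
  have FE: "F_E M N v G Y = letter_series v"
    using gf_branch_funs[OF assms(5)] by (simp add: F_E_def F_T_def letter_series_def card_L_gens Let_def)
  have c: "(2 * of_nat M + of_nat N - 1) ^ s + (- 1) ^ s * (of_nat M + of_nat N - 1) + of_nat M =
      (of_nat (card (cyc_words s)) :: rat)" if "s > 0" for s
    using arg_cong[OF card_cyc_words[OF that card_L_gens card_L_involutions], of "of_int :: int \<Rightarrow> rat"]
    by simp
  show ?thesis
    unfolding Let_def FE by (rule infinite_cursor_series[OF assms(5) c])
qed

end
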